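(* Let $X=\{X(t):t\in\mathbb R\}$ be a centered Gaussian process with stationary increments, $X(0)=0$, continuous sample paths and variance function $\sigma^2(t)=\operatorname{Var}X(t)$. Suppose that $\sigma$ is regularly varying at zero with parameter $\lambda\in(0,1)$ and regularly varying at infinity with parameter $\alpha\in(0,1)$. With $\delta(c):=\inf\{x>0: x/\sigma(x)=1/c\}$, $$\frac{Q^{(c)}_X(\delta(c)\,\cdot)}{\sigma(\delta(c))}\xrightarrow{d} Q^{(1)}_{B_\lambda}(\cdot)\quad\text{as } c\to\infty,$$ in $C[0,\infty)$, where $B_\lambda$ is fractional Brownian motion with Hurst parameter $\lambda$.
   Context: Regular variation: a non-negative measurable function $f$ on $[0,\infty)$ is regularly varying at infinity with parameter $\alpha$ if $f(tx)/f(x)\to t^\alpha$ as $x\to\infty$ for all $t>0$; it is regularly varying at zero with parameter $\lambda$ if $f(tx)/f(x)\to t^\lambda$ as $x\to0$ for all $t>0$. For a centered Gaussian process $Y=\{Y(t):t\in\mathbb R\}$ with stationary increments, $Y(0)=0$ and continuous sample paths, and for $c>0$, the stationary buffer content process is $$Q_Y^{(c)}(t)=\sup_{-\infty<s\le t}\bigl(Y(t)-Y(s)-c(t-s)\bigr),\qquad t\ge0.$$ Fractional Brownian motion $B_H=\{B_H(t):t\in\mathbb R\}$ with Hurst parameter $H\in(0,1)$ is the centered Gaussian process with stationary increments, continuous sample paths, $B_H(0)=0$ and covariance $\mathrm{Cov}(B_H(t),B_H(s))=\tfrac12(|s|^{2H}+|t|^{2H}-|t-s|^{2H})$. The function $\delta$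 satisfies $c\,\delta(c)/\sigma(\delta(c))=1$ for every $c>0$. $C[0,\infty)$ is the space of continuous functions $[0,\infty)\to\mathbb R$ with the topology of uniform convergence on compact intervals $[0,T]$, $T>0$; $\xrightarrow{d}$ denotes weak convergence (convergence in distribution) of random elements of this space. *)

theory Defs
  imports "HOL-Probability.Probability"
begin

section \<open>Regular variation\<close>

text \<open>
  With \<open>x / 0 = 0\<close>, the limits below (which are positive) force \<open>f\<close> to be
  nonzero near infinity, respectively to the right of zero.
\<close>

definition regularly_varying_at_infinity :: "(real \<Rightarrow> real) \<Rightarrow> real \<Rightarrow> bool" where
  "regularly_varying_at_infinity f \<alpha> \<longleftrightarrow>
     f \<in> borel_measurable (restrict_space borel {0..}) \<and> (\<forall>x\<ge>0. 0 \<le> f x) \<and>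
     (\<forall>t>0. ((\<lambda>x. f (t * x) / f x) \<longlongrightarrow> t powr \<alpha>) at_top)"

definition regularly_varying_at_zero :: "(real \<Rightarrow> real) \<Rightarrow> real \<Rightarrow> bool" where
  "regularly_varying_at_zero f \<alpha> \<longleftrightarrow>
     f \<in> borel_measurable (restrict_space borel {0..}) \<and> (\<forall>x\<ge>0. 0 \<le> f x) \<and>
     (\<forall>t>0. ((\<lambda>x. f (t * x) / f x) \<longlongrightarrow> t powr \<alpha>) (at_right 0))"


section \<open>Gaussian processes\<close>

text \<open>Normal laws include the degenerate ones (point masses).\<close>

definition gaussian_variable :: "'a measure \<Rightarrow> ('a \<Rightarrow> real) \<Rightarrow> bool" where
  "gaussian_variable M Z \<longleftrightarrow> Z \<in> borel_measurable M \<and>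
     ((\<exists>\<mu> s. 0 < s \<and> distributed M lborel Z (normal_density \<mu> s)) \<or>
      (\<exists>\<mu>. AE \<omega> in M. Z \<omega> = \<mu>))"

definition gaussian_process :: "'a measure \<Rightarrow> (real \<Rightarrow> 'a \<Rightarrow> real) \<Rightarrow> bool" where
  "gaussian_process M Y \<longleftrightarrow>
     (\<forall>J a. finite J \<longrightarrow> gaussian_variable M (\<lambda>\<omega>. \<Sum>t\<in>J. a t * Y t \<omega>))"

definition centered :: "'a measure \<Rightarrow> (real \<Rightarrow> 'a \<Rightarrow> real) \<Rightarrow> bool" where
  "centered M Y \<longleftrightarrow> (\<forall>t. (\<integral>\<omega>. Y t \<omega> \<partial>M) = 0)"

definition stationary_increments :: "'a measure \<Rightarrow> (real \<Rightarrow> 'a \<Rightarrow> real) \<Rightarrow> bool" where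
  "stationary_increments M Y \<longleftrightarrow>
     (\<forall>h J. finite J \<longrightarrow>
        distr M (Pi\<^sub>M J (\<lambda>_. borel)) (\<lambda>\<omega>. \<lambda>t\<in>J. Y (t + h) \<omega> - Y h \<omega>) =
        distr M (Pi\<^sub>M J (\<lambda>_. borel)) (\<lambda>\<omega>. \<lambda>t\<in>J. Y t \<omega> - Y 0 \<omega>))"

definition continuous_paths :: "'a measure \<Rightarrow> (real \<Rightarrow> 'a \<Rightarrow> real) \<Rightarrow> bool" where
  "continuous_paths M Y \<longleftrightarrow> (\<forall>\<omega>\<in>space M. continuous_on UNIV (\<lambda>t. Y t \<omega>))"

definition gaussian_stationary_increments ::
    "'a measure \<Rightarrow> (real \<Rightarrow> 'a \<Rightarrow> real) \<Rightarrow> bool" where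
  "gaussian_stationary_increments M Y \<longleftrightarrow>
     gaussian_process M Y \<and> centered M Y \<and> stationary_increments M Y \<and>
     (\<forall>\<omega>\<in>space M. Y 0 \<omega> = 0) \<and> continuous_paths M Y"

definition covariance :: "'a measure \<Rightarrow> ('a \<Rightarrow> real) \<Rightarrow> ('a \<Rightarrow> real) \<Rightarrow> real" where
  "covariance M U V =
     (\<integral>\<omega>. (U \<omega> - (\<integral>\<eta>. U \<eta> \<partial>M)) * (V \<omega> - (\<integral>\<eta>. V \<eta> \<partial>M)) \<partial>M)"

definition fractional_brownian_motion ::
    "'a measure \<Rightarrow> real \<Rightarrow> (real \<Rightarrow> 'a \<Rightarrow> real) \<Rightarrow> bool" where
  "fractional_brownian_motion M H B \<longleftrightarrow>
     0 < H \<and> H < 1 \<and> gaussian_stationary_increments M B \<and>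
     (\<forall>t s. covariance M (B t) (B s) =
        (\<bar>s\<bar> powr (2 * H) + \<bar>t\<bar> powr (2 * H) - \<bar>t - s\<bar> powr (2 * H)) / 2)"

definition std_function :: "'a measure \<Rightarrow> (real \<Rightarrow> 'a \<Rightarrow> real) \<Rightarrow> real \<Rightarrow> real" where
  "std_function M Y t = sqrt (prob_space.variance M (Y t))"


section \<open>Buffer content and scaling function\<close>

text \<open>
  For a path along which the supremum is infinite, \<open>SUP\<close> returns an unspecified real.
  For continuous paths, infiniteness does not depend on \<open>t\<close>, and that real
  does not either, so the path of the buffer process is then constant.
\<close>

definition buffer_content ::
    "(real \<Rightarrow> 'a \<Rightarrow> real) \<Rightarrow> real \<Rightarrow> real \<Rightarrow> 'a \<Rightarrow> real" where
  "buffer_content Y c t \<omega> = (SUP s\<in>{..t}. Y t \<omega> - Y s \<omega> - c * (t - s))"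

definition scaling :: "(real \<Rightarrow> real) \<Rightarrow> real \<Rightarrow> real" where
  "scaling \<sigma> c = Inf {x. 0 < x \<and> x / \<sigma> x = 1 / c}"


section \<open>Convergence in distribution\<close>

text \<open>
  An element of \<open>C[0,\<infinity>)\<close> is represented by a function that is continuous on
  \<open>{0..}\<close> and takes the value \<open>undefined\<close> outside.
\<close>

definition cont_paths :: "(real \<Rightarrow> real) set" where
  "cont_paths = {f \<in> extensional {0..}. continuous_on {0..} f}"

definition cont_path_topology :: "(real \<Rightarrow> real) topology" where
  "cont_path_topology = topology (\<lambda>U. U \<subseteq> cont_paths \<and>
     (\<forall>f\<in>U. \<exists>T>0. \<exists>e>0. \<forall>g\<in>cont_paths. (\<forall>t\<in>{0..T}. \<bar>g t - f t\<bar> < e) \<longrightarrow> g \<in> U))"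

lemma openin_cont_path_topology:
  "openin cont_path_topology U \<longleftrightarrow> U \<subseteq> cont_paths \<and>
     (\<forall>f\<in>U. \<exists>T>0. \<exists>e>0. \<forall>g\<in>cont_paths. (\<forall>t\<in>{0..T}. \<bar>g t - f t\<bar> < e) \<longrightarrow> g \<in> U)"
proof -
  define L where "L = (\<lambda>U. U \<subseteq> cont_paths \<and>
     (\<forall>f\<in>U. \<exists>T>0. \<exists>e>0. \<forall>g\<in>cont_paths. (\<forall>t\<in>{0..T}. \<bar>g t - f t\<bar> < e) \<longrightarrow> g \<in> U))"
  have "istopology L"
    unfolding istopology_def
  proof (intro conjI allI impI)
    fix U V assume U: "L U" and V: "L V"
    have "\<exists>T>0. \<exists>e>0. \<forall>g\<in>cont_paths. (\<forall>t\<in>{0..T}. \<bar>g t - f t\<bar> < e) \<longrightarrow> g \<in> U \<inter> V"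
      if f: "f \<in> U \<inter> V" for f
    proof -
      obtain T1 e1 where 1: "T1 > 0" "e1 > 0"
          "\<forall>g\<in>cont_paths. (\<forall>t\<in>{0..T1}. \<bar>g t - f t\<bar> < e1) \<longrightarrow> g \<in> U"
        using U f unfolding L_def by blast
      obtain T2 e2 where 2: "T2 > 0" "e2 > 0"
          "\<forall>g\<in>cont_paths. (\<forall>t\<in>{0..T2}. \<bar>g t - f t\<bar> < e2) \<longrightarrow> g \<in> V"
        using V f unfolding L_def by blast
      have "\<forall>g\<in>cont_paths. (\<forall>t\<in>{0..max T1 T2}. \<bar>g t - f t\<bar> < min e1 e2) \<longrightarrow> g \<in> U \<inter> V"
      proof (intro ballI impI)
        fix g assume g: "g \<in> cont_paths" "\<forall>t\<in>{0..max T1 T2}. \<bar>g t - f t\<bar> < min e1 e2"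
        have "\<forall>t\<in>{0..T1}. \<bar>g t - f t\<bar> < e1" "\<forall>t\<in>{0..T2}. \<bar>g t - f t\<bar> < e2"
          using g(2) by (auto simp: le_max_iff_disj)
        then show "g \<in> U \<inter> V" using g(1) 1(3) 2(3) by blast
      qed
      moreover have "max T1 T2 > 0" "min e1 e2 > 0" using 1 2 by auto
      ultimately show ?thesis by blast
    qed
    then show "L (U \<inter> V)" using U unfolding L_def by auto
  next
    fix K assume K: "\<forall>U\<in>K. L U"
    have "\<exists>T>0. \<exists>e>0. \<forall>g\<in>cont_paths. (\<forall>t\<in>{0..T}. \<bar>g t - f t\<bar> < e) \<longrightarrow> g \<in> \<Union>K"
      if f: "f \<in> \<Union>K" for f
    proof -
      obtain U where U: "U \<in> K" "f \<in> U" using f by blast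
      then obtain T e where "T > 0" "e > 0"
          "\<forall>g\<in>cont_paths. (\<forall>t\<in>{0..T}. \<bar>g t - f t\<bar> < e) \<longrightarrow> g \<in> U"
        using K unfolding L_def by blast
      then show ?thesis using U by blast
    qed
    moreover have "\<Union>K \<subseteq> cont_paths" using K unfolding L_def by blast
    ultimately show "L (\<Union>K)" unfolding L_def by blast
  qed
  then show ?thesis
    unfolding cont_path_topology_def L_def by simp
qed

lemma topspace_cont_path_topology [simp]: "topspace cont_path_topology = cont_paths"
proof
  show "topspace cont_path_topology \<subseteq> cont_paths"
    unfolding topspace_def openin_cont_path_topology by auto
  have "openin cont_path_topology cont_paths"
    unfolding openin_cont_path_topology by (auto intro!: exI[of _ "1::real"])
  then show "cont_paths \<subseteq> topspace cont_path_topology"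
    by (rule openin_subset)
qed

definition borel_of_topology :: "'e topology \<Rightarrow> 'e measure" where
  "borel_of_topology T = sigma (topspace T) {U. openin T U}"

definition converges_in_distribution ::
    "'e topology \<Rightarrow> 'a measure \<Rightarrow> ('c \<Rightarrow> 'a \<Rightarrow> 'e) \<Rightarrow> 'c filter \<Rightarrow>
     'b measure \<Rightarrow> ('b \<Rightarrow> 'e) \<Rightarrow> bool" where
  "converges_in_distribution T M Y F N Z \<longleftrightarrow>
     (\<forall>\<^sub>F c in F. Y c \<in> M \<rightarrow>\<^sub>M borel_of_topology T) \<and>
     Z \<in> N \<rightarrow>\<^sub>M borel_of_topology T \<and>
     (\<forall>\<phi> :: 'e \<Rightarrow> real.
        continuous_map T euclideanreal \<phi> \<and> bounded (\<phi> ` topspace T) \<longrightarrow>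
        ((\<lambda>c. \<integral>\<omega>. \<phi> (Y c \<omega>) \<partial>M) \<longlongrightarrow> (\<integral>\<omega>. \<phi> (Z \<omega>) \<partial>N)) F)"

end

theory Submission
  imports Defs
begin

text \<open>
  Put \<open>d = \<delta> c\<close> and \<open>Y t = X (d t) / \<sigma> d\<close>.  Since \<open>c d = \<sigma> d\<close>, the
  substitution \<open>s = d u\<close> turns the rescaled buffer content into the buffer content of
  \<open>Y\<close> with unit drift, and \<open>d\<close> tends to zero as \<open>c\<close> grows.  So everything
  reduces to the convergence of \<open>Y\<close> to fractional Brownian motion, in a sense strong enough
  for a functional that looks at the whole past.

  The law of a centered Gaussian process with stationary increments is determined by the
  standard deviations of its increments; for \<open>Y\<close> these are \<open>\<sigma> (d h) / \<sigma> d\<close>,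
  which tend to \<open>h powr lam\<close> by regular variation at zero.  Hence the finite-dimensional
  characteristic functions converge (\<open>characteristic_tendsto\<close>).

  Tightness is uniform control of the paths of \<open>Y\<close>.  Comparing \<open>\<sigma>\<close> along doublings of
  its argument gives, for all small \<open>d\<close>, a bound of order \<open>2\<^sup>-\<^sup>\<gamma>\<^sup>m\<close> for the standard
  deviation of increments over \<open>2\<^sup>-\<^sup>m\<close> and a bound of order \<open>n\<^sup>\<beta>\<close> with
  \<open>\<beta> < 1\<close> over \<open>n\<close> (\<open>std_bounds_near_zero\<close>).  Because \<open>d n\<close> runs
  through all scales, the second bound uses the behaviour of \<open>\<sigma>\<close> at zero and at infinity.
  High Gaussian moments, a union bound and dyadic chaining then place the path, with probability
  close to one, in a fixed set of paths with a common modulus of continuity and a common sublinear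
  growth bound (\<open>prob_controlled_paths\<close>).  This set is compact for pointwise convergence,
  and because sublinear growth loses against the drift, the buffer path is a continuous function
  on it (\<open>continuous_on_buffer_functional\<close>).

  The two halves are joined without finite-dimensional distributions or Prokhorov's theorem
  (\<open>expectation_tendsto_of_characteristic_functions\<close>): trigonometric polynomials in the
  coordinates form an algebra separating paths, so on the compact set a bounded continuous
  functional of the buffer path is uniformly close to one of them, and the expectations of
  trigonometric polynomials converge.
\<close>

section \<open>Weak convergence from characteristic functions and compact sets\<close>

lemma open_coordinate_condition:
  fixes U :: "'b::topological_space set"
  shows "open U \<Longrightarrow> open {z::'a \<Rightarrow> 'b. z i \<in> U}"
  using open_vimage[of U "\<lambda>z. z i"] by (simp add: vimage_def)

text \<open>
  The Stone-Weierstrass theorem is stated for Hausdorff types, and paths indexed by all of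
  \<open>real\<close> form an uncountable product, which is not metrizable.  The weaker separation
  classes come first because a type constructor must belong to the superclasses of
  \<^class>\<open>t2_space\<close> under hypotheses no stronger than those for \<^class>\<open>t2_space\<close> itself.
\<close>
instance "fun" :: (type, t0_space) t0_space
proof
  fix x y :: "'a \<Rightarrow> 'b" assume "x \<noteq> y"
  then obtain i where "x i \<noteq> y i" by blast
  then obtain U where "open U" "\<not> (x i \<in> U \<longleftrightarrow> y i \<in> U)" using t0_space_class.t0_space[OF \<open>x i \<noteq> y i\<close>] by blast
  then show "\<exists>U. open U \<and> \<not> (x \<in> U \<longleftrightarrow> y \<in> U)"
    by (intro exI[of _ "{z. z i \<in> U}"]) (auto intro: open_coordinate_condition)
qed

instance "fun" :: (type, t1_space) t1_space
proof
  fix x y :: "'a \<Rightarrow> 'b" assume "x \<noteq> y"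
  then obtain i where "x i \<noteq> y i" by blast
  then obtain U where "open U" "x i \<in> U" "y i \<notin> U" using t1_space_class.t1_space[OF \<open>x i \<noteq> y i\<close>] by blast
  then show "\<exists>U. open U \<and> x \<in> U \<and> y \<notin> U"
    by (intro exI[of _ "{z. z i \<in> U}"]) (auto intro: open_coordinate_condition)
qed

instance "fun" :: (type, t2_space) t2_space
proof
  fix x y :: "'a \<Rightarrow> 'b" assume "x \<noteq> y"
  then obtain i where "x i \<noteq> y i" by blast
  then obtain U V where "open U" "open V" "x i \<in> U" "y i \<in> V" "U \<inter> V = {}"
    using hausdorff[OF \<open>x i \<noteq> y i\<close>] by blast
  then show "\<exists>U V. open U \<and> open V \<and> x \<in> U \<and> y \<in> V \<and> U \<inter> V = {}"
    by (intro exI[of _ "{z. z i \<in> U}"] exI[of _ "{z. z i \<in> V}"])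
      (auto intro: open_coordinate_condition)
qed

text \<open>
  Trigonometric polynomials in finitely many coordinates; the free phase covers the sines.
  Their expectations carry the same information as the finite-dimensional characteristic
  functions.
\<close>
inductive trig_poly :: "(('i \<Rightarrow> real) \<Rightarrow> real) \<Rightarrow> bool" where
  cos: "finite J \<Longrightarrow> trig_poly (\<lambda>x. b * cos ((\<Sum>t\<in>J. a t * x t) + \<theta>))"
| add: "trig_poly f \<Longrightarrow> trig_poly g \<Longrightarrow> trig_poly (\<lambda>x. f x + g x)"

lemma trig_poly_const: "trig_poly (\<lambda>x. b)"
  using trig_poly.cos[of "{}" b _ 0] by simp

text \<open>
  The coefficients are extended by zero to \<open>J \<union> J'\<close>, so that the sum and the
  difference of the two phases are again functionals of the same form.
\<close>
lemma trig_poly_cos_mult_cos: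
  assumes "finite J" "finite J'"
  shows "trig_poly (\<lambda>x. (b * cos ((\<Sum>t\<in>J. a t * x t) + \<theta>)) * (b' * cos ((\<Sum>t\<in>J'. a' t * x t) + \<theta>')))"
proof -
  define u u' where "u t = (if t \<in> J then a t else 0)" and "u' t = (if t \<in> J' then a' t else 0)" for t
  have J: "(\<Sum>t\<in>J. a t * x t) = (\<Sum>t\<in>J \<union> J'. u t * x t)" for x
    using assms by (intro sum.mono_neutral_cong_left) (auto simp: u_def)
  have J': "(\<Sum>t\<in>J'. a' t * x t) = (\<Sum>t\<in>J \<union> J'. u' t * x t)" for x
    using assms by (intro sum.mono_neutral_cong_left) (auto simp: u'_def)
  have "(\<lambda>x. (b * cos ((\<Sum>t\<in>J. a t * x t) + \<theta>)) * (b' * cos ((\<Sum>t\<in>J'. a' t * x t) + \<theta>'))) =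
    (\<lambda>x. b * b' / 2 * cos ((\<Sum>t\<in>J \<union> J'. (u t - u' t) * x t) + (\<theta> - \<theta>')) +
         b * b' / 2 * cos ((\<Sum>t\<in>J \<union> J'. (u t + u' t) * x t) + (\<theta> + \<theta>')))"
    (is "_ = ?rhs")
  proof
    fix x
    let ?A = "(\<Sum>t\<in>J \<union> J'. u t * x t)" and ?B = "(\<Sum>t\<in>J \<union> J'. u' t * x t)"
    have "(b * cos (?A + \<theta>)) * (b' * cos (?B + \<theta>')) = b * b' * (cos (?A + \<theta>) * cos (?B + \<theta>'))" by simp
    also have "\<dots> = b * b' / 2 * cos ((?A + \<theta>) - (?B + \<theta>')) + b * b' / 2 * cos ((?A + \<theta>) + (?B + \<theta>'))"
      unfolding cos_times_cos by (simp add: field_simps)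
    also have "(?A + \<theta>) - (?B + \<theta>') = (\<Sum>t\<in>J \<union> J'. (u t - u' t) * x t) + (\<theta> - \<theta>')"
      by (simp add: sum_subtractf algebra_simps)
    also have "(?A + \<theta>) + (?B + \<theta>') = (\<Sum>t\<in>J \<union> J'. (u t + u' t) * x t) + (\<theta> + \<theta>')"
      by (simp add: sum.distrib algebra_simps)
    finally show "(b * cos ((\<Sum>t\<in>J. a t * x t) + \<theta>)) * (b' * cos ((\<Sum>t\<in>J'. a' t * x t) + \<theta>')) = ?rhs x"
      unfolding J J' .
  qed
  then show ?thesis
    using assms by (simp only:) (intro trig_poly.intros finite_UnI)
qed

lemma trig_poly_mult:
  assumes "trig_poly f" "trig_poly g"
  shows "trig_poly (\<lambda>x. f x * g x)"
  using assms(1)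
proof induction
  case (cos J b a \<theta>)
  from assms(2) show ?case
  proof induction
    case (cos J' b' a' \<theta>')
    show ?case by (rule trig_poly_cos_mult_cos[OF \<open>finite J\<close> \<open>finite J'\<close>])
  next
    case (add f g)
    then show ?case by (simp add: distrib_left trig_poly.add)
  qed
next
  case (add f f')
  then show ?case by (simp add: distrib_right trig_poly.add)
qed

lemma trig_poly_compose:
  assumes "real_polynomial_function q" "trig_poly f"
  shows "trig_poly (\<lambda>x. q (f x))"
  using assms(1)
proof (induction rule: real_polynomial_function.induct)
  case (linear q)
  have "q y = q 1 * y" for y
    using linear_cmul[OF bounded_linear.linear[OF linear], of y 1] by simp
  then have eq: "(\<lambda>x. q (f x)) = (\<lambda>x. q 1 * f x)" by (intro ext)
  show ?case unfolding eq by (rule trig_poly_mult[OF trig_poly_const assms(2)])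
next
  case (const b)
  show ?case by (rule trig_poly_const)
next
  case (add q q')
  show ?case by (rule trig_poly.add[OF add.IH])
next
  case (mult q q')
  show ?case by (rule trig_poly_mult[OF mult.IH])
qed

lemma trig_poly_bounded: "trig_poly f \<Longrightarrow> \<exists>C. \<forall>x. \<bar>f x\<bar> \<le> C"
proof (induction rule: trig_poly.induct)
  case (cos J b a \<theta>)
  have "\<bar>b * cos ((\<Sum>t\<in>J. a t * x t) + \<theta>)\<bar> \<le> \<bar>b\<bar>" for x :: "'a \<Rightarrow> real"
    using mult_left_mono[OF abs_cos_le_one, of "\<bar>b\<bar>"] by (simp add: abs_mult)
  then show ?case by blast
next
  case (add f g)
  then obtain C D where "\<forall>x. \<bar>f x\<bar> \<le> C" "\<forall>x. \<bar>g x\<bar> \<le> D" by blast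
  then have "\<forall>x. \<bar>f x + g x\<bar> \<le> C + D" by (meson abs_triangle_ineq add_mono order_trans)
  then show ?case by blast
qed

lemma trig_poly_continuous: "trig_poly f \<Longrightarrow> continuous_on S f"
proof (induction rule: trig_poly.induct)
  case (cos J b a \<theta>)
  have "continuous_on S (\<lambda>x::'a \<Rightarrow> real. x i)" for i
    by (rule continuous_on_subset[OF continuous_on_product_coordinates]) simp
  then show ?case by (intro continuous_intros)
qed (auto intro: continuous_intros)

lemma trig_poly_separates:
  fixes x y :: "'i \<Rightarrow> real"
  assumes "x \<noteq> y"
  shows "\<exists>f. trig_poly f \<and> f x \<noteq> f y"
proof -
  obtain i where i: "x i \<noteq> y i" using assms by blast
  \<comment> \<open>The phase is chosen to be \<open>0\<close> at \<open>x\<close> and \<open>pi\<close> at \<open>y\<close>.\<close>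
  define d where "d = y i - x i"
  have d: "d \<noteq> 0" using i by (simp add: d_def)
  define f where "f z = 1 * cos ((\<Sum>t\<in>{i}. (pi / d) * z t) + (- (pi / d) * x i))" for z :: "'i \<Rightarrow> real"
  have "trig_poly f"
    unfolding f_def by (rule trig_poly.cos) simp
  moreover have "f x = 1" by (simp add: f_def)
  moreover have "(pi / d) * y i + (- (pi / d) * x i) = (pi / d) * d"
    unfolding d_def right_diff_distrib by simp
  then have "f y = - 1" using d by (simp add: f_def)
  ultimately show ?thesis by (intro exI[of _ f]) simp
qed

text \<open>
  Stone-Weierstrass approximates \<open>g\<close> on \<open>K\<close> only, and the approximant may be
  huge off \<open>K\<close>.  But every trigonometric polynomial is bounded everywhere, say by
  \<open>C\<close>; composing it with a real polynomial that is close on \<open>[-C, C]\<close> to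
  the truncation at height \<open>b\<close> restores the global bound and stays inside the algebra.
\<close>
lemma trig_poly_approximation:
  fixes g :: "('i \<Rightarrow> real) \<Rightarrow> real"
  assumes K: "compact K" and g: "continuous_on K g" and b: "\<And>x. x \<in> K \<Longrightarrow> \<bar>g x\<bar> \<le> b" and e: "0 < e"
    and b0: "0 \<le> b"
  obtains p where "trig_poly p" "\<And>x. \<bar>p x\<bar> \<le> b + e" "\<And>x. x \<in> K \<Longrightarrow> \<bar>g x - p x\<bar> \<le> 2 * e"
proof -
  have "\<exists>f. trig_poly f \<and> (\<forall>x\<in>K. \<bar>g x - f x\<bar> < e)"
  proof (rule Stone_Weierstrass_HOL[where P = trig_poly, OF K _ _ _ _ _ g e])
    show "\<exists>f. trig_poly f \<and> f x \<noteq> f y" if "x \<in> K \<and> y \<in> K \<and> x \<noteq> y" for x y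
      using that by (intro trig_poly_separates) simp
    show "trig_poly (\<lambda>x. f x + g x)" if "trig_poly f \<and> trig_poly g" for f g :: "('i \<Rightarrow> real) \<Rightarrow> real"
      by (rule trig_poly.add[OF conjunct1[OF that] conjunct2[OF that]])
    show "trig_poly (\<lambda>x. f x * g x)" if "trig_poly f \<and> trig_poly g" for f g :: "('i \<Rightarrow> real) \<Rightarrow> real"
      by (rule trig_poly_mult[OF conjunct1[OF that] conjunct2[OF that]])
  qed (rule trig_poly_const trig_poly_continuous, assumption?)+
  then obtain f where f: "trig_poly f" "\<And>x. x \<in> K \<Longrightarrow> \<bar>g x - f x\<bar> < e" by blast
  obtain C where C: "\<And>x. \<bar>f x\<bar> \<le> C" using trig_poly_bounded[OF f(1)] by blast
  \<comment> \<open>Truncation at height \<open>b\<close> moves \<open>f\<close> no further from \<open>g\<close> on \<open>K\<close>.\<close>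
  define clamp :: "real \<Rightarrow> real" where "clamp y = max (- b) (min b y)" for y
  have "continuous_on {-C..C} clamp" unfolding clamp_def by (intro continuous_intros)
  then obtain q where q: "real_polynomial_function q" "\<And>y. y \<in> {-C..C} \<Longrightarrow> \<bar>clamp y - q y\<bar> < e"
    using Stone_Weierstrass_real_polynomial_function[of "{-C..C}" clamp e] e by auto
  have qf: "\<bar>clamp (f x) - q (f x)\<bar> < e" for x
    using q(2)[of "f x"] C[of x] by (simp add: abs_le_iff)
  show thesis
  proof
    show "trig_poly (\<lambda>x. q (f x))" by (rule trig_poly_compose[OF q(1) f(1)])
    have cb: "\<bar>clamp y\<bar> \<le> b" for y using b0 unfolding clamp_def by linarith
    show "\<bar>q (f x)\<bar> \<le> b + e" for x
      using qf[of x] cb[of "f x"] by linarith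
    fix x assume x: "x \<in> K"
    have "\<bar>g x - clamp (f x)\<bar> \<le> \<bar>g x - f x\<bar>"
      using b[OF x] unfolding clamp_def by linarith
    then show "\<bar>g x - q (f x)\<bar> \<le> 2 * e"
      using qf[of x] f(2)[OF x] by linarith
  qed
qed

lemma trig_poly_measurable:
  assumes "trig_poly p" and Y: "\<And>t. (\<lambda>\<omega>. Y \<omega> t) \<in> borel_measurable M"
  shows "(\<lambda>\<omega>. p (Y \<omega>)) \<in> borel_measurable M"
  using assms(1)
proof (induction rule: trig_poly.induct)
  case (cos J b a \<theta>)
  note Y[measurable]
  show ?case by measurable
next
  case (add f g)
  show ?case by (rule borel_measurable_add[OF add.IH])
qed

lemma integrable_trig_poly:
  assumes "prob_space P" "trig_poly h" and W: "\<And>t. (\<lambda>\<omega>. W \<omega> t) \<in> borel_measurable P"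
  shows "integrable P (\<lambda>\<omega>. h (W \<omega>))"
proof -
  interpret P: prob_space P by fact
  obtain C where "\<forall>x. \<bar>h x\<bar> \<le> C" using trig_poly_bounded[OF assms(2)] by blast
  then show ?thesis
    using trig_poly_measurable[OF assms(2) W] by (intro P.integrable_const_bound[of _ C]) auto
qed

lemma trig_poly_expectation_tendsto:
  assumes M: "prob_space M" and N: "prob_space N"
    and Y: "\<And>c t. (\<lambda>\<omega>. Y c \<omega> t) \<in> borel_measurable M"
    and Z: "\<And>t. (\<lambda>\<omega>. Z \<omega> t) \<in> borel_measurable N"
    and conv: "\<And>J a \<theta>. finite J \<Longrightarrow>
       ((\<lambda>c. \<integral>\<omega>. cos ((\<Sum>t\<in>J. a t * Y c \<omega> t) + \<theta>) \<partial>M) \<longlongrightarrow>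
        (\<integral>\<omega>. cos ((\<Sum>t\<in>J. a t * Z \<omega> t) + \<theta>) \<partial>N)) F"
    and p: "trig_poly p"
  shows "((\<lambda>c. \<integral>\<omega>. p (Y c \<omega>) \<partial>M) \<longlongrightarrow> (\<integral>\<omega>. p (Z \<omega>) \<partial>N)) F"
  using p
proof (induction rule: trig_poly.induct)
  case (cos J b a \<theta>)
  show ?case
    using tendsto_mult[OF tendsto_const conv[OF cos], of b] by simp
next
  case (add f g)
  have "(\<integral>\<omega>. f (Y c \<omega>) + g (Y c \<omega>) \<partial>M) = (\<integral>\<omega>. f (Y c \<omega>) \<partial>M) + (\<integral>\<omega>. g (Y c \<omega>) \<partial>M)" for c
    by (intro Bochner_Integration.integral_add integrable_trig_poly M Y add.hyps)
  moreover have "(\<integral>\<omega>. f (Z \<omega>) + g (Z \<omega>) \<partial>N) = (\<integral>\<omega>. f (Z \<omega>) \<partial>N) + (\<integral>\<omega>. g (Z \<omega>) \<partial>N)"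
    by (intro Bochner_Integration.integral_add integrable_trig_poly N Z add.hyps)
  ultimately show ?case
    using tendsto_add[OF add.IH] by simp
qed

lemma (in prob_space) expectation_close_on_large_event:
  fixes f g :: "'a \<Rightarrow> real"
  assumes E: "E \<in> events" "1 - e \<le> prob E"
    and f: "f \<in> borel_measurable M" "\<And>\<omega>. \<omega> \<in> space M \<Longrightarrow> \<bar>f \<omega>\<bar> \<le> B"
    and g: "g \<in> borel_measurable M" "\<And>\<omega>. \<omega> \<in> space M \<Longrightarrow> \<bar>g \<omega>\<bar> \<le> B"
    and d: "\<And>\<omega>. \<omega> \<in> E \<Longrightarrow> \<bar>f \<omega> - g \<omega>\<bar> \<le> d" and d0: "0 \<le> d" and B0: "0 \<le> B"
  shows "\<bar>expectation f - expectation g\<bar> \<le> d + 2 * B * e"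
proof -
  have i: "integrable M f" "integrable M g"
    using f g by (auto intro!: integrable_const_bound[of _ B])
  have pE: "prob (space M - E) \<le> e" using E by (simp add: prob_compl)
  have "\<bar>expectation f - expectation g\<bar> = \<bar>\<integral>\<omega>. f \<omega> - g \<omega> \<partial>M\<bar>"
    using i by simp
  also have "\<dots> \<le> (\<integral>\<omega>. \<bar>f \<omega> - g \<omega>\<bar> \<partial>M)" by (rule integral_abs_bound)
  also have "\<dots> \<le> (\<integral>\<omega>. d + 2 * B * indicator (space M - E) \<omega> \<partial>M)"
  proof (rule integral_mono)
    show "integrable M (\<lambda>\<omega>. \<bar>f \<omega> - g \<omega>\<bar>)" using i by auto
    show "integrable M (\<lambda>\<omega>. d + 2 * B * indicator (space M - E) \<omega>)"
      using E by (intro Bochner_Integration.integrable_add integrable_mult_right integrable_const integrable_real_indicator)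
        (auto simp: less_top[symmetric])
    fix \<omega> assume w: "\<omega> \<in> space M"
    show "\<bar>f \<omega> - g \<omega>\<bar> \<le> d + 2 * B * indicator (space M - E) \<omega>"
      using d[of \<omega>] f(2)[OF w] g(2)[OF w] w d0 by (auto simp: indicator_def)
  qed
  also have "\<dots> = d + 2 * B * prob (space M - E)"
    using E by (subst Bochner_Integration.integral_add) (auto simp: prob_space less_top[symmetric])
  also have "\<dots> \<le> d + 2 * B * e"
    using pE B0 by (intro add_left_mono mult_left_mono) auto
  finally show ?thesis .
qed

text \<open>
  Convergence of characteristic functions plus tightness gives convergence of expectations, with
  no reference to finite-dimensional distributions: on the compact set of probability close to
  one the functional is replaced by a trigonometric polynomial, and the global bound on that
  polynomial controls the exceptional event.  The functional has to factor through a continuous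
  function of the path only on the compact set, which is what allows it to be undefined or
  discontinuous elsewhere.
\<close>
theorem expectation_tendsto_of_characteristic_functions:
  fixes Y :: "'c \<Rightarrow> 'a \<Rightarrow> 'i \<Rightarrow> real" and Z :: "'b \<Rightarrow> 'i \<Rightarrow> real"
    and G :: "'c \<Rightarrow> 'a \<Rightarrow> real" and H :: "'b \<Rightarrow> real"
  assumes M: "prob_space M" and N: "prob_space N"
    and Y: "\<And>c t. (\<lambda>\<omega>. Y c \<omega> t) \<in> borel_measurable M"
    and Z: "\<And>t. (\<lambda>\<omega>. Z \<omega> t) \<in> borel_measurable N"
    and conv: "\<And>J a \<theta>. finite J \<Longrightarrow>
       ((\<lambda>c. \<integral>\<omega>. cos ((\<Sum>t\<in>J. a t * Y c \<omega> t) + \<theta>) \<partial>M) \<longlongrightarrow>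
        (\<integral>\<omega>. cos ((\<Sum>t\<in>J. a t * Z \<omega> t) + \<theta>) \<partial>N)) F"
    and G: "\<And>c. G c \<in> borel_measurable M" "\<And>c \<omega>. \<omega> \<in> space M \<Longrightarrow> \<bar>G c \<omega>\<bar> \<le> b"
    and H: "H \<in> borel_measurable N" "\<And>\<omega>. \<omega> \<in> space N \<Longrightarrow> \<bar>H \<omega>\<bar> \<le> b"
    and tight: "\<And>e. 0 < e \<Longrightarrow> \<exists>K g. compact K \<and> continuous_on K g \<and> (\<forall>x\<in>K. \<bar>g x\<bar> \<le> b) \<and>
       (\<forall>\<^sub>F c in F. \<exists>E\<in>sets M. 1 - e \<le> measure M E \<and> (\<forall>\<omega>\<in>E. Y c \<omega> \<in> K \<and> G c \<omega> = g (Y c \<omega>))) \<and>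
       (\<exists>E\<in>sets N. 1 - e \<le> measure N E \<and> (\<forall>\<omega>\<in>E. Z \<omega> \<in> K \<and> H \<omega> = g (Z \<omega>)))"
  shows "((\<lambda>c. \<integral>\<omega>. G c \<omega> \<partial>M) \<longlongrightarrow> (\<integral>\<omega>. H \<omega> \<partial>N)) F"
proof (rule tendstoI)
  interpret M: prob_space M by fact
  interpret N: prob_space N by fact
  fix r :: real assume r: "0 < r"
  obtain \<omega>\<^sub>0 where "\<omega>\<^sub>0 \<in> space N" using N.not_empty by blast
  then have b0: "0 \<le> b" using H(2)[of \<omega>\<^sub>0] by auto
  define e where "e = min 1 (r / (2 * (4 + 4 * (b + 1))))"
  have e: "0 < e" using r b0 by (simp add: e_def)
  have e1: "e \<le> 1" by (simp add: e_def)
  have "e \<le> r / (2 * (4 + 4 * (b + 1)))" by (simp add: e_def)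
  then have er: "2 * (2 * e + 2 * (b + 1) * e) \<le> r / 2"
    using b0 by (simp add: field_simps)
  obtain K g where "compact K \<and> continuous_on K g \<and> (\<forall>x\<in>K. \<bar>g x\<bar> \<le> b) \<and>
       (\<forall>\<^sub>F c in F. \<exists>E\<in>sets M. 1 - e \<le> measure M E \<and> (\<forall>\<omega>\<in>E. Y c \<omega> \<in> K \<and> G c \<omega> = g (Y c \<omega>))) \<and>
       (\<exists>E\<in>sets N. 1 - e \<le> measure N E \<and> (\<forall>\<omega>\<in>E. Z \<omega> \<in> K \<and> H \<omega> = g (Z \<omega>)))"
    using tight[OF e] by (elim exE)
  then have K: "compact K" "continuous_on K g" "\<And>x. x \<in> K \<Longrightarrow> \<bar>g x\<bar> \<le> b"
    and EM: "\<forall>\<^sub>F c in F. \<exists>E\<in>sets M. 1 - e \<le> measure M E \<and> (\<forall>\<omega>\<in>E. Y c \<omega> \<in> K \<and> G c \<omega> = g (Y c \<omega>))"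
    and EN: "\<exists>E\<in>sets N. 1 - e \<le> measure N E \<and> (\<forall>\<omega>\<in>E. Z \<omega> \<in> K \<and> H \<omega> = g (Z \<omega>))"
    by simp_all
  obtain p where p: "trig_poly p" "\<And>x. \<bar>p x\<bar> \<le> b + e" "\<And>x. x \<in> K \<Longrightarrow> \<bar>g x - p x\<bar> \<le> 2 * e"
    using trig_poly_approximation[OF K(1,2,3) e b0] by blast
  have pb: "\<bar>p x\<bar> \<le> b + 1" for x using p(2)[of x] e1 by linarith
  have limp: "\<forall>\<^sub>F c in F. \<bar>(\<integral>\<omega>. p (Y c \<omega>) \<partial>M) - (\<integral>\<omega>. p (Z \<omega>) \<partial>N)\<bar> < r / 2"
    using tendstoD[OF trig_poly_expectation_tendsto[OF M N Y Z conv p(1)], of "r/2"] r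
    by (simp add: dist_real_def)
  have N_close: "\<bar>(\<integral>\<omega>. H \<omega> \<partial>N) - (\<integral>\<omega>. p (Z \<omega>) \<partial>N)\<bar> \<le> 2 * e + 2 * (b + 1) * e"
  proof -
    obtain E where E: "E \<in> sets N" "1 - e \<le> measure N E" "\<forall>\<omega>\<in>E. Z \<omega> \<in> K \<and> H \<omega> = g (Z \<omega>)"
      using EN by blast
    show ?thesis
    proof (rule N.expectation_close_on_large_event[OF E(1,2)])
      show "(\<lambda>\<omega>. p (Z \<omega>)) \<in> borel_measurable N" by (rule trig_poly_measurable[OF p(1) Z])
      show "\<bar>H \<omega>\<bar> \<le> b + 1" if "\<omega> \<in> space N" for \<omega> using H(2)[OF that] by linarith
      show "\<bar>H \<omega> - p (Z \<omega>)\<bar> \<le> 2 * e" if "\<omega> \<in> E" for \<omega> using E(3) that p(3) by simp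
    qed (use H(1) pb e b0 in auto)
  qed
  have M_close: "\<forall>\<^sub>F c in F. \<bar>(\<integral>\<omega>. G c \<omega> \<partial>M) - (\<integral>\<omega>. p (Y c \<omega>) \<partial>M)\<bar> \<le> 2 * e + 2 * (b + 1) * e"
    using EM
  proof eventually_elim
    case (elim c)
    then obtain E where E: "E \<in> sets M" "1 - e \<le> measure M E" "\<forall>\<omega>\<in>E. Y c \<omega> \<in> K \<and> G c \<omega> = g (Y c \<omega>)"
      by blast
    show ?case
    proof (rule M.expectation_close_on_large_event[OF E(1,2)])
      show "(\<lambda>\<omega>. p (Y c \<omega>)) \<in> borel_measurable M" by (rule trig_poly_measurable[OF p(1) Y])
      show "\<bar>G c \<omega>\<bar> \<le> b + 1" if "\<omega> \<in> space M" for \<omega> using G(2)[OF that, of c] by linarith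
      show "\<bar>G c \<omega> - p (Y c \<omega>)\<bar> \<le> 2 * e" if "\<omega> \<in> E" for \<omega> using E(3) that p(3) by simp
    qed (use G(1) pb e b0 in auto)
  qed
  show "\<forall>\<^sub>F c in F. dist (\<integral>\<omega>. G c \<omega> \<partial>M) (\<integral>\<omega>. H \<omega> \<partial>N) < r"
    using limp M_close
  proof eventually_elim
    case (elim c)
    have "\<bar>x - y\<bar> < r" if "\<bar>u - v\<bar> < r / 2" "\<bar>x - u\<bar> \<le> d" "\<bar>y - v\<bar> \<le> d" "2 * d \<le> r / 2"
      for x y u v d :: real
      using that by linarith
    from this[OF elim N_close er] show ?case by (simp add: dist_real_def)
  qed
qed

section \<open>Centered Gaussian processes with stationary increments\<close>

lemma (in prob_space) normal_characteristic:
  assumes s: "0 < s" and D: "distributed M lborel Z (normal_density 0 s)"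
  shows "expectation (\<lambda>\<omega>. cos (Z \<omega> + \<theta>)) = exp (- s\<^sup>2 / 2) * cos \<theta>"
proof -
  let ?W = "\<lambda>\<omega>. Z \<omega> / s"
  have W: "distributed M lborel ?W std_normal_density"
    using D s by (subst (asm) normal_standard_normal_convert) auto
  have Zm [measurable]: "Z \<in> borel_measurable M"
    using distributed_measurable[OF D] by simp
  have Wm: "?W \<in> measurable M lborel" by simp
  have "exp (- s\<^sup>2 / 2) = char (distr M lborel ?W) s"
    using char_std_normal_distribution distributed_distr_eq_density[OF W] by simp
  also have "\<dots> = (CLINT \<omega>|M. iexp (s * ?W \<omega>))"
    unfolding char_def by (subst integral_distr[OF Wm]) auto
  also have "\<dots> = (CLINT \<omega>|M. iexp (Z \<omega>))" using s by simp
  finally have *: "(CLINT \<omega>|M. iexp (Z \<omega>)) = exp (- s\<^sup>2 / 2)" ..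
  have i: "complex_integrable M (\<lambda>\<omega>. iexp (Z \<omega>))"
    by (rule integrable_const_bound[of _ 1]) auto
  have c: "expectation (\<lambda>\<omega>. cos (Z \<omega>)) = exp (- s\<^sup>2 / 2)"
    using arg_cong[OF *, of Re] integral_Re[OF i] by (simp add: Re_exp)
  have sn: "expectation (\<lambda>\<omega>. sin (Z \<omega>)) = 0"
    using arg_cong[OF *, of Im] integral_Im[OF i] by (simp add: Im_exp)
  have "integrable M (\<lambda>\<omega>. cos (Z \<omega>))" "integrable M (\<lambda>\<omega>. sin (Z \<omega>))"
    by (auto intro!: integrable_const_bound[of _ 1])
  then show ?thesis by (simp add: cos_add c sn)
qed

text \<open>
  Degenerate laws are included.  The even moments are used for Markov bounds, the cosine formula
  (a characteristic function with its phase) for the finite-dimensional limits.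
\<close>
lemma (in prob_space) centered_gaussian:
  assumes Z: "gaussian_variable M Z" and mean: "expectation Z = 0"
  shows "integrable M (\<lambda>\<omega>. Z \<omega> ^ k)"
    and "expectation (\<lambda>\<omega>. Z \<omega> ^ (2 * k)) = fact (2 * k) / (2 ^ k * fact k) * expectation (\<lambda>\<omega>. (Z \<omega>)\<^sup>2) ^ k"
    and "expectation (\<lambda>\<omega>. cos (Z \<omega> + \<theta>)) = exp (- expectation (\<lambda>\<omega>. (Z \<omega>)\<^sup>2) / 2) * cos \<theta>"
proof -
  have Zm [measurable]: "Z \<in> borel_measurable M"
    using Z by (simp add: gaussian_variable_def)
  consider (normal) s where "0 < s" "distributed M lborel Z (normal_density 0 s)" | (zero) "AE \<omega> in M. Z \<omega> = 0"
  proof -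
    from Z consider \<mu> s where "0 < s" "distributed M lborel Z (normal_density \<mu> s)" | \<mu> where "AE \<omega> in M. Z \<omega> = \<mu>"
      unfolding gaussian_variable_def by blast
    then show thesis
    proof cases
      case (1 \<mu> s)
      then show thesis using normal_distributed_expectation[OF 1] mean normal by simp
    next
      case (2 \<mu>)
      have "expectation Z = (\<integral>\<omega>. \<mu> \<partial>M)" using 2 by (intro integral_cong_AE) simp_all
      then have "\<mu> = 0" using mean by (simp add: prob_space)
      then show thesis using 2 zero by simp
    qed
  qed
  then have "integrable M (\<lambda>\<omega>. Z \<omega> ^ k) \<and>
    expectation (\<lambda>\<omega>. Z \<omega> ^ (2 * k)) = fact (2 * k) / (2 ^ k * fact k) * expectation (\<lambda>\<omega>. (Z \<omega>)\<^sup>2) ^ k \<and>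
    expectation (\<lambda>\<omega>. cos (Z \<omega> + \<theta>)) = exp (- expectation (\<lambda>\<omega>. (Z \<omega>)\<^sup>2) / 2) * cos \<theta>"
  proof cases
    case (normal s)
    note D = normal(2)
    have "variance Z = s\<^sup>2" by (rule normal_distributed_variance[OF normal])
    then have v: "expectation (\<lambda>\<omega>. (Z \<omega>)\<^sup>2) = s\<^sup>2" using mean by simp
    have "integrable M (\<lambda>\<omega>. Z \<omega> ^ k)"
      using distributed_integrable[OF D, of "\<lambda>x. x ^ k"] integrable_normal_moment[OF normal(1), of 0 k] by simp
    moreover have "expectation (\<lambda>\<omega>. Z \<omega> ^ (2 * k)) = fact (2 * k) / ((2 / s\<^sup>2) ^ k * fact k)"
      using distributed_integral[OF D, of "\<lambda>x. x ^ (2 * k)"] integral_normal_moment_even[OF normal(1), of 0 k] by simp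
    ultimately show ?thesis
      using normal_characteristic[OF normal] normal(1) by (simp add: v power_divide field_simps)
  next
    case zero
    have c: "expectation (\<lambda>\<omega>. h (Z \<omega>)) = h 0" if [measurable]: "h \<in> borel_measurable borel" for h :: "real \<Rightarrow> real"
    proof -
      have "expectation (\<lambda>\<omega>. h (Z \<omega>)) = (\<integral>\<omega>. h 0 \<partial>M)"
        by (rule integral_cong_AE) (measurable, use zero in eventually_elim, simp)
      then show ?thesis by (simp add: prob_space)
    qed
    have "integrable M (\<lambda>\<omega>. Z \<omega> ^ k)"
      by (rule integrable_cong_AE_imp[of M "\<lambda>\<omega>. 0 ^ k"]) (simp, measurable, use zero in eventually_elim, simp)
    moreover have "expectation (\<lambda>\<omega>. (Z \<omega>)\<^sup>2) = 0" "expectation (\<lambda>\<omega>. Z \<omega> ^ (2 * k)) = 0 ^ (2 * k)"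
        "expectation (\<lambda>\<omega>. cos (Z \<omega> + \<theta>)) = cos \<theta>"
      using c[of "\<lambda>x. x\<^sup>2"] c[of "\<lambda>x. x ^ (2 * k)"] c[of "\<lambda>x. cos (x + \<theta>)"] by simp_all
    ultimately show ?thesis by (cases k) auto
  qed
  then show "integrable M (\<lambda>\<omega>. Z \<omega> ^ k)"
    and "expectation (\<lambda>\<omega>. Z \<omega> ^ (2 * k)) = fact (2 * k) / (2 ^ k * fact k) * expectation (\<lambda>\<omega>. (Z \<omega>)\<^sup>2) ^ k"
    and "expectation (\<lambda>\<omega>. cos (Z \<omega> + \<theta>)) = exp (- expectation (\<lambda>\<omega>. (Z \<omega>)\<^sup>2) / 2) * cos \<theta>"
    by blast+
qed

text \<open>
  What the argument uses of a centered Gaussian process with stationary increments: the joint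
  laws are determined by the standard deviation \<open>s\<close> of the increments.  Unlike the
  invariance of all finite-dimensional laws, this description is visibly stable under a linear
  change of time and a rescaling of space.
\<close>
locale gaussian_increments = prob_space M for M :: "'a measure" +
  fixes Y :: "real \<Rightarrow> 'a \<Rightarrow> real" and s :: "real \<Rightarrow> real"
  assumes gauss: "gaussian_process M Y"
    and mean: "expectation (Y t) = 0"
    and increment: "expectation (\<lambda>\<omega>. (Y t \<omega> - Y u \<omega>)\<^sup>2) = (s \<bar>t - u\<bar>)\<^sup>2"
    and s_nonneg: "0 \<le> s t"
    and zero: "\<omega> \<in> space M \<Longrightarrow> Y 0 \<omega> = 0"
    and cont: "\<omega> \<in> space M \<Longrightarrow> continuous_on UNIV (\<lambda>t. Y t \<omega>)"
begin

lemma gaussian_combination: "finite J \<Longrightarrow> gaussian_variable M (\<lambda>\<omega>. \<Sum>t\<in>J. a t * Y t \<omega>)"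
  using gauss by (auto simp: gaussian_process_def)

lemma gaussian_coordinate: "gaussian_variable M (Y t)"
  using gaussian_combination[of "{t}" "\<lambda>_. 1"] by simp

lemma measurable_coordinate [measurable]: "Y t \<in> borel_measurable M"
  using gaussian_coordinate by (simp add: gaussian_variable_def)

lemma integrable_coordinate: "integrable M (Y t)"
  using centered_gaussian(1)[OF gaussian_coordinate mean, of t 1] by simp

lemma mean_combination: "expectation (\<lambda>\<omega>. \<Sum>t\<in>J. a t * Y t \<omega>) = 0"
  by (subst Bochner_Integration.integral_sum) (auto simp: integrable_coordinate mean)

lemma integrable_square: "integrable M (\<lambda>\<omega>. (Y t \<omega>)\<^sup>2)"
  by (rule centered_gaussian(1)[OF gaussian_coordinate mean])

lemma second_moment: "expectation (\<lambda>\<omega>. (Y t \<omega>)\<^sup>2) = (s \<bar>t\<bar>)\<^sup>2"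
proof -
  have "expectation (\<lambda>\<omega>. (Y t \<omega>)\<^sup>2) = expectation (\<lambda>\<omega>. (Y t \<omega> - Y 0 \<omega>)\<^sup>2)"
    by (intro Bochner_Integration.integral_cong) (auto simp: zero)
  then show ?thesis using increment[of t 0] by simp
qed

lemma gaussian_increment: "gaussian_variable M (\<lambda>\<omega>. Y t \<omega> - Y u \<omega>)"
proof (cases "t = u")
  case True
  then show ?thesis unfolding gaussian_variable_def by auto
next
  case False
  then show ?thesis
    using gaussian_combination[of "{t, u}" "\<lambda>r. if r = t then 1 else - 1"] by simp
qed

lemma mean_increment: "expectation (\<lambda>\<omega>. Y t \<omega> - Y u \<omega>) = 0"
  by (simp add: integrable_coordinate mean)

lemma integrable_mult_coordinates: "integrable M (\<lambda>\<omega>. Y t \<omega> * Y u \<omega>)"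
proof (rule Bochner_Integration.integrable_bound)
  show "integrable M (\<lambda>\<omega>. (Y t \<omega>)\<^sup>2 + (Y u \<omega>)\<^sup>2)"
    by (intro Bochner_Integration.integrable_add integrable_square)
  have "\<bar>x * y\<bar> \<le> x\<^sup>2 + y\<^sup>2" for x y :: real
  proof -
    have "2 * (\<bar>x\<bar> * \<bar>y\<bar>) \<le> x\<^sup>2 + y\<^sup>2" using sum_squares_bound[of "\<bar>x\<bar>" "\<bar>y\<bar>"] by simp
    moreover have "0 \<le> \<bar>x\<bar> * \<bar>y\<bar>" by simp
    ultimately show ?thesis unfolding abs_mult by linarith
  qed
  then show "AE \<omega> in M. norm (Y t \<omega> * Y u \<omega>) \<le> norm ((Y t \<omega>)\<^sup>2 + (Y u \<omega>)\<^sup>2)"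
    by auto
qed simp

lemma covariance: "expectation (\<lambda>\<omega>. Y t \<omega> * Y u \<omega>) = ((s \<bar>t\<bar>)\<^sup>2 + (s \<bar>u\<bar>)\<^sup>2 - (s \<bar>t - u\<bar>)\<^sup>2) / 2"
proof -
  have "(s \<bar>t - u\<bar>)\<^sup>2 = expectation (\<lambda>\<omega>. ((Y t \<omega>)\<^sup>2 + (Y u \<omega>)\<^sup>2) - 2 * (Y t \<omega> * Y u \<omega>))"
    unfolding increment[symmetric]
    by (intro Bochner_Integration.integral_cong) (auto simp: power2_diff)
  also have "\<dots> = (expectation (\<lambda>\<omega>. (Y t \<omega>)\<^sup>2) + expectation (\<lambda>\<omega>. (Y u \<omega>)\<^sup>2)) - 2 * expectation (\<lambda>\<omega>. Y t \<omega> * Y u \<omega>)"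
    by (simp add: integrable_square integrable_mult_coordinates)
  finally show ?thesis by (simp add: second_moment)
qed

lemma variance_combination:
  assumes "finite J"
  shows "expectation (\<lambda>\<omega>. (\<Sum>t\<in>J. a t * Y t \<omega>)\<^sup>2) =
    (\<Sum>t\<in>J. \<Sum>u\<in>J. a t * a u * (((s \<bar>t\<bar>)\<^sup>2 + (s \<bar>u\<bar>)\<^sup>2 - (s \<bar>t - u\<bar>)\<^sup>2) / 2))"
proof -
  have "expectation (\<lambda>\<omega>. (\<Sum>t\<in>J. a t * Y t \<omega>)\<^sup>2) =
      expectation (\<lambda>\<omega>. \<Sum>t\<in>J. \<Sum>u\<in>J. a t * a u * (Y t \<omega> * Y u \<omega>))"
    by (simp add: power2_eq_square sum_product mult_ac)
  also have "\<dots> = (\<Sum>t\<in>J. \<Sum>u\<in>J. a t * a u * expectation (\<lambda>\<omega>. Y t \<omega> * Y u \<omega>))"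
    by (simp add: integrable_mult_coordinates)
  finally show ?thesis by (simp add: covariance)
qed

lemma characteristic_combination:
  assumes "finite J"
  shows "expectation (\<lambda>\<omega>. cos ((\<Sum>t\<in>J. a t * Y t \<omega>) + \<theta>)) =
    exp (- (\<Sum>t\<in>J. \<Sum>u\<in>J. a t * a u * (((s \<bar>t\<bar>)\<^sup>2 + (s \<bar>u\<bar>)\<^sup>2 - (s \<bar>t - u\<bar>)\<^sup>2) / 2)) / 2) * cos \<theta>"
  using centered_gaussian(3)[OF gaussian_combination[OF assms] mean_combination, of a \<theta>]
  unfolding variance_combination[OF assms] .

text \<open>
  Minkowski's inequality in \<open>L\<^sup>2\<close>.  For \<open>x\<close>, \<open>y\<close> above the two norms, the
  weighted bound \<open>(U + V)\<^sup>2 \<le> (1 + y/x) U\<^sup>2 + (1 + x/y) V\<^sup>2\<close> integrates to at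
  most \<open>(x + y)\<^sup>2\<close>; strict positivity of the weights is recovered by adding
  \<open>e / 2\<close> to each norm.
\<close>
lemma std_triangle: "s \<bar>a - c\<bar> \<le> s \<bar>a - b\<bar> + s \<bar>b - c\<bar>"
proof -
  let ?U = "\<lambda>\<omega>. Y a \<omega> - Y b \<omega>" and ?V = "\<lambda>\<omega>. Y b \<omega> - Y c \<omega>"
  have i: "integrable M (\<lambda>\<omega>. (Y t \<omega> - Y u \<omega>)\<^sup>2)" for t u
    by (rule centered_gaussian(1)[OF gaussian_increment mean_increment])
  have bound: "(s \<bar>a - c\<bar>)\<^sup>2 \<le> (x + y)\<^sup>2"
    if x: "0 < x" "s \<bar>a - b\<bar> \<le> x" and y: "0 < y" "s \<bar>b - c\<bar> \<le> y" for x y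
  proof -
    have "(s \<bar>a - c\<bar>)\<^sup>2 = expectation (\<lambda>\<omega>. (?U \<omega> + ?V \<omega>)\<^sup>2)"
      using increment[of a c] by simp
    also have "\<dots> \<le> expectation (\<lambda>\<omega>. (1 + y / x) * (?U \<omega>)\<^sup>2 + (1 + x / y) * (?V \<omega>)\<^sup>2)"
    proof (rule integral_mono)
      show "integrable M (\<lambda>\<omega>. (?U \<omega> + ?V \<omega>)\<^sup>2)" using i[of a c] by simp
      show "integrable M (\<lambda>\<omega>. (1 + y / x) * (?U \<omega>)\<^sup>2 + (1 + x / y) * (?V \<omega>)\<^sup>2)"
        by (intro Bochner_Integration.integrable_add integrable_mult_right i)
      fix \<omega>
      have "0 \<le> (y * ?U \<omega> - x * ?V \<omega>)\<^sup>2 / (x * y)" using x y by simp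
      also have "(y * P - x * Q)\<^sup>2 / (x * y) = (1 + y / x) * P\<^sup>2 + (1 + x / y) * Q\<^sup>2 - (P + Q)\<^sup>2" for P Q
        using x(1) y(1) by (simp add: divide_simps) (simp add: algebra_simps power2_eq_square)
      finally show "(?U \<omega> + ?V \<omega>)\<^sup>2 \<le> (1 + y / x) * (?U \<omega>)\<^sup>2 + (1 + x / y) * (?V \<omega>)\<^sup>2" by simp
    qed
    also have "\<dots> = (1 + y / x) * (s \<bar>a - b\<bar>)\<^sup>2 + (1 + x / y) * (s \<bar>b - c\<bar>)\<^sup>2"
      by (subst Bochner_Integration.integral_add) (simp_all only: integrable_mult_right i integral_mult_right_zero increment)
    also have "\<dots> \<le> (1 + y / x) * x\<^sup>2 + (1 + x / y) * y\<^sup>2"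
      using x y by (intro add_mono mult_left_mono power_mono s_nonneg) auto
    also have "\<dots> = (x + y)\<^sup>2" using x(1) y(1) by (simp add: divide_simps) (simp add: algebra_simps power2_eq_square)
    finally show ?thesis .
  qed
  show ?thesis
  proof (rule field_le_epsilon)
    fix e :: real assume e: "0 < e"
    have p: "0 < s t + e / 2" for t using s_nonneg[of t] e by linarith
    have "(s \<bar>a - c\<bar>)\<^sup>2 \<le> ((s \<bar>a - b\<bar> + e / 2) + (s \<bar>b - c\<bar> + e / 2))\<^sup>2"
      using e p by (intro bound) auto
    then have "s \<bar>a - c\<bar> \<le> (s \<bar>a - b\<bar> + e / 2) + (s \<bar>b - c\<bar> + e / 2)"
      by (rule power2_le_imp_le) (intro add_nonneg_nonneg less_imp_le[OF p])
    then show "s \<bar>a - c\<bar> \<le> s \<bar>a - b\<bar> + s \<bar>b - c\<bar> + e" by simp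
  qed
qed

lemma std_subadditive: "0 \<le> t \<Longrightarrow> 0 \<le> u \<Longrightarrow> s (t + u) \<le> s t + s u"
  using std_triangle[of "t + u" 0 u] by simp

lemma std_diff_le: "0 \<le> t \<Longrightarrow> 0 \<le> u \<Longrightarrow> \<bar>s t - s u\<bar> \<le> s \<bar>t - u\<bar>"
  using std_triangle[of t 0 u] std_triangle[of u 0 t] by (simp add: abs_minus_commute)

text \<open>
  Continuity of the paths passes to the variances through the characteristic function:
  \<open>exp (- s(h)\<^sup>2 / 2)\<close> is the expectation of \<open>cos (Y h)\<close>, which tends to
  one by dominated convergence.
\<close>
lemma std_tendsto_0: "(s \<longlongrightarrow> 0) (at_right 0)"
proof -
  have lim: "(\<lambda>n. expectation (\<lambda>\<omega>. cos (Y (h n) \<omega> + 0))) \<longlonglongrightarrow> expectation (\<lambda>\<omega>. 1)" if h: "h \<longlonglongrightarrow> 0" for h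
  proof (rule integral_dominated_convergence[where w = "\<lambda>_. 1"])
    show "AE \<omega> in M. (\<lambda>n. cos (Y (h n) \<omega> + 0)) \<longlonglongrightarrow> 1"
    proof (rule AE_I2)
      fix \<omega> assume w: "\<omega> \<in> space M"
      have "isCont (\<lambda>t. Y t \<omega>) 0" using cont[OF w] by (simp add: continuous_on_eq_continuous_at)
      then have "(\<lambda>n. Y (h n) \<omega>) \<longlonglongrightarrow> 0"
        using isCont_tendsto_compose[OF _ h] zero[OF w] by fastforce
      then have "(\<lambda>n. cos (Y (h n) \<omega> + 0)) \<longlonglongrightarrow> cos (0 + 0)" by (intro tendsto_intros)
      then show "(\<lambda>n. cos (Y (h n) \<omega> + 0)) \<longlonglongrightarrow> 1" by simp
    qed
  qed auto
  show ?thesis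
  proof (subst tendsto_at_iff_sequentially, intro allI impI)
    fix h :: "nat \<Rightarrow> real" assume h: "\<forall>i. h i \<in> {0<..} - {0}" "h \<longlonglongrightarrow> 0"
    have "expectation (\<lambda>\<omega>. cos (Y (h n) \<omega> + 0)) = exp (- (s (h n))\<^sup>2 / 2)" for n
      using centered_gaussian(3)[OF gaussian_coordinate mean, of "h n" 0] second_moment[of "h n"] h(1) 
      by (simp add: less_imp_le abs_of_pos)
    then have "(\<lambda>n. exp (- (s (h n))\<^sup>2 / 2)) \<longlonglongrightarrow> 1"
      using lim[OF h(2)] by (simp add: prob_space)
    then have "(\<lambda>n. ln (exp (- (s (h n))\<^sup>2 / 2))) \<longlonglongrightarrow> ln 1"
      by (intro tendsto_ln) auto
    then have "(\<lambda>n. - 2 * (- (s (h n))\<^sup>2 / 2)) \<longlonglongrightarrow> - 2 * 0"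
      by (intro tendsto_mult) auto
    then have "(\<lambda>n. sqrt ((s (h n))\<^sup>2)) \<longlonglongrightarrow> sqrt 0"
      by (intro tendsto_real_sqrt) simp
    then show "(s \<circ> h) \<longlonglongrightarrow> 0" by (simp add: s_nonneg o_def)
  qed
qed

end

lemma gaussian_process_time_change:
  assumes Y: "gaussian_process M Y" and d: "d \<noteq> 0"
  shows "gaussian_process M (\<lambda>t \<omega>. Y (d * t) \<omega> / b)"
  unfolding gaussian_process_def
proof (intro allI impI)
  fix J :: "real set" and a assume J: "finite J"
  have "(\<Sum>t\<in>J. a t * (Y (d * t) \<omega> / b)) = (\<Sum>u\<in>(*) d ` J. (a (u / d) / b) * Y u \<omega>)" for \<omega>
    using d by (subst sum.reindex) (auto simp: inj_on_def)
  moreover have "gaussian_variable M (\<lambda>\<omega>. \<Sum>u\<in>(*) d ` J. (a (u / d) / b) * Y u \<omega>)"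
    using Y J by (simp only: gaussian_process_def finite_imageI)
  ultimately show "gaussian_variable M (\<lambda>\<omega>. \<Sum>t\<in>J. a t * (Y (d * t) \<omega> / b))"
    by simp
qed

context gaussian_increments
begin

lemma time_change:
  assumes d: "d \<noteq> 0" and b: "0 < b"
  shows "gaussian_increments M (\<lambda>t \<omega>. Y (d * t) \<omega> / b) (\<lambda>h. s (\<bar>d\<bar> * h) / b)"
proof
  show "gaussian_process M (\<lambda>t \<omega>. Y (d * t) \<omega> / b)"
    by (rule gaussian_process_time_change[OF gauss d])
  show "expectation (\<lambda>\<omega>. Y (d * t) \<omega> / b) = 0" for t
    using mean by simp
  show "expectation (\<lambda>\<omega>. (Y (d * t) \<omega> / b - Y (d * u) \<omega> / b)\<^sup>2) = (s (\<bar>d\<bar> * \<bar>t - u\<bar>) / b)\<^sup>2" for t u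
  proof -
    have "expectation (\<lambda>\<omega>. (Y (d * t) \<omega> / b - Y (d * u) \<omega> / b)\<^sup>2) =
        expectation (\<lambda>\<omega>. (Y (d * t) \<omega> - Y (d * u) \<omega>)\<^sup>2 / b\<^sup>2)"
      by (simp add: diff_divide_distrib[symmetric] power_divide)
    also have "\<dots> = (s \<bar>d * t - d * u\<bar>)\<^sup>2 / b\<^sup>2"
      by (simp add: increment)
    finally show ?thesis by (simp add: power_divide right_diff_distrib[symmetric] abs_mult)
  qed
  show "0 \<le> s (\<bar>d\<bar> * t) / b" for t using s_nonneg b by simp
  show "Y (d * 0) \<omega> / b = 0" if "\<omega> \<in> space M" for \<omega> using zero[OF that] by simp
  show "continuous_on UNIV (\<lambda>t. Y (d * t) \<omega> / b)" if "\<omega> \<in> space M" for \<omega>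
    using b by (intro continuous_on_divide continuous_on_const continuous_on_compose2[OF cont[OF that]] continuous_intros) auto
qed

lemma time_reversal: "gaussian_increments M (\<lambda>t. Y (- t)) s"
  using time_change[of "- 1" 1] by simp

end

lemma gaussian_increments_of_stationary:
  assumes "prob_space M" and X: "gaussian_stationary_increments M X"
  shows "gaussian_increments M X (std_function M X)"
proof -
  interpret prob_space M by fact
  have gauss: "gaussian_process M X" and mean: "\<And>t. expectation (X t) = 0"
    and stat: "stationary_increments M X"
    and zero: "\<And>\<omega>. \<omega> \<in> space M \<Longrightarrow> X 0 \<omega> = 0"
    and cont: "\<And>\<omega>. \<omega> \<in> space M \<Longrightarrow> continuous_on UNIV (\<lambda>t. X t \<omega>)"
    using X by (auto simp: gaussian_stationary_increments_def centered_def continuous_paths_def)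
  have "gaussian_variable M (X t)" for t
    using gauss[unfolded gaussian_process_def, rule_format, of "{t}" "\<lambda>_. 1"] by simp
  then have [measurable]: "X t \<in> borel_measurable M" for t
    by (simp add: gaussian_variable_def)
  have std: "(std_function M X t)\<^sup>2 = expectation (\<lambda>\<omega>. (X t \<omega>)\<^sup>2)" for t
    by (simp add: std_function_def mean integral_nonneg_AE)
  have inc: "expectation (\<lambda>\<omega>. (X (r + h) \<omega> - X h \<omega>)\<^sup>2) = (std_function M X r)\<^sup>2" for r h
  proof -
    let ?P = "Pi\<^sub>M {r} (\<lambda>_. borel) :: (real \<Rightarrow> real) measure"
    have 1: "(\<lambda>\<omega>. \<lambda>t\<in>{r}. X (t + h) \<omega> - X h \<omega>) \<in> measurable M ?P"
      and 2: "(\<lambda>\<omega>. \<lambda>t\<in>{r}. X t \<omega> - X 0 \<omega>) \<in> measurable M ?P"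
      by measurable
    have sq: "(\<lambda>z. (z r)\<^sup>2) \<in> borel_measurable ?P" by measurable
    have "expectation (\<lambda>\<omega>. (X (r + h) \<omega> - X h \<omega>)\<^sup>2) =
      (\<integral>z. (z r)\<^sup>2 \<partial>distr M ?P (\<lambda>\<omega>. \<lambda>t\<in>{r}. X (t + h) \<omega> - X h \<omega>))"
      by (subst integral_distr[OF 1 sq]) simp
    also have "\<dots> = (\<integral>z. (z r)\<^sup>2 \<partial>distr M ?P (\<lambda>\<omega>. \<lambda>t\<in>{r}. X t \<omega> - X 0 \<omega>))"
      using stat[unfolded stationary_increments_def, rule_format, of "{r}" h] by simp
    also have "\<dots> = expectation (\<lambda>\<omega>. (X r \<omega> - X 0 \<omega>)\<^sup>2)"
      by (subst integral_distr[OF 2 sq]) simp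
    also have "\<dots> = expectation (\<lambda>\<omega>. (X r \<omega>)\<^sup>2)"
      by (intro Bochner_Integration.integral_cong) (auto simp: zero)
    finally show ?thesis by (simp add: std)
  qed
  show ?thesis
  proof
    show "expectation (\<lambda>\<omega>. (X t \<omega> - X u \<omega>)\<^sup>2) = (std_function M X \<bar>t - u\<bar>)\<^sup>2" for t u
      using inc[of "t - u" u] inc[of "u - t" t] by (cases "u \<le> t") (auto simp: power2_commute)
    show "0 \<le> std_function M X t" for t
      by (simp add: std_function_def integral_nonneg_AE)
  qed (use gauss mean zero cont in auto)
qed

lemma gaussian_increments_fractional_brownian_motion:
  assumes N: "prob_space N" and B: "fractional_brownian_motion N H B"
  shows "gaussian_increments N B (\<lambda>h. \<bar>h\<bar> powr H)"
proof -
  interpret B: gaussian_increments N B "std_function N B"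
    using B by (intro gaussian_increments_of_stationary[OF N]) (simp add: fractional_brownian_motion_def)
  have "(std_function N B t)\<^sup>2 = (\<bar>t\<bar> powr H)\<^sup>2" for t
  proof -
    have "(std_function N B t)\<^sup>2 = Defs.covariance N (B t) (B t)"
      by (simp add: std_function_def Defs.covariance_def power2_eq_square integral_nonneg_AE)
    also have "\<dots> = \<bar>t\<bar> powr (2 * H)"
    proof -
      have "Defs.covariance N (B t) (B t) =
          (\<bar>t\<bar> powr (2 * H) + \<bar>t\<bar> powr (2 * H) - \<bar>t - t\<bar> powr (2 * H)) / 2"
        using B unfolding fractional_brownian_motion_def by blast
      then show ?thesis by simp
    qed
    also have "\<dots> = (\<bar>t\<bar> powr H)\<^sup>2" by (simp only: mult_2 powr_add power2_eq_square)
    finally show ?thesis .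
  qed
  then have "std_function N B t = \<bar>t\<bar> powr H" for t
    by (rule power2_eq_imp_eq) (rule B.s_nonneg powr_ge_zero)+
  then have "std_function N B = (\<lambda>h. \<bar>h\<bar> powr H)" by (rule ext)
  then show ?thesis using B.gaussian_increments_axioms by (simp only:)
qed

section \<open>Dyadic chaining and compact sets of paths\<close>

lemma floor_twice: "\<lfloor>2 * x\<rfloor> = 2 * \<lfloor>x::real\<rfloor> \<or> \<lfloor>2 * x\<rfloor> = 2 * \<lfloor>x\<rfloor> + 1"
  by linarith

text \<open>
  \<open>D t j\<close> is the dyadic number of level \<open>j\<close> just below \<open>t\<close>.  Passing
  from \<open>D t j\<close> to \<open>D t (j + 1)\<close> moves by at most one dyadic step, so the
  distance from \<open>x (D t m)\<close> to \<open>x t\<close> is a geometric tail; two points within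
  \<open>2\<^sup>-\<^sup>m\<close> have equal or neighbouring approximations of level \<open>m\<close>.
\<close>
lemma dyadic_chaining:
  fixes x :: "real \<Rightarrow> real"
  assumes cont: "continuous_on {0..1} x" and r: "0 < r" "r < 1" and B: "0 \<le> B"
    and inc: "\<And>m i. i < 2 ^ m \<Longrightarrow> \<bar>x ((real i + 1) / 2 ^ m) - x (real i / 2 ^ m)\<bar> \<le> B * r ^ m"
    and t: "t \<in> {0..1}" and u: "u \<in> {0..1}" and close: "\<bar>t - u\<bar> \<le> 1 / 2 ^ m"
  shows "\<bar>x t - x u\<bar> \<le> 2 / (1 - r) * B * r ^ m"
proof -
  define D :: "real \<Rightarrow> nat \<Rightarrow> real" where "D t j = of_int \<lfloor>t * 2 ^ j\<rfloor> / 2 ^ j" for t j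
  have step: "\<bar>x (of_int (k + 1) / 2 ^ j) - x (of_int k / 2 ^ j)\<bar> \<le> B * r ^ j"
    if "0 \<le> k" "k + 1 \<le> 2 ^ j" for k :: int and j
  proof -
    have "int (nat k) < int (2 ^ j)" using that by simp
    then have "nat k < 2 ^ j" by (simp only: of_nat_less_iff)
    then show ?thesis using inc[of "nat k" j] that(1) by simp
  qed
  have fl: "0 \<le> \<lfloor>t * 2 ^ j\<rfloor>" "\<lfloor>t * 2 ^ j\<rfloor> \<le> 2 ^ j" if "t \<in> {0..1}" for t :: real and j
  proof -
    show "0 \<le> \<lfloor>t * 2 ^ j\<rfloor>" using that by simp
    have "t * 2 ^ j \<le> 2 ^ j" using that by simp
    then have "t * 2 ^ j \<le> of_int (2 ^ j)" by simp
    then have "\<lfloor>t * 2 ^ j\<rfloor> \<le> \<lfloor>of_int (2 ^ j) :: real\<rfloor>" by (rule floor_mono)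
    then show "\<lfloor>t * 2 ^ j\<rfloor> \<le> 2 ^ j" by (simp only: floor_of_int)
  qed
  have refine: "\<bar>x (D t (Suc j)) - x (D t j)\<bar> \<le> B * r ^ Suc j" if t: "t \<in> {0..1}" for t :: real and j
  proof -
    have eq: "D t j = of_int (2 * \<lfloor>t * 2 ^ j\<rfloor>) / 2 ^ Suc j" by (simp add: D_def)
    have t2: "t * 2 ^ Suc j = 2 * (t * 2 ^ j)" by simp
    consider "\<lfloor>t * 2 ^ Suc j\<rfloor> = 2 * \<lfloor>t * 2 ^ j\<rfloor>" | "\<lfloor>t * 2 ^ Suc j\<rfloor> = 2 * \<lfloor>t * 2 ^ j\<rfloor> + 1"
      unfolding t2 using floor_twice by blast
    then show ?thesis
    proof cases
      case 1
      then have "D t (Suc j) = D t j" unfolding eq by (simp add: D_def)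
      then show ?thesis using B r by simp
    next
      case 2
      then have "D t (Suc j) = of_int (2 * \<lfloor>t * 2 ^ j\<rfloor> + 1) / 2 ^ Suc j" unfolding D_def by simp
      moreover have "2 * \<lfloor>t * 2 ^ j\<rfloor> + 1 \<le> 2 ^ Suc j" using fl(2)[OF t, of "Suc j"] 2 by simp
      ultimately show ?thesis using step[of "2 * \<lfloor>t * 2 ^ j\<rfloor>" "Suc j"] fl(1)[OF t, of j] unfolding eq by simp
    qed
  qed
  have D_range: "D t j \<in> {0..1}" if "t \<in> {0..1}" for t :: real and j
  proof -
    have "of_int \<lfloor>t * 2 ^ j\<rfloor> \<le> (of_int (2 ^ j) :: real)" using fl(2)[OF that, of j] by (simp only: of_int_le_iff)
    then show ?thesis using fl(1)[OF that, of j] by (simp add: D_def)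
  qed
  have D_close: "\<bar>D t j - t\<bar> \<le> 1 / 2 ^ j" for t j
  proof -
    have "\<bar>of_int \<lfloor>t * 2 ^ j\<rfloor> - t * 2 ^ j\<bar> \<le> 1" by linarith
    then have "\<bar>of_int \<lfloor>t * 2 ^ j\<rfloor> - t * 2 ^ j\<bar> / 2 ^ j \<le> 1 / 2 ^ j" by (intro divide_right_mono) auto
    moreover have "\<bar>of_int \<lfloor>t * 2 ^ j\<rfloor> - t * 2 ^ j\<bar> / 2 ^ j = \<bar>D t j - t\<bar>"
    proof -
      have "D t j - t = (of_int \<lfloor>t * 2 ^ j\<rfloor> - t * 2 ^ j) / 2 ^ j" by (simp add: D_def diff_divide_distrib)
      then show ?thesis by (simp add: abs_divide)
    qed
    ultimately show ?thesis by simp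
  qed
  have D_lim: "(\<lambda>j. x (D t j)) \<longlonglongrightarrow> x t" if t: "t \<in> {0..1}" for t :: real
  proof (rule continuous_on_tendsto_compose[OF cont _ t])
    show "(\<lambda>j. D t j) \<longlonglongrightarrow> t"
    proof (rule LIM_zero_cancel, rule Lim_null_comparison)
      show "\<forall>\<^sub>F j in sequentially. norm (D t j - t) \<le> (1/2) ^ j"
        using D_close by (simp add: power_one_over)
      show "(\<lambda>j. (1/2::real) ^ j) \<longlonglongrightarrow> 0" by (rule LIMSEQ_power_zero) simp
    qed
    show "\<forall>\<^sub>F j in sequentially. D t j \<in> {0..1}" using D_range[OF t] by simp
  qed
  have tail: "\<bar>x t - x (D t m)\<bar> \<le> B * (r ^ Suc m / (1 - r))" if t: "t \<in> {0..1}" for t :: real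
  proof -
    have part: "\<bar>x (D t (m + n)) - x (D t m)\<bar> \<le> B * (r ^ Suc m * (1 - r ^ n) / (1 - r))" for n
    proof (induction n)
      case (Suc n)
      have "\<bar>x (D t (m + Suc n)) - x (D t m)\<bar> \<le> B * r ^ Suc (m + n) + B * (r ^ Suc m * (1 - r ^ n) / (1 - r))"
        using Suc refine[OF t, of "m + n"] by simp
      also have "\<dots> = B * (r ^ Suc m * (1 - r ^ Suc n) / (1 - r))"
        using r by (simp add: field_simps power_add)
      finally show ?case .
    qed simp
    have "\<bar>x (D t (m + n)) - x (D t m)\<bar> \<le> B * (r ^ Suc m / (1 - r))" for n
    proof -
      have "r ^ Suc m * (1 - r ^ n) / (1 - r) \<le> r ^ Suc m * 1 / (1 - r)"
        using r by (intro divide_right_mono mult_left_mono) auto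
      then have "r ^ Suc m * (1 - r ^ n) / (1 - r) \<le> r ^ Suc m / (1 - r)" by (simp only: mult_1_right)
      from part[of n] mult_left_mono[OF this B] show ?thesis by (rule order_trans)
    qed
    moreover have "(\<lambda>n. \<bar>x (D t (m + n)) - x (D t m)\<bar>) \<longlonglongrightarrow> \<bar>x t - x (D t m)\<bar>"
      using LIMSEQ_ignore_initial_segment[OF D_lim[OF t], of m]
      by (intro tendsto_intros) (simp add: add.commute)
    ultimately show ?thesis by (intro LIMSEQ_le_const2) auto
  qed
  have near: "\<bar>x (D t m) - x (D u m)\<bar> \<le> B * r ^ m" if tu: "t \<in> {0..1}" "u \<in> {0..1}" "u \<le> t" "t - u \<le> 1 / 2 ^ m" for t u :: real
  proof -
    have "t * 2 ^ m \<le> u * 2 ^ m + 1" using tu(4) by (simp add: field_simps)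
    then have "\<lfloor>t * 2 ^ m\<rfloor> \<le> \<lfloor>u * 2 ^ m\<rfloor> + 1" by linarith
    moreover have "\<lfloor>u * 2 ^ m\<rfloor> \<le> \<lfloor>t * 2 ^ m\<rfloor>" using tu by (intro floor_mono mult_right_mono) auto
    ultimately consider "\<lfloor>t * 2 ^ m\<rfloor> = \<lfloor>u * 2 ^ m\<rfloor>" | "\<lfloor>t * 2 ^ m\<rfloor> = \<lfloor>u * 2 ^ m\<rfloor> + 1" by linarith
    then show ?thesis
    proof cases
      case 1
      then show ?thesis using B r by (simp add: D_def)
    next
      case 2
      then show ?thesis using step[of "\<lfloor>u * 2 ^ m\<rfloor>" m] fl[OF tu(1), of m] fl[OF tu(2), of m] by (simp add: D_def)
    qed
  qed
  have "\<bar>x (D t m) - x (D u m)\<bar> \<le> B * r ^ m"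
    using near[of t u] near[of u t] t u close by (cases "u \<le> t") auto
  then have "\<bar>x t - x u\<bar> \<le> B * r ^ m + 2 * (B * (r ^ Suc m / (1 - r)))"
    using tail[OF t] tail[OF u] by linarith
  also have "\<dots> = B * r ^ m * ((1 + r) / (1 - r))"
    using r by (simp add: field_simps)
  also have "\<dots> \<le> B * r ^ m * (2 / (1 - r))"
    using r B by (intro mult_left_mono divide_right_mono) auto
  finally show ?thesis by (simp add: mult_ac)
qed

text \<open>
  Countably many conditions on a path, each on one value or one dyadic increment, so that they
  form an event and a union bound applies.  Constants grow with the unit cell like
  \<open>(1 + n)\<^sup>\<beta>\<close>: with \<open>\<beta> < 1\<close> this is slow enough to be beaten by
  the drift, and with high moments fast enough to make the union bound summable.
\<close>
definition controlled :: "real \<Rightarrow> real \<Rightarrow> real \<Rightarrow> (real \<Rightarrow> real) \<Rightarrow> bool" where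
  "controlled A \<beta> r x \<longleftrightarrow>
     (\<forall>n::nat. \<bar>x (real n)\<bar> \<le> A * (1 + real n) powr \<beta>) \<and>
     (\<forall>n m. \<forall>i<2 ^ m. \<bar>x (real n + (real i + 1) / 2 ^ m) - x (real n + real i / 2 ^ m)\<bar>
        \<le> A * (1 + real n) powr \<beta> * r ^ m)"

text \<open>
  The closed consequences of \<open>controlled\<close> for a continuous path, on both half-lines: a
  growth bound at the integers and a modulus of continuity on every unit cell.
\<close>
definition controlled_paths :: "real \<Rightarrow> real \<Rightarrow> real \<Rightarrow> (real \<Rightarrow> real) set" where
  "controlled_paths A \<beta> r = {x.
     (\<forall>k::int. \<bar>x (of_int k)\<bar> \<le> A * (1 + \<bar>of_int k\<bar>) powr \<beta>) \<and>
     (\<forall>k::int. \<forall>m. \<forall>t\<in>{of_int k..of_int k + 1}. \<forall>u\<in>{of_int k..of_int k + 1}. \<bar>t - u\<bar> \<le> 1 / 2 ^ m \<longrightarrow>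
        \<bar>x t - x u\<bar> \<le> 2 / (1 - r) * (A * (1 + \<bar>of_int k\<bar>) powr \<beta>) * r ^ m)}"

lemma controlled_cell:
  assumes cont: "continuous_on UNIV x" and x: "controlled A \<beta> r x" and A: "0 \<le> A" and r: "0 < r" "r < 1"
    and tu: "t \<in> {real n..real n + 1}" "u \<in> {real n..real n + 1}" "\<bar>t - u\<bar> \<le> 1 / 2 ^ m"
  shows "\<bar>x t - x u\<bar> \<le> 2 / (1 - r) * (A * (1 + real n) powr \<beta>) * r ^ m"
proof -
  let ?y = "\<lambda>h. x (real n + h)"
  have "\<bar>?y (t - real n) - ?y (u - real n)\<bar> \<le> 2 / (1 - r) * (A * (1 + real n) powr \<beta>) * r ^ m"
  proof (rule dyadic_chaining[where x = ?y])
    show "continuous_on {0..1} ?y"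
      by (intro continuous_on_compose2[OF cont] continuous_intros) auto
    show "\<bar>?y ((real i + 1) / 2 ^ m) - ?y (real i / 2 ^ m)\<bar> \<le> A * (1 + real n) powr \<beta> * r ^ m" if "i < 2 ^ m" for m i
      using x that by (simp add: controlled_def)
  qed (use A r tu in auto)
  then show ?thesis by simp
qed

lemma controlled_imp_controlled_paths:
  assumes cont: "continuous_on UNIV x" and x: "controlled A \<beta> r x" "controlled A \<beta> r (\<lambda>t. x (- t))"
    and A: "0 \<le> A" and r: "0 < r" "r < 1" and \<beta>: "0 \<le> \<beta>"
  shows "x \<in> controlled_paths A \<beta> r"
proof -
  have cont': "continuous_on UNIV (\<lambda>t. x (- t))"
    by (intro continuous_on_compose2[OF cont] continuous_intros) auto
  have "\<bar>x (of_int k)\<bar> \<le> A * (1 + \<bar>of_int k\<bar>) powr \<beta>" for k :: int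
  proof (cases "0 \<le> k")
    case True
    then obtain n where n: "k = int n" using nonneg_int_cases by blast
    have "\<bar>x (real n)\<bar> \<le> A * (1 + real n) powr \<beta>" using x(1) unfolding controlled_def by blast
    then show ?thesis by (simp add: n)
  next
    case False
    then have "0 \<le> - k" by simp
    then obtain n where "- k = int n" using nonneg_int_cases by blast
    then have n: "k = - int n" by simp
    have "\<bar>x (- real n)\<bar> \<le> A * (1 + real n) powr \<beta>" using x(2) unfolding controlled_def by blast
    then show ?thesis by (simp add: n)
  qed
  moreover have "\<bar>x t - x u\<bar> \<le> 2 / (1 - r) * (A * (1 + \<bar>of_int k\<bar>) powr \<beta>) * r ^ m"
    if tu: "t \<in> {of_int k..of_int k + 1}" "u \<in> {of_int k..of_int k + 1}" "\<bar>t - u\<bar> \<le> 1 / 2 ^ m" for k :: int and m t u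
  proof (cases "0 \<le> k")
    case True
    then obtain n where n: "k = int n" using nonneg_int_cases by blast
    show ?thesis using controlled_cell[OF cont x(1) A r, of t n u m] tu by (simp add: n)
  next
    case False
    then have "0 \<le> - k - 1" by simp
    then obtain n where n0: "- k - 1 = int n" using nonneg_int_cases by blast
    \<comment> \<open>Reflection maps the cell \<open>[-n-1, -n]\<close> onto the cell \<open>[n, n+1]\<close>.\<close>
    then have n: "k = - int n - 1" by simp
    have "\<bar>x (- (- t)) - x (- (- u))\<bar> \<le> 2 / (1 - r) * (A * (1 + real n) powr \<beta>) * r ^ m"
      by (rule controlled_cell[OF cont' x(2) A r]) (use tu in \<open>auto simp: n\<close>)
    also have "\<dots> \<le> 2 / (1 - r) * (A * (1 + \<bar>of_int k\<bar>) powr \<beta>) * r ^ m"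
      using A r \<beta> by (intro mult_right_mono mult_left_mono powr_mono2) (auto simp: n)
    finally show ?thesis by simp
  qed
  ultimately show ?thesis unfolding controlled_paths_def by blast
qed

lemma controlled_paths_growth:
  assumes x: "x \<in> controlled_paths A \<beta> r" and A: "0 \<le> A" and r: "0 < r" "r < 1" and \<beta>: "0 \<le> \<beta>"
  shows "\<bar>x t\<bar> \<le> A * (1 + 2 / (1 - r)) * (2 + \<bar>t\<bar>) powr \<beta>"
proof -
  define k where "k = \<lfloor>t\<rfloor>"
  have t: "t \<in> {of_int k..of_int k + 1}" unfolding k_def by (simp add: less_imp_le)
  have kt: "\<bar>of_int k\<bar> \<le> 1 + \<bar>t\<bar>" using t by auto
  have 1: "\<bar>x (of_int k)\<bar> \<le> A * (1 + \<bar>of_int k\<bar>) powr \<beta>" using x unfolding controlled_paths_def by blast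
  have "\<bar>t - of_int k\<bar> \<le> 1 / 2 ^ 0" using t by auto
  then have 2: "\<bar>x t - x (of_int k)\<bar> \<le> 2 / (1 - r) * (A * (1 + \<bar>of_int k\<bar>) powr \<beta>) * r ^ 0"
    using x t unfolding controlled_paths_def by (auto simp del: power_0)
  have "\<bar>x t\<bar> \<le> A * (1 + 2 / (1 - r)) * (1 + \<bar>of_int k\<bar>) powr \<beta>"
    using 1 2 by (simp add: algebra_simps)
  also have "\<dots> \<le> A * (1 + 2 / (1 - r)) * (2 + \<bar>t\<bar>) powr \<beta>"
    using A r \<beta> kt by (intro mult_left_mono powr_mono2) auto
  finally show ?thesis .
qed

lemma controlled_paths_equicontinuous:
  assumes A: "0 \<le> A" and r: "0 < r" "r < 1" and \<beta>: "0 \<le> \<beta>" and e: "0 < e"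
  shows "\<exists>d>0. \<forall>x\<in>controlled_paths A \<beta> r. \<forall>t u. \<bar>t\<bar> \<le> L \<and> \<bar>u\<bar> \<le> L \<and> \<bar>t - u\<bar> \<le> d \<longrightarrow> \<bar>x t - x u\<bar> < e"
proof -
  define W where "W = 2 / (1 - r) * (A * (2 + \<bar>L\<bar>) powr \<beta>)"
  have W: "0 \<le> W" using A r by (simp add: W_def)
  have "(\<lambda>m. 2 * (W * r ^ m)) \<longlonglongrightarrow> 2 * (W * 0)"
    using r by (intro tendsto_mult tendsto_const LIMSEQ_power_zero) auto
  then have "\<forall>\<^sub>F m in sequentially. 2 * (W * r ^ m) < e"
    using e by (intro order_tendstoD(2)) auto
  then obtain m where m: "2 * (W * r ^ m) < e"
    using eventually_happens'[OF sequentially_bot] by blast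
  have Wm: "0 \<le> W * r ^ m" using W r by simp
  have main: "\<bar>x t - x u\<bar> < e"
    if x: "x \<in> controlled_paths A \<beta> r" and t: "\<bar>t\<bar> \<le> L" and u: "\<bar>u\<bar> \<le> L" and ut: "u \<le> t" and d: "t - u \<le> 1 / 2 ^ m" for x t u
  proof -
    have cell: "\<bar>x a - x b\<bar> \<le> W * r ^ m"
      if "a \<in> {of_int k..of_int k + 1}" "b \<in> {of_int k..of_int k + 1}" "\<bar>a - b\<bar> \<le> 1 / 2 ^ m" "\<bar>of_int k\<bar> \<le> 1 + \<bar>L\<bar>"
      for a b and k :: int
    proof -
      have "\<bar>x a - x b\<bar> \<le> 2 / (1 - r) * (A * (1 + \<bar>of_int k\<bar>) powr \<beta>) * r ^ m"
        using x that unfolding controlled_paths_def by blast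
      also have "\<dots> \<le> W * r ^ m"
        unfolding W_def using A r \<beta> that(4) by (intro mult_right_mono mult_left_mono powr_mono2) auto
      finally show ?thesis .
    qed
    have d1: "t - u \<le> 1" using d by (rule order_trans) simp
    have kb: "\<bar>of_int \<lfloor>t\<rfloor>\<bar> \<le> 1 + \<bar>L\<bar>" "\<bar>of_int \<lfloor>u\<rfloor>\<bar> \<le> 1 + \<bar>L\<bar>" using t u by linarith+
    \<comment> \<open>Points of two neighbouring cells are compared through the common endpoint.\<close>
    consider "\<lfloor>t\<rfloor> = \<lfloor>u\<rfloor>" | "\<lfloor>t\<rfloor> = \<lfloor>u\<rfloor> + 1" using ut d1 by linarith
    then show ?thesis
    proof cases
      case 1
      have tc: "t \<in> {of_int \<lfloor>u\<rfloor>..of_int \<lfloor>u\<rfloor> + 1}" "u \<in> {of_int \<lfloor>u\<rfloor>..of_int \<lfloor>u\<rfloor> + 1}"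
        using 1 by (simp_all, linarith+)
      have "\<bar>x t - x u\<bar> \<le> W * r ^ m"
        by (rule cell[OF tc _ kb(2)]) (use ut d in simp)
      then show ?thesis using m Wm by linarith
    next
      case 2
      let ?b = "of_int \<lfloor>t\<rfloor> :: real"
      have b: "u \<le> ?b" "?b \<le> t" using 2 by linarith+
      have fl: "of_int \<lfloor>a\<rfloor> \<le> a" "a \<le> of_int \<lfloor>a\<rfloor> + 1" for a :: real by linarith+
      have "t \<in> {?b..?b + 1}" "?b \<in> {?b..?b + 1}" "\<bar>t - ?b\<bar> \<le> 1 / 2 ^ m"
        using b d fl[of t] by auto
      then have "\<bar>x t - x ?b\<bar> \<le> W * r ^ m" using kb(1) by (rule cell)
      moreover have "?b \<in> {of_int \<lfloor>u\<rfloor>..of_int \<lfloor>u\<rfloor> + 1}" "u \<in> {of_int \<lfloor>u\<rfloor>..of_int \<lfloor>u\<rfloor> + 1}" "\<bar>?b - u\<bar> \<le> 1 / 2 ^ m"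
        using b d fl[of u] 2 by auto
      then have "\<bar>x ?b - x u\<bar> \<le> W * r ^ m" using kb(2) by (rule cell)
      ultimately show ?thesis using m by linarith
    qed
  qed
  show ?thesis
  proof (intro exI[of _ "1 / 2 ^ m"] conjI ballI allI impI)
    fix x t u assume x: "x \<in> controlled_paths A \<beta> r" and tu: "\<bar>t\<bar> \<le> L \<and> \<bar>u\<bar> \<le> L \<and> \<bar>t - u\<bar> \<le> 1 / 2 ^ m"
    show "\<bar>x t - x u\<bar> < e"
      using main[OF x, of t u] main[OF x, of u t] tu by (cases "u \<le> t") (auto simp: abs_minus_commute)
  qed simp
qed

lemma compact_Pi_UNIV:
  fixes S :: "'i \<Rightarrow> 'b::topological_space set"
  assumes "\<And>i. compact (S i)"
  shows "compact (Pi UNIV S)"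
proof -
  have "compactin (product_topology (\<lambda>i. euclidean) UNIV) (PiE UNIV S)"
    using assms by (subst compactin_PiE) auto
  then show ?thesis by (simp add: euclidean_product_topology PiE_UNIV_domain)
qed

text \<open>
  The growth bound confines the set to a product of compact intervals, so Tychonoff's theorem
  applies in the topology of pointwise convergence; the equicontinuity built into the set is
  what later turns pointwise into locally uniform convergence.
\<close>
lemma compact_controlled_paths:
  assumes A: "0 \<le> A" and r: "0 < r" "r < 1" and \<beta>: "0 \<le> \<beta>"
  shows "compact (controlled_paths A \<beta> r)"
proof -
  define g where "g t = A * (1 + 2 / (1 - r)) * (2 + \<bar>t\<bar>) powr \<beta>" for t :: real
  have "compact (Pi UNIV (\<lambda>t. {- g t..g t}))"
    by (rule compact_Pi_UNIV) simp
  moreover have coord: "continuous_on UNIV (\<lambda>x::real \<Rightarrow> real. x i)" for i by simp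
  have "closed (controlled_paths A \<beta> r)"
    unfolding controlled_paths_def Ball_def
    by (intro closed_Collect_conj closed_Collect_all closed_Collect_imp closed_Collect_le open_Collect_const
        continuous_intros coord)
  ultimately have "compact (Pi UNIV (\<lambda>t. {- g t..g t}) \<inter> controlled_paths A \<beta> r)"
    by (rule compact_Int_closed)
  moreover have "x t \<in> {- g t..g t}" if "x \<in> controlled_paths A \<beta> r" for x t
    using controlled_paths_growth[OF that A r \<beta>, of t] by (simp add: g_def abs_le_iff)
  then have "Pi UNIV (\<lambda>t. {- g t..g t}) \<inter> controlled_paths A \<beta> r = controlled_paths A \<beta> r"
    by blast
  ultimately show ?thesis by simp
qed

section \<open>Tightness by moments\<close>

lemma (in prob_space) gaussian_tail:
  assumes Z: "gaussian_variable M Z" "expectation Z = 0" and v: "expectation (\<lambda>\<omega>. (Z \<omega>)\<^sup>2) \<le> v\<^sup>2" and a: "0 < a"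
  shows "prob {\<omega> \<in> space M. a < \<bar>Z \<omega>\<bar>} \<le> fact (2 * p) / (2 ^ p * fact p) * (v / a) ^ (2 * p)"
proof -
  have [measurable]: "Z \<in> borel_measurable M" using Z by (simp add: gaussian_variable_def)
  have sq: "0 \<le> expectation (\<lambda>\<omega>. (Z \<omega>)\<^sup>2)" by (rule integral_nonneg_AE) simp
  have "prob {\<omega> \<in> space M. a < \<bar>Z \<omega>\<bar>} \<le> prob {\<omega> \<in> space M. a ^ (2 * p) \<le> Z \<omega> ^ (2 * p)}"
  proof (rule finite_measure_mono)
    show "{\<omega> \<in> space M. a < \<bar>Z \<omega>\<bar>} \<subseteq> {\<omega> \<in> space M. a ^ (2 * p) \<le> Z \<omega> ^ (2 * p)}"
    proof safe
      fix \<omega> assume "a < \<bar>Z \<omega>\<bar>"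
      then have "a ^ (2 * p) \<le> \<bar>Z \<omega>\<bar> ^ (2 * p)" using a by (intro power_mono) auto
      then show "a ^ (2 * p) \<le> Z \<omega> ^ (2 * p)" by (simp only: power_even_abs even_mult_iff even_numeral simp_thms)
    qed
  qed simp
  also have "\<dots> \<le> expectation (\<lambda>\<omega>. Z \<omega> ^ (2 * p)) / a ^ (2 * p)"
    by (rule integral_Markov_inequality_measure[OF centered_gaussian(1)[OF Z], where A = "{}"]) (use a in auto)
  also have "\<dots> \<le> fact (2 * p) / (2 ^ p * fact p) * (v\<^sup>2) ^ p / a ^ (2 * p)"
    unfolding centered_gaussian(2)[OF Z]
    by (intro divide_right_mono mult_left_mono power_mono v sq) (use a in auto)
  finally show ?thesis by (simp add: power_divide power_mult)
qed

lemma (in prob_space) prob_UN_le_suminf: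
  assumes A: "\<And>i. A i \<in> events" and b: "\<And>i::nat. prob (A i) \<le> b i" "summable b"
  shows "prob (\<Union>i. A i) \<le> (\<Sum>i. b i)"
proof -
  have s: "summable (\<lambda>i. prob (A i))"
    by (rule summable_comparison_test'[OF b(2), of 0]) (simp add: b(1))
  have "prob (\<Union>i. A i) \<le> (\<Sum>i. prob (A i))"
    by (rule finite_measure_subadditive_countably) (use A s in auto)
  also have "\<dots> \<le> (\<Sum>i. b i)" by (rule suminf_le[OF b(1) s b(2)])
  finally show ?thesis .
qed

context gaussian_increments
begin

lemma controlled_event [measurable]: "{\<omega> \<in> space M. controlled A \<beta> r (\<lambda>t. Y t \<omega>)} \<in> events"
  unfolding controlled_def by measurable

text \<open>
  Markov's inequality with the \<open>2p\<close>-th moment.  On level \<open>m\<close> there are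
  \<open>2\<^sup>m\<close> increments, each with standard deviation of order \<open>r\<^sup>2\<^sup>m\<close> tested
  against a threshold of order \<open>r\<^sup>m\<close>; the surplus \<open>r\<^sup>m\<close> to the power
  \<open>2p\<close> is at most \<open>4\<^sup>-\<^sup>m\<close>, which pays for their number.
\<close>
lemma prob_not_controlled_cell:
  assumes A: "0 < A" and C: "0 \<le> C" and r: "0 < r"
    and p: "r ^ (2 * p) \<le> 1 / 4" "2 \<le> 2 * real p * (\<beta> - \<gamma>)" and \<gamma>: "0 \<le> \<gamma>"
    and nat: "s (real n) \<le> C * (1 + real n) powr \<gamma>"
    and dyadic: "\<And>m. s (1 / 2 ^ m) \<le> C * (r ^ 2) ^ m"
  defines "q \<equiv> fact (2 * p) / (2 ^ p * fact p) * (C / A) ^ (2 * p)"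
  defines "V \<equiv> {\<omega> \<in> space M. A * (1 + real n) powr \<beta> < \<bar>Y (real n) \<omega>\<bar>}"
  defines "I \<equiv> \<lambda>m i. {\<omega> \<in> space M. A * (1 + real n) powr \<beta> * r ^ m
      < \<bar>Y (real n + (real i + 1) / 2 ^ m) \<omega> - Y (real n + real i / 2 ^ m) \<omega>\<bar>}"
  shows "prob (V \<union> (\<Union>m. \<Union>i\<in>{..<2 ^ m}. I m i)) \<le> 3 * q * (1 / (1 + real n)\<^sup>2)"
proof -
  let ?D = "fact (2 * p) / (2 ^ p * fact p) :: real"
  have q: "0 \<le> q" using A C by (simp add: q_def)
  have n1: "1 \<le> 1 + real n" by simp
  have powr_decay: "((1 + real n) powr (\<gamma> - \<beta>)) ^ (2 * p) \<le> 1 / (1 + real n)\<^sup>2"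
  proof -
    have "((1 + real n) powr (\<gamma> - \<beta>)) ^ (2 * p) = (1 + real n) powr ((\<gamma> - \<beta>) * real (2 * p))"
      by (simp add: powr_realpow[symmetric] powr_powr)
    also have "\<dots> \<le> (1 + real n) powr (- 2)"
      using p(2) by (intro powr_mono n1) (simp add: algebra_simps)
    also have "\<dots> = 1 / (1 + real n)\<^sup>2" by (simp add: powr_minus_divide)
    finally show ?thesis .
  qed
  have Vm [measurable]: "V \<in> events" unfolding V_def by measurable
  have Im [measurable]: "I m i \<in> events" for m i unfolding I_def by measurable
  have V: "prob V \<le> q * (1 / (1 + real n)\<^sup>2)"
  proof -
    have "prob V \<le> ?D * (s (real n) / (A * (1 + real n) powr \<beta>)) ^ (2 * p)"
      unfolding V_def by (rule gaussian_tail[OF gaussian_coordinate mean]) (use A second_moment in auto)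
    also have "\<dots> \<le> ?D * (C / A * (1 + real n) powr (\<gamma> - \<beta>)) ^ (2 * p)"
    proof (intro mult_left_mono power_mono)
      have "s (real n) / (A * (1 + real n) powr \<beta>) \<le> (C * (1 + real n) powr \<gamma>) / (A * (1 + real n) powr \<beta>)"
        using A by (intro divide_right_mono nat) auto
      then show "s (real n) / (A * (1 + real n) powr \<beta>) \<le> C / A * (1 + real n) powr (\<gamma> - \<beta>)"
        by (simp add: powr_diff)
    qed (use A s_nonneg in auto)
    also have "\<dots> = q * ((1 + real n) powr (\<gamma> - \<beta>)) ^ (2 * p)"
      by (simp only: q_def power_mult_distrib mult.assoc)
    also have "\<dots> \<le> q * (1 / (1 + real n)\<^sup>2)"
      by (intro mult_left_mono powr_decay q)
    finally show ?thesis .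
  qed
  have I: "prob (I m i) \<le> q * (1 / (1 + real n)\<^sup>2) * (1 / 4) ^ m" for m i
  proof -
    have d: "\<bar>(real n + (real i + 1) / 2 ^ m) - (real n + real i / 2 ^ m)\<bar> = 1 / 2 ^ m"
      by (simp add: add_divide_distrib)
    have "prob (I m i) \<le> ?D * (s (1 / 2 ^ m) / (A * (1 + real n) powr \<beta> * r ^ m)) ^ (2 * p)"
      unfolding I_def by (rule gaussian_tail[OF gaussian_increment mean_increment])
        (use A r in \<open>simp_all only: increment d order_refl, simp\<close>)
    also have "\<dots> \<le> ?D * (C / A * (1 + real n) powr (\<gamma> - \<beta>) * r ^ m) ^ (2 * p)"
    proof (intro mult_left_mono power_mono)
      have "s (1 / 2 ^ m) / (A * (1 + real n) powr \<beta> * r ^ m)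
          \<le> (C * (r ^ 2) ^ m) / (A * (1 + real n) powr \<beta> * r ^ m)"
        using A r by (intro divide_right_mono dyadic) auto
      also have "(r ^ 2) ^ m = r ^ m * r ^ m" by (simp add: power2_eq_square power_mult_distrib)
      also have "(C * (r ^ m * r ^ m)) / (A * (1 + real n) powr \<beta> * r ^ m) = C / A * (1 + real n) powr (- \<beta>) * r ^ m"
        using A r by (simp add: powr_minus_divide)
      also have "\<dots> \<le> C / A * (1 + real n) powr (\<gamma> - \<beta>) * r ^ m"
        using A C r \<gamma> by (intro mult_right_mono mult_left_mono powr_mono n1) auto
      finally show "s (1 / 2 ^ m) / (A * (1 + real n) powr \<beta> * r ^ m) \<le> C / A * (1 + real n) powr (\<gamma> - \<beta>) * r ^ m" .
    qed (use A r s_nonneg in auto)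
    also have "\<dots> = q * ((1 + real n) powr (\<gamma> - \<beta>)) ^ (2 * p) * (r ^ (2 * p)) ^ m"
      by (simp only: q_def power_mult_distrib mult.assoc power_mult[symmetric] mult.commute[of m])
    also have "\<dots> \<le> q * (1 / (1 + real n)\<^sup>2) * (1 / 4) ^ m"
      using q r by (intro mult_mono mult_left_mono powr_decay power_mono p(1)) auto
    finally show ?thesis .
  qed
  have U: "prob (\<Union>m. \<Union>i\<in>{..<2 ^ m}. I m i) \<le> (\<Sum>m. q * (1 / (1 + real n)\<^sup>2) * (1 / 2) ^ m)"
  proof (rule prob_UN_le_suminf)
    fix m
    have "prob (\<Union>i\<in>{..<2 ^ m}. I m i) \<le> (\<Sum>i\<in>{..<(2::nat) ^ m}. prob (I m i))"
      by (rule finite_measure_subadditive_finite) auto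
    also have "\<dots> \<le> (\<Sum>i\<in>{..<(2::nat) ^ m}. q * (1 / (1 + real n)\<^sup>2) * (1 / 4) ^ m)"
      by (intro sum_mono I)
    also have "\<dots> = q * (1 / (1 + real n)\<^sup>2) * (2 ^ m * (1 / 4) ^ m)" by simp
    also have "(2::real) ^ m * (1 / 4) ^ m = (1 / 2) ^ m"
      by (simp add: power_mult_distrib[symmetric])
    finally show "prob (\<Union>i\<in>{..<2 ^ m}. I m i) \<le> q * (1 / (1 + real n)\<^sup>2) * (1 / 2) ^ m" .
  qed (auto intro!: summable_mult)
  also have "\<dots> = q * (1 / (1 + real n)\<^sup>2) * 2"
    by (subst suminf_mult) (auto simp: suminf_geometric)
  finally have "prob (V \<union> (\<Union>m. \<Union>i\<in>{..<2 ^ m}. I m i)) \<le> q * (1 / (1 + real n)\<^sup>2) + q * (1 / (1 + real n)\<^sup>2) * 2"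
    using measure_Un_le[OF Vm, of "\<Union>m. \<Union>i\<in>{..<2 ^ m}. I m i"] V by simp
  then show ?thesis by simp
qed

lemma prob_controlled:
  assumes A: "0 < A" and C: "0 \<le> C" and r: "0 < r"
    and p: "r ^ (2 * p) \<le> 1 / 4" "2 \<le> 2 * real p * (\<beta> - \<gamma>)" and \<gamma>: "0 \<le> \<gamma>"
    and nat: "\<And>n::nat. s (real n) \<le> C * (1 + real n) powr \<gamma>"
    and dyadic: "\<And>m. s (1 / 2 ^ m) \<le> C * (r ^ 2) ^ m"
  shows "1 - 3 * (fact (2 * p) / (2 ^ p * fact p)) * (\<Sum>n. 1 / (1 + real n)\<^sup>2) * (C / A) ^ (2 * p)
      \<le> prob {\<omega> \<in> space M. controlled A \<beta> r (\<lambda>t. Y t \<omega>)}"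
proof -
  define q where "q = fact (2 * p) / (2 ^ p * fact p) * (C / A) ^ (2 * p)"
  define V where "V n = {\<omega> \<in> space M. A * (1 + real n) powr \<beta> < \<bar>Y (real n) \<omega>\<bar>}" for n :: nat
  define I where "I n m i = {\<omega> \<in> space M. A * (1 + real n) powr \<beta> * r ^ m
      < \<bar>Y (real n + (real i + 1) / 2 ^ m) \<omega> - Y (real n + real i / 2 ^ m) \<omega>\<bar>}" for n m i :: nat
  define bad where "bad n = V n \<union> (\<Union>m. \<Union>i\<in>{..<2 ^ m}. I n m i)" for n
  have sq: "summable (\<lambda>n. 1 / (1 + real n)\<^sup>2)"
    using inverse_squares_sums by (auto simp: sums_iff add.commute)
  have bad_le: "prob (bad n) \<le> 3 * q * (1 / (1 + real n)\<^sup>2)" for n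
    unfolding bad_def V_def I_def q_def
    by (rule prob_not_controlled_cell[OF A C r p \<gamma> nat dyadic])
  have [measurable]: "V n \<in> events" "I n m i \<in> events" for n m i unfolding V_def I_def by measurable
  have bad_ev: "bad n \<in> events" for n unfolding bad_def by measurable
  have "prob (\<Union>n. bad n) \<le> (\<Sum>n. 3 * q * (1 / (1 + real n)\<^sup>2))"
    by (rule prob_UN_le_suminf[OF bad_ev bad_le summable_mult[OF sq]])
  also have "\<dots> = 3 * q * (\<Sum>n. 1 / (1 + real n)\<^sup>2)" by (rule suminf_mult[OF sq])
  finally have le: "prob (\<Union>n. bad n) \<le> 3 * q * (\<Sum>n. 1 / (1 + real n)\<^sup>2)" .
  have "space M - (\<Union>n. bad n) \<subseteq> {\<omega> \<in> space M. controlled A \<beta> r (\<lambda>t. Y t \<omega>)}"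
    by (auto simp: controlled_def bad_def V_def I_def not_less)
  then have "prob (space M - (\<Union>n. bad n)) \<le> prob {\<omega> \<in> space M. controlled A \<beta> r (\<lambda>t. Y t \<omega>)}"
    by (intro finite_measure_mono controlled_event)
  moreover have "prob (space M - (\<Union>n. bad n)) = 1 - prob (\<Union>n. bad n)"
    using bad_ev by (intro prob_compl) auto
  moreover have "3 * q * (\<Sum>n. 1 / (1 + real n)\<^sup>2) =
      3 * (fact (2 * p) / (2 ^ p * fact p)) * (\<Sum>n. 1 / (1 + real n)\<^sup>2) * (C / A) ^ (2 * p)"
    by (simp add: q_def mult_ac)
  ultimately show ?thesis using le by linarith
qed

text \<open>
  The bound depends on the process only through the constant \<open>C\<close> in the estimates for
  its standard deviation.  This gives tightness of a whole family of processes at once.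
\<close>
lemma prob_controlled_paths:
  assumes A: "0 < A" and C: "0 \<le> C" and r: "0 < r" "r < 1"
    and p: "r ^ (2 * p) \<le> 1 / 4" "2 \<le> 2 * real p * (\<beta> - \<gamma>)" and \<gamma>: "0 \<le> \<gamma>" and \<beta>: "0 \<le> \<beta>"
    and nat: "\<And>n::nat. s (real n) \<le> C * (1 + real n) powr \<gamma>"
    and dyadic: "\<And>m. s (1 / 2 ^ m) \<le> C * (r ^ 2) ^ m"
  shows "\<exists>E\<in>events. 1 - 6 * (fact (2 * p) / (2 ^ p * fact p)) * (\<Sum>n. 1 / (1 + real n)\<^sup>2) * (C / A) ^ (2 * p) \<le> prob E \<and>
      (\<forall>\<omega>\<in>E. (\<lambda>t. Y t \<omega>) \<in> controlled_paths A \<beta> r)"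
proof -
  interpret R: gaussian_increments M "\<lambda>t. Y (- t)" s by (rule time_reversal)
  define E1 where "E1 = {\<omega> \<in> space M. controlled A \<beta> r (\<lambda>t. Y t \<omega>)}"
  define E2 where "E2 = {\<omega> \<in> space M. controlled A \<beta> r (\<lambda>t. Y (- t) \<omega>)}"
  let ?b = "3 * (fact (2 * p) / (2 ^ p * fact p)) * (\<Sum>n. 1 / (1 + real n)\<^sup>2) * (C / A) ^ (2 * p)"
  have ev: "E1 \<in> events" "E2 \<in> events"
    unfolding E1_def E2_def by (rule controlled_event R.controlled_event)+
  have "1 - ?b \<le> prob E1" "1 - ?b \<le> prob E2"
    unfolding E1_def E2_def
    by (rule prob_controlled[OF A C r(1) p \<gamma> nat dyadic] R.prob_controlled[OF A C r(1) p \<gamma> nat dyadic])+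
  moreover have "prob E1 + prob E2 \<le> prob (E1 \<inter> E2) + 1"
  proof -
    have "prob (E1 \<union> E2) = prob E1 + prob E2 - prob (E1 \<inter> E2)"
      using ev by (intro measure_Un3) (auto simp: fmeasurable_eq_sets)
    then show ?thesis using prob_le_1[of "E1 \<union> E2"] by linarith
  qed
  moreover have "6 * (fact (2 * p) / (2 ^ p * fact p)) * (\<Sum>n. 1 / (1 + real n)\<^sup>2) * (C / A) ^ (2 * p) = 2 * ?b"
    by simp
  ultimately have "1 - 6 * (fact (2 * p) / (2 ^ p * fact p)) * (\<Sum>n. 1 / (1 + real n)\<^sup>2) * (C / A) ^ (2 * p) \<le> prob (E1 \<inter> E2)"
    by linarith
  moreover have "(\<lambda>t. Y t \<omega>) \<in> controlled_paths A \<beta> r" if "\<omega> \<in> E1 \<inter> E2" for \<omega>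
    using that A r \<beta> cont unfolding E1_def E2_def by (intro controlled_imp_controlled_paths) auto
  ultimately show ?thesis using ev by (intro bexI[of _ "E1 \<inter> E2"]) auto
qed

end

section \<open>The buffer content as a functional of the path\<close>

text \<open>
  The path functional is separated from the process so that continuity in the path and
  measurability can be treated for deterministic paths.
\<close>
definition buffer_level :: "real \<Rightarrow> (real \<Rightarrow> real) \<Rightarrow> real \<Rightarrow> real" where
  "buffer_level c x t = (SUP s\<in>{..t}. x t - x s - c * (t - s))"

lemma buffer_content_eq_level: "buffer_content Y c t \<omega> = buffer_level c (\<lambda>t. Y t \<omega>) t"
  by (simp add: buffer_content_def buffer_level_def)

definition buffer_bounded :: "real \<Rightarrow> (real \<Rightarrow> real) \<Rightarrow> real \<Rightarrow> bool" where
  "buffer_bounded c x t \<longleftrightarrow> bdd_above ((\<lambda>s. x t - x s - c * (t - s)) ` {..t})"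

text \<open>
  The supremum of reals is defined as the least upper bound, so for every unbounded set it is
  the same unspecified number.
\<close>
lemma Sup_real_unbounded:
  assumes "\<not> bdd_above (S :: real set)"
  shows "Sup S = (LEAST z. False)"
proof -
  have "(\<forall>x\<in>S. x \<le> z) = False" for z
    using assms unfolding bdd_above_def by blast
  then have eq: "(\<lambda>z. \<forall>x\<in>S. x \<le> z) = (\<lambda>z. False)" by (intro ext)
  show ?thesis unfolding Sup_real_def eq ..
qed

lemma buffer_level_unbounded: "\<not> buffer_bounded c x t \<Longrightarrow> buffer_level c x t = (LEAST z. False)"
  unfolding buffer_level_def buffer_bounded_def by (rule Sup_real_unbounded)

lemma buffer_level_le_iff:
  assumes "buffer_bounded c x t"
  shows "buffer_level c x t \<le> b \<longleftrightarrow> (\<forall>s\<le>t. x t - x s - c * (t - s) \<le> b)"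
  using assms unfolding buffer_level_def buffer_bounded_def by (subst cSUP_le_iff) auto

lemma buffer_level_upper:
  assumes "buffer_bounded c x t" "s \<le> t"
  shows "x t - x s - c * (t - s) \<le> buffer_level c x t"
  using buffer_level_le_iff[OF assms(1), of "buffer_level c x t"] assms(2) by blast

lemma buffer_bounded_transfer:
  assumes cont: "continuous_on UNIV x" and t: "buffer_bounded c x t"
  shows "buffer_bounded c x u"
proof -
  obtain b where b: "\<And>s. s \<le> t \<Longrightarrow> x t - x s - c * (t - s) \<le> b"
    using t unfolding buffer_bounded_def bdd_above_def by auto
  have "continuous_on {t..u} (\<lambda>s. c * s - x s)"
    by (intro continuous_intros continuous_on_subset[OF cont]) auto
  then have "bdd_above ((\<lambda>s. c * s - x s) ` {t..u})"
    by (intro bounded_imp_bdd_above compact_imp_bounded compact_continuous_image) auto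
  then obtain b' where b': "\<And>s. s \<in> {t..u} \<Longrightarrow> c * s - x s \<le> b'"
    unfolding bdd_above_def by blast
  have "x u - x s - c * (u - s) \<le> max (b - (x t - c * t)) b' + (x u - c * u)" if "s \<le> u" for s
    using b[of s] b'[of s] that by (cases "s \<le> t") (auto simp: algebra_simps)
  then show ?thesis
    unfolding buffer_bounded_def
    by (intro bdd_aboveI2[where M = "max (b - (x t - c * t)) b' + (x u - c * u)"]) (simp only: atMost_iff)
qed

text \<open>
  Up to the continuous term \<open>z\<close> the buffer content is the running supremum \<open>S\<close> of
  \<open>z s = c s - x s\<close>, which increases by at most the oscillation of \<open>z\<close>.  If the
  supremum is infinite at one time it is infinite at all times and the path is constant.
\<close>
lemma continuous_buffer_level:
  assumes cont: "continuous_on UNIV x"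
  shows "continuous_on UNIV (buffer_level c x)"
proof (cases "buffer_bounded c x 0")
  case False
  then have "\<not> buffer_bounded c x t" for t using buffer_bounded_transfer[OF cont] by blast
  then have "buffer_level c x = (\<lambda>t. LEAST z. False)" by (intro ext buffer_level_unbounded)
  then show ?thesis by simp
next
  case True
  then have bdd: "buffer_bounded c x t" for t by (rule buffer_bounded_transfer[OF cont])
  define z where "z s = c * s - x s" for s
  define S where "S t = buffer_level c x t + z t" for t
  have z_le: "z s \<le> S t" if "s \<le> t" for s t
    using buffer_level_upper[OF bdd that] by (simp add: S_def z_def algebra_simps)
  have S_le: "S t \<le> b" if "\<And>s. s \<le> t \<Longrightarrow> z s \<le> b" for t b
  proof -
    have "buffer_level c x t \<le> b - z t"
      unfolding buffer_level_le_iff[OF bdd] using that by (auto simp: z_def algebra_simps)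
    then show ?thesis by (simp add: S_def)
  qed
  have z_cont: "continuous_on UNIV z" unfolding z_def by (intro continuous_intros cont)
  have "isCont S t" for t
  proof (rule continuous_at_eps_delta[THEN iffD2], intro allI impI)
    fix e :: real assume e: "0 < e"
    have "isCont z t" using z_cont by (simp add: continuous_on_eq_continuous_at)
    then obtain d where d: "0 < d" "\<And>s. \<bar>s - t\<bar> < d \<Longrightarrow> \<bar>z s - z t\<bar> < e / 4"
      using e unfolding continuous_at_eps_delta dist_real_def by (metis zero_less_divide_iff zero_less_numeral)
    have main: "\<bar>S q - S p\<bar> < e" if pq: "p \<le> q" "\<bar>p - t\<bar> < d" "\<bar>q - t\<bar> < d" for p q
    proof -
      have "S p \<le> S q" using z_le pq(1) by (intro S_le) (meson order_trans)
      moreover have "S q \<le> S p + e / 2"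
      proof (rule S_le)
        fix s assume s: "s \<le> q"
        show "z s \<le> S p + e / 2"
        proof (cases "s \<le> p")
          case True
          then show ?thesis using z_le[of s p] e by linarith
        next
          case False
          then have "\<bar>s - t\<bar> < d" using s pq by linarith
          then show ?thesis using d(2)[of s] d(2)[of p] pq(2) z_le[of p p] by linarith
        qed
      qed
      ultimately show ?thesis using e by linarith
    qed
    show "\<exists>d>0. \<forall>u. dist u t < d \<longrightarrow> dist (S u) (S t) < e"
    proof (intro exI[of _ d] conjI allI impI)
      fix u assume u: "dist u t < d"
      then show "dist (S u) (S t) < e"
        using main[of u t] main[of t u] d(1) unfolding dist_real_def by (cases "u \<le> t") (auto simp: abs_minus_commute)
    qed (rule d(1))
  qed
  then have "continuous_on UNIV S" by (simp add: continuous_on_eq_continuous_at)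
  then have "continuous_on UNIV (\<lambda>t. S t - z t)" by (intro continuous_intros z_cont)
  then show ?thesis by (simp add: S_def)
qed

definition buffer_path :: "(real \<Rightarrow> real) \<Rightarrow> real \<Rightarrow> real" where
  "buffer_path x = (\<lambda>t\<in>{0..}. buffer_level 1 x t)"

lemma restrict_in_cont_paths:
  assumes "continuous_on UNIV f"
  shows "(\<lambda>t\<in>{0..}. f t) \<in> cont_paths"
proof -
  have "continuous_on {0..} f" by (rule continuous_on_subset[OF assms subset_UNIV])
  then have "continuous_on {0..} (\<lambda>t\<in>{0..}. f t)" by (rule continuous_on_eq) simp
  then show ?thesis by (simp add: cont_paths_def del: restrict_apply)
qed

context
  fixes A \<beta> r :: real
  assumes A: "0 \<le> A" and r: "0 < r" "r < 1" and \<beta>: "0 \<le> \<beta>" "\<beta> < 1"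
begin

lemma controlled_paths_continuous:
  assumes x: "x \<in> controlled_paths A \<beta> r"
  shows "continuous_on UNIV x"
proof -
  have "isCont x t" for t
  proof (rule continuous_at_eps_delta[THEN iffD2], intro allI impI)
    fix e :: real assume e: "0 < e"
    obtain d where d: "d > 0" "\<forall>x\<in>controlled_paths A \<beta> r. \<forall>u v. \<bar>u\<bar> \<le> \<bar>t\<bar> + 1 \<and> \<bar>v\<bar> \<le> \<bar>t\<bar> + 1 \<and> \<bar>u - v\<bar> \<le> d \<longrightarrow> \<bar>x u - x v\<bar> < e"
      using controlled_paths_equicontinuous[OF A r \<beta>(1) e, of "\<bar>t\<bar> + 1"] by blast
    have "\<bar>x u - x t\<bar> < e" if "\<bar>u - t\<bar> < min d 1" for u
    proof -
      have "\<bar>u\<bar> \<le> \<bar>t\<bar> + 1" "\<bar>t\<bar> \<le> \<bar>t\<bar> + 1" "\<bar>u - t\<bar> \<le> d" using that by linarith+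
      then show ?thesis using d(2) x by blast
    qed
    then show "\<exists>d>0. \<forall>u. dist u t < d \<longrightarrow> dist (x u) (x t) < e"
      using d(1) by (intro exI[of _ "min d 1"]) (simp add: dist_real_def)
  qed
  then show ?thesis by (simp add: continuous_on_eq_continuous_at)
qed

text \<open>
  Sublinear growth, uniformly over the compact set, loses against the drift: up to time
  \<open>T\<close> the supremum may be restricted to \<open>s \<ge> - S\<close>, since \<open>s = t\<close>
  already contributes \<open>0\<close>.
\<close>
lemma distant_past_irrelevant:
  "\<exists>S\<ge>0. \<forall>x\<in>controlled_paths A \<beta> r. \<forall>t\<in>{0..T}. \<forall>s\<le>-S. x t - x s - 1 * (t - s) \<le> 0"
proof -
  define D where "D = A * (1 + 2 / (1 - r))"
  have D: "0 \<le> D" using A r by (simp add: D_def)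
  have growth: "\<bar>x t\<bar> \<le> D * (2 + \<bar>t\<bar>) powr \<beta>" if "x \<in> controlled_paths A \<beta> r" for x t
    using controlled_paths_growth[OF that A r \<beta>(1)] by (simp add: D_def)
  have "((\<lambda>u. u powr (\<beta> - 1)) \<longlongrightarrow> 0) at_top"
    using \<beta> by (intro tendsto_neg_powr filterlim_ident) auto
  then have "((\<lambda>u. D * u powr (\<beta> - 1)) \<longlongrightarrow> D * 0) at_top" by (intro tendsto_mult tendsto_const)
  then have "\<forall>\<^sub>F u in at_top. D * u powr (\<beta> - 1) < 1 / 2" by (intro order_tendstoD(2)) auto
  then obtain u0 where u0: "\<And>u. u0 \<le> u \<Longrightarrow> D * u powr (\<beta> - 1) < 1 / 2"
    by (auto simp: eventually_at_top_linorder)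
  define E where "E = D * (2 + \<bar>T\<bar>) powr \<beta>"
  have E: "0 \<le> E" using D by (simp add: E_def)
  define S where "S = max \<bar>u0\<bar> (2 * (E + 1))"
  have "x t - x s - 1 * (t - s) \<le> 0" if x: "x \<in> controlled_paths A \<beta> r" and t: "t \<in> {0..T}" and s: "s \<le> - S" for x t s
  proof -
    have s': "s \<le> - \<bar>u0\<bar>" "s \<le> - 2 * (E + 1)" using s by (auto simp: S_def)
    have "\<bar>x t\<bar> \<le> D * (2 + \<bar>t\<bar>) powr \<beta>" by (rule growth[OF x])
    also have "\<dots> \<le> E" unfolding E_def using t D \<beta> by (intro mult_left_mono powr_mono2) auto
    finally have xt: "\<bar>x t\<bar> \<le> E" .
    have pos: "0 < 2 + \<bar>s\<bar>" by simp
    have "\<bar>x s\<bar> \<le> D * (2 + \<bar>s\<bar>) powr \<beta>" by (rule growth[OF x])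
    also have "(2 + \<bar>s\<bar>) powr \<beta> = (2 + \<bar>s\<bar>) powr (\<beta> - 1) * (2 + \<bar>s\<bar>)"
      using powr_add[of "2 + \<bar>s\<bar>" "\<beta> - 1" 1] pos by simp
    also have "D * ((2 + \<bar>s\<bar>) powr (\<beta> - 1) * (2 + \<bar>s\<bar>)) = D * (2 + \<bar>s\<bar>) powr (\<beta> - 1) * (2 + \<bar>s\<bar>)" by simp
    also have "\<dots> \<le> 1 / 2 * (2 + \<bar>s\<bar>)"
    proof (rule mult_right_mono)
      have "u0 \<le> 2 + \<bar>s\<bar>" using s'(1) by linarith
      then show "D * (2 + \<bar>s\<bar>) powr (\<beta> - 1) \<le> 1 / 2" by (rule less_imp_le[OF u0])
    qed simp
    finally have "\<bar>x s\<bar> \<le> 1 + \<bar>s\<bar> / 2" by simp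
    moreover have "\<bar>s\<bar> = - s" using s'(1) by auto
    ultimately have "- x s \<le> 1 - s / 2" by simp
    moreover have "0 \<le> t" "x t \<le> E" using t xt by auto
    moreover have "s / 2 \<le> - E - 1" using s'(2) by simp
    ultimately show ?thesis by simp
  qed
  moreover have "0 \<le> S" using E by (simp add: S_def)
  ultimately show ?thesis by blast
qed

lemma controlled_paths_buffer_bounded:
  assumes x: "x \<in> controlled_paths A \<beta> r"
  shows "buffer_bounded 1 x t"
proof -
  have cont: "continuous_on UNIV x" by (rule controlled_paths_continuous[OF x])
  obtain S where S: "0 \<le> S" "\<And>s. s \<le> - S \<Longrightarrow> x 0 - x s - 1 * (0 - s) \<le> 0"
    using distant_past_irrelevant[of 0] x by auto
  have "continuous_on {-S..0} (\<lambda>s. x 0 - x s - 1 * (0 - s))"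
    by (intro continuous_intros continuous_on_subset[OF cont]) auto
  then have "bdd_above ((\<lambda>s. x 0 - x s - 1 * (0 - s)) ` {-S..0})"
    by (intro bounded_imp_bdd_above compact_imp_bounded compact_continuous_image) auto
  then obtain b where b: "\<And>s. s \<in> {-S..0} \<Longrightarrow> x 0 - x s - 1 * (0 - s) \<le> b"
    unfolding bdd_above_def by blast
  have "x 0 - x s - 1 * (0 - s) \<le> max 0 b" if "s \<le> 0" for s
    using S(2)[of s] b[of s] that by (cases "s \<le> - S") (auto simp: le_max_iff_disj)
  then have "buffer_bounded 1 x 0" unfolding buffer_bounded_def by (intro bdd_aboveI2) auto
  then show ?thesis by (rule buffer_bounded_transfer[OF cont])
qed

text \<open>
  By \<open>distant_past_irrelevant\<close> the buffer path on \<open>[0, T]\<close> depends only on the restriction of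
  \<open>x\<close> to \<open>[-S, T]\<close>, and does so in a Lipschitz way for the uniform norm.  By
  equicontinuity, closeness on a finite mesh \<open>F\<close> forces uniform closeness there, and
  closeness on a finite set is an open condition for pointwise convergence.
\<close>
lemma continuous_on_buffer_functional:
  assumes \<phi>: "continuous_map cont_path_topology euclideanreal \<phi>"
  shows "continuous_on (controlled_paths A \<beta> r) (\<lambda>x. \<phi> (buffer_path x))"
  unfolding continuous_on_topological
proof (intro ballI allI impI)
  let ?K = "controlled_paths A \<beta> r"
  fix x B assume x: "x \<in> ?K" and B: "open B" "\<phi> (buffer_path x) \<in> B"
  have in_paths: "buffer_path y \<in> cont_paths" if "y \<in> ?K" for y
    unfolding buffer_path_def
    by (intro restrict_in_cont_paths continuous_buffer_level controlled_paths_continuous that)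
  let ?U = "{f \<in> cont_paths. \<phi> f \<in> B}"
  have "openin cont_path_topology ?U"
    using openin_continuous_map_preimage[OF \<phi>, of B] B(1) by simp
  then have nbhd: "\<forall>f\<in>?U. \<exists>T>0. \<exists>e>0. \<forall>g\<in>cont_paths. (\<forall>t\<in>{0..T}. \<bar>g t - f t\<bar> < e) \<longrightarrow> g \<in> ?U"
    unfolding openin_cont_path_topology by (rule conjunct2)
  have "buffer_path x \<in> ?U" using B(2) in_paths[OF x] by simp
  from bspec[OF nbhd this] obtain T e where T: "0 < T" and e: "0 < e"
    and U: "\<forall>g\<in>cont_paths. (\<forall>t\<in>{0..T}. \<bar>g t - buffer_path x t\<bar> < e) \<longrightarrow> g \<in> ?U"
    by (elim exE conjE) (rule that)
  obtain S where S: "0 \<le> S" "\<And>x t s. x \<in> ?K \<Longrightarrow> t \<in> {0..T} \<Longrightarrow> s \<le> - S \<Longrightarrow> x t - x s - 1 * (t - s) \<le> 0"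
    using distant_past_irrelevant[of T] by blast
  have compare: "buffer_level 1 y t \<le> buffer_level 1 y' t + 2 * h"
    if y: "y \<in> ?K" "y' \<in> ?K" and t: "t \<in> {0..T}" and h: "0 \<le> h" "\<And>s. s \<in> {-S..T} \<Longrightarrow> \<bar>y s - y' s\<bar> \<le> h" for y y' t h
  proof -
    have "y t - y s - 1 * (t - s) \<le> buffer_level 1 y' t + 2 * h" if s: "s \<le> t" for s
    proof (cases "s \<le> - S")
      case True
      have "0 \<le> buffer_level 1 y' t"
        using buffer_level_upper[OF controlled_paths_buffer_bounded[OF y(2)], of t t] by simp
      then show ?thesis using S(2)[OF y(1) t True] h(1) by linarith
    next
      case False
      then have "\<bar>y s - y' s\<bar> \<le> h" "\<bar>y t - y' t\<bar> \<le> h"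
        using h(2)[of s] h(2)[of t] s t S(1) by auto
      then show ?thesis
        using buffer_level_upper[OF controlled_paths_buffer_bounded[OF y(2)] s] by linarith
    qed
    then show ?thesis by (simp add: buffer_level_le_iff[OF controlled_paths_buffer_bounded[OF y(1)]])
  qed
  obtain d where d: "d > 0" "\<forall>x\<in>?K. \<forall>u v. \<bar>u\<bar> \<le> S + T \<and> \<bar>v\<bar> \<le> S + T \<and> \<bar>u - v\<bar> \<le> d \<longrightarrow> \<bar>x u - x v\<bar> < e / 8"
    using controlled_paths_equicontinuous[OF A r \<beta>(1), of "e / 8" "S + T"] e by auto
  have "seq_compact {-S..T}" by (simp add: compact_imp_seq_compact)
  from seq_compact_imp_totally_bounded[OF this, rule_format, OF d(1)]
  obtain F where F: "finite F" "F \<subseteq> {-S..T}" "{-S..T} \<subseteq> (\<Union>f\<in>F. ball f d)" by blast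
  let ?W = "\<Inter>f\<in>F. {y. \<bar>y f - x f\<bar> < e / 8}"
  have coord: "continuous_on UNIV (\<lambda>x::real \<Rightarrow> real. x i)" for i by simp
  have "open {y::real \<Rightarrow> real. \<bar>y f - x f\<bar> < e / 8}" for f
    by (intro open_Collect_less continuous_intros coord)
  then have "open ?W" using F(1) by (intro open_INT) auto
  moreover have "x \<in> ?W" using e by simp
  moreover have "\<phi> (buffer_path y) \<in> B" if y: "y \<in> ?K" "y \<in> ?W" for y
  proof -
    have "\<bar>y s - x s\<bar> \<le> 3 * (e / 8)" if s: "s \<in> {-S..T}" for s
    proof -
      obtain f where f: "f \<in> F" "dist f s < d" using F(3) s by auto
      have "f \<in> {-S..T}" using f(1) F(2) by (rule subsetD[rotated])
      then have "\<bar>f\<bar> \<le> S + T" "\<bar>s\<bar> \<le> S + T" using s S(1) T by auto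
      moreover have "\<bar>f - s\<bar> \<le> d" using f(2) by (simp add: dist_real_def)
      ultimately have "\<bar>y f - y s\<bar> < e / 8" "\<bar>x f - x s\<bar> < e / 8" using d(2) x y(1) by blast+
      moreover have "\<bar>y f - x f\<bar> < e / 8" using y(2) f(1) by blast
      ultimately show ?thesis by linarith
    qed
    then have near: "\<bar>y s - x s\<bar> \<le> 3 * (e / 8)" "\<bar>x s - y s\<bar> \<le> 3 * (e / 8)" if "s \<in> {-S..T}" for s
      using that by (simp_all add: abs_minus_commute)
    have "buffer_path y \<in> ?U"
    proof (rule bspec[OF U in_paths[OF y(1)], THEN mp], rule ballI)
      fix t assume t: "t \<in> {0..T}"
      have "buffer_level 1 y t \<le> buffer_level 1 x t + 2 * (3 * (e / 8))"
           "buffer_level 1 x t \<le> buffer_level 1 y t + 2 * (3 * (e / 8))"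
        using e by (intro compare x y(1) t near; simp)+
      then show "\<bar>buffer_path y t - buffer_path x t\<bar> < e"
        using e t by (simp add: buffer_path_def)
    qed
    then show ?thesis by simp
  qed
  ultimately show "\<exists>V. open V \<and> x \<in> V \<and> (\<forall>y\<in>?K. y \<in> V \<longrightarrow> \<phi> (buffer_path y) \<in> B)" by blast
qed

end

section \<open>Measurability of buffer paths\<close>

text \<open>
  The space of paths is separable, so its Borel sets are generated by the coordinates.  Every
  open set is a countable union of tubes around step functions with rational values, which serve
  as centres although they are not themselves paths.  A tube constrains a path at rational times
  only, hence pulls back to an event.
\<close>
lemma measurable_cont_paths:
  assumes paths: "\<And>\<omega>. \<omega> \<in> space M \<Longrightarrow> f \<omega> \<in> cont_paths"
    and coord: "\<And>t. 0 \<le> t \<Longrightarrow> (\<lambda>\<omega>. f \<omega> t) \<in> borel_measurable M"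
  shows "f \<in> M \<rightarrow>\<^sub>M borel_of_topology cont_path_topology"
  unfolding borel_of_topology_def
proof (rule measurable_measure_of)
  show "{U. openin cont_path_topology U} \<subseteq> Pow (topspace cont_path_topology)"
    using openin_subset by blast
  show "f \<in> space M \<rightarrow> topspace cont_path_topology" using paths by simp
  fix U assume "U \<in> {U. openin cont_path_topology U}"
  then have U: "U \<subseteq> cont_paths"
    "\<And>g. g \<in> U \<Longrightarrow> \<exists>T>0. \<exists>e>0. \<forall>h\<in>cont_paths. (\<forall>t\<in>{0..T}. \<bar>h t - g t\<bar> < e) \<longrightarrow> h \<in> U"
    by (auto simp: openin_cont_path_topology)
  define tube :: "nat \<times> nat \<times> nat \<times> rat list \<Rightarrow> (real \<Rightarrow> real) set" where
    "tube = (\<lambda>(n, k, m, q). {g \<in> cont_paths. \<forall>t\<in>\<rat> \<inter> {0..real n}.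
        \<bar>g t - real_of_rat (q ! nat \<lfloor>t * real k\<rfloor>)\<bar> \<le> 1 / real m})"
  have tube_event: "f -` tube p \<inter> space M \<in> sets M" for p
  proof -
    obtain n k m q where p: "p = (n, k, m, q)" by (cases p)
    have "f -` tube p \<inter> space M = {\<omega> \<in> space M. \<forall>t\<in>\<rat> \<inter> {0..real n}.
        \<bar>f \<omega> t - real_of_rat (q ! nat \<lfloor>t * real k\<rfloor>)\<bar> \<le> 1 / real m}"
      using paths by (auto simp: p tube_def)
    moreover have "{\<omega> \<in> space M. \<forall>t\<in>\<rat> \<inter> {0..real n}.
        \<bar>f \<omega> t - real_of_rat (q ! nat \<lfloor>t * real k\<rfloor>)\<bar> \<le> 1 / real m} \<in> sets M"
    proof (rule sets.sets_Collect_countable_All')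
      fix t assume "t \<in> \<rat> \<inter> {0..real n}"
      then have [measurable]: "(\<lambda>\<omega>. f \<omega> t) \<in> borel_measurable M" using coord by simp
      show "{\<omega> \<in> space M. \<bar>f \<omega> t - real_of_rat (q ! nat \<lfloor>t * real k\<rfloor>)\<bar> \<le> 1 / real m} \<in> sets M"
        by measurable
    qed (simp add: countable_rat)
    ultimately show ?thesis by simp
  qed
  have cover: "\<exists>p. g \<in> tube p \<and> tube p \<subseteq> U" if g: "g \<in> U" for g
  proof -
    obtain T e where T: "0 < T" and e: "0 < e"
      and nbhd: "\<And>h. h \<in> cont_paths \<Longrightarrow> (\<And>t. t \<in> {0..T} \<Longrightarrow> \<bar>h t - g t\<bar> < e) \<Longrightarrow> h \<in> U"
      using U(2)[OF g] by blast
    \<comment> \<open>The tube reaches beyond \<open>T\<close>, so that every time in \<open>[0, T]\<close> is a limit of rational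
      times in the tube from the right.\<close>
    obtain n where n: "T + 1 \<le> real n" using real_arch_simple by blast
    obtain m0 where m0: "4 / e < real m0" using reals_Archimedean2 by blast
    define m where "m = Suc m0"
    have m: "2 / real m < e / 2" "0 < real m"
      using m0 e by (auto simp: m_def field_simps)
    have g_cont: "continuous_on {0..} g" using g U(1) by (auto simp: cont_paths_def)
    have "uniformly_continuous_on {0..real n} g"
      by (intro compact_uniformly_continuous continuous_on_subset[OF g_cont]) auto
    then obtain d where d: "0 < d" "\<And>s t. s \<in> {0..real n} \<Longrightarrow> t \<in> {0..real n} \<Longrightarrow> \<bar>s - t\<bar> < d \<Longrightarrow> \<bar>g s - g t\<bar> < 1 / (2 * real m)"
      using m(2) unfolding uniformly_continuous_on_def dist_real_def by (metis zero_less_divide_1_iff zero_less_mult_iff zero_less_numeral)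
    obtain k0 where k0: "1 / d < real k0" using reals_Archimedean2 by blast
    define k where "k = Suc k0"
    have k: "1 / real k < d" "0 < real k" using k0 d(1) by (auto simp: k_def field_simps)
    have "\<exists>q::rat. \<bar>g (real i / real k) - real_of_rat q\<bar> < 1 / (2 * real m)" for i
    proof -
      obtain y where y: "y \<in> \<rat>" "g (real i / real k) < y" "y < g (real i / real k) + 1 / (2 * real m)"
        using Rats_dense_in_real[of "g (real i / real k)" "g (real i / real k) + 1 / (2 * real m)"] m(2) by auto
      then obtain q where "y = real_of_rat q" by (auto elim: Rats_cases)
      then show ?thesis using y by (intro exI[of _ q]) auto
    qed
    then obtain Q :: "nat \<Rightarrow> rat" where Q: "\<And>i. \<bar>g (real i / real k) - real_of_rat (Q i)\<bar> < 1 / (2 * real m)"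
      by metis
    define q where "q = map Q [0..<Suc (n * k)]"
    have step: "\<bar>g t - real_of_rat (q ! nat \<lfloor>t * real k\<rfloor>)\<bar> \<le> 1 / real m" if t: "t \<in> {0..real n}" for t
    proof -
      define i where "i = nat \<lfloor>t * real k\<rfloor>"
      have ti: "real i \<le> t * real k" "t * real k < real i + 1"
        using t unfolding i_def by (auto simp: of_nat_nat)
      have "t * real k \<le> real n * real k" using t by (intro mult_right_mono) auto
      then have "real i \<le> real (n * k)" using ti(1) by simp
      then have ik: "i \<le> n * k" by (simp only: of_nat_le_iff)
      have "real i / real k \<le> t" "t < real i / real k + 1 / real k"
        using ti k(2) by (auto simp: field_simps)
      moreover have "0 \<le> real i / real k" by simp
      ultimately have "\<bar>g t - g (real i / real k)\<bar> < 1 / (2 * real m)"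
        using t k(1) by (intro d(2)) auto
      moreover have "q ! i = Q i" unfolding q_def using ik by (simp del: upt_Suc)
      moreover have "\<bar>g t - real_of_rat (Q i)\<bar>
          \<le> \<bar>g t - g (real i / real k)\<bar> + \<bar>g (real i / real k) - real_of_rat (Q i)\<bar>" by simp
      moreover have "1 / (2 * real m) + 1 / (2 * real m) = 1 / real m" by simp
      ultimately have "\<bar>g t - real_of_rat (q ! i)\<bar> \<le> 1 / real m"
        using Q[of i] by simp
      then show ?thesis by (simp only: i_def)
    qed
    have "g \<in> tube (n, k, m, q)"
      using g U(1) step by (auto simp: tube_def)
    moreover have "tube (n, k, m, q) \<subseteq> U"
    proof
      fix h assume h: "h \<in> tube (n, k, m, q)"
      then have hp: "h \<in> cont_paths"
        and hq: "\<And>t. t \<in> \<rat> \<Longrightarrow> t \<in> {0..real n} \<Longrightarrow> \<bar>h t - real_of_rat (q ! nat \<lfloor>t * real k\<rfloor>)\<bar> \<le> 1 / real m"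
        by (auto simp: tube_def)
      have h_cont: "continuous_on {0..} h" using hp by (auto simp: cont_paths_def)
      show "h \<in> U"
      proof (rule nbhd[OF hp])
        fix t assume t: "t \<in> {0..T}"
        have "continuous_on {0..} (\<lambda>u. h u - g u)" by (intro continuous_intros h_cont g_cont)
        then obtain d' where d': "0 < d'" "\<And>u. 0 \<le> u \<Longrightarrow> \<bar>u - t\<bar> < d' \<Longrightarrow> \<bar>(h u - g u) - (h t - g t)\<bar> < e / 2"
          using t e unfolding continuous_on_iff dist_real_def by (metis atLeast_iff atLeastAtMost_iff half_gt_zero)
        obtain u where u: "u \<in> \<rat>" "t < u" "u < t + min d' 1"
          using Rats_dense_in_real[of t "t + min d' 1"] d'(1) by auto
        have un: "u \<in> {0..real n}" using u t n by auto
        have "\<bar>h u - g u\<bar> \<le> 2 / real m"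
          using hq[OF u(1) un] step[OF un] by (simp add: field_simps)
        moreover have "\<bar>(h u - g u) - (h t - g t)\<bar> < e / 2" using d'(2)[of u] u t by auto
        ultimately show "\<bar>h t - g t\<bar> < e" using m(1) by linarith
      qed
    qed
    ultimately show ?thesis by blast
  qed
  have "f -` U \<inter> space M = (\<Union>p\<in>{p. tube p \<subseteq> U}. f -` tube p \<inter> space M)"
    using cover by blast
  also have "\<dots> \<in> sets M"
    by (rule sets.countable_UN''[OF _ tube_event]) simp
  finally show "f -` U \<inter> space M \<in> sets M" .
qed

lemma le_on_rationals_iff:
  fixes z :: "real \<Rightarrow> real"
  assumes cont: "continuous_on UNIV z"
  shows "(\<forall>s\<le>t. z s \<le> b) \<longleftrightarrow> (\<forall>s\<in>\<rat> \<inter> {..t}. z s \<le> b)"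
proof
  assume rat: "\<forall>s\<in>\<rat> \<inter> {..t}. z s \<le> b"
  show "\<forall>s\<le>t. z s \<le> b"
  proof (intro allI impI, rule ccontr)
    fix s assume s: "s \<le> t" "\<not> z s \<le> b"
    have "isCont z s" using cont by (simp add: continuous_on_eq_continuous_at)
    then obtain d where d: "0 < d" "\<And>u. \<bar>u - s\<bar> < d \<Longrightarrow> \<bar>z u - z s\<bar> < z s - b"
      using s(2) unfolding continuous_at_eps_delta dist_real_def by (metis diff_gt_0_iff_gt not_le)
    obtain u where u: "u \<in> \<rat>" "s - d < u" "u < s"
      using Rats_dense_in_real[of "s - d" s] d(1) by auto
    then have "z u \<le> b" using rat s(1) by auto
    moreover have "\<bar>z u - z s\<bar> < z s - b" using u by (intro d(2)) auto
    ultimately show False by linarith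
  qed
qed auto

text \<open>
  The supremum over the rationals in \<open>(-\<infinity>, t]\<close> is the same, and on the event where it
  is infinite the buffer content is the constant of \<open>Sup_real_unbounded\<close>.
\<close>
lemma measurable_buffer_level:
  assumes meas [measurable]: "\<And>t. X t \<in> borel_measurable M"
    and cont: "\<And>\<omega>. \<omega> \<in> space M \<Longrightarrow> continuous_on UNIV (\<lambda>t. X t \<omega>)"
  shows "(\<lambda>\<omega>. buffer_level c (\<lambda>t. X t \<omega>) t) \<in> borel_measurable M"
proof (rule borel_measurableI_le)
  fix a
  let ?z = "\<lambda>\<omega> s. X t \<omega> - X s \<omega> - c * (t - s)"
  let ?le = "\<lambda>\<omega> b. \<forall>s\<in>\<rat> \<inter> {..t}. ?z \<omega> s \<le> b"
  have cnt: "countable (\<rat> \<inter> {..t})" by (simp add: countable_rat countable_Int1)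
  have le [measurable]: "{\<omega> \<in> space M. ?le \<omega> b} \<in> sets M" for b
    by (rule sets.sets_Collect_countable_All'[OF _ cnt]) measurable
  have rational: "(\<forall>s\<le>t. ?z \<omega> s \<le> b) \<longleftrightarrow> ?le \<omega> b" if "\<omega> \<in> space M" for \<omega> b
    by (intro le_on_rationals_iff continuous_intros cont that)
  have bdd: "buffer_bounded c (\<lambda>t. X t \<omega>) t \<longleftrightarrow> (\<exists>n::nat. ?le \<omega> (real n))" if w: "\<omega> \<in> space M" for \<omega>
  proof
    assume "buffer_bounded c (\<lambda>t. X t \<omega>) t"
    then obtain b where b: "\<And>s. s \<le> t \<Longrightarrow> ?z \<omega> s \<le> b"
      unfolding buffer_bounded_def bdd_above_def by auto
    obtain n where "b \<le> real n" using real_arch_simple by blast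
    then show "\<exists>n::nat. ?le \<omega> (real n)" using b by (intro exI[of _ n]) force
  next
    assume "\<exists>n::nat. ?le \<omega> (real n)"
    then obtain n :: nat where "\<forall>s\<le>t. ?z \<omega> s \<le> real n" using rational[OF w] by blast
    then show "buffer_bounded c (\<lambda>t. X t \<omega>) t"
      unfolding buffer_bounded_def by (intro bdd_aboveI2) auto
  qed
  have "(buffer_level c (\<lambda>t. X t \<omega>) t \<le> a) \<longleftrightarrow>
      (\<exists>n::nat. ?le \<omega> (real n)) \<and> ?le \<omega> a \<or> \<not> (\<exists>n::nat. ?le \<omega> (real n)) \<and> (LEAST z::real. False) \<le> a"
    if w: "\<omega> \<in> space M" for \<omega>
  proof (cases "buffer_bounded c (\<lambda>t. X t \<omega>) t")
    case True
    then show ?thesis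
      unfolding buffer_level_le_iff[OF True] rational[OF w] bdd[OF w] by blast
  next
    case False
    then show ?thesis
      unfolding buffer_level_unbounded[OF False] bdd[OF w] by blast
  qed
  then have "{\<omega> \<in> space M. buffer_level c (\<lambda>t. X t \<omega>) t \<le> a} = {\<omega> \<in> space M.
      (\<exists>n::nat. ?le \<omega> (real n)) \<and> ?le \<omega> a \<or> \<not> (\<exists>n::nat. ?le \<omega> (real n)) \<and> (LEAST z::real. False) \<le> a}"
    by (intro Collect_cong conj_cong refl)
  also have "\<dots> \<in> sets M"
    by (intro sets.sets_Collect_disj sets.sets_Collect_conj sets.sets_Collect_neg
        sets.sets_Collect_countable_Ex sets.sets_Collect_const le)
  finally show "{\<omega> \<in> space M. buffer_level c (\<lambda>t. X t \<omega>) t \<le> a} \<in> sets M" .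
qed

lemma measurable_buffer_content:
  assumes meas: "\<And>t. X t \<in> borel_measurable M"
    and cont: "\<And>\<omega>. \<omega> \<in> space M \<Longrightarrow> continuous_on UNIV (\<lambda>t. X t \<omega>)"
  shows "(\<lambda>\<omega>. \<lambda>t\<in>{0..}. buffer_content X c (a * t) \<omega> / b) \<in> M \<rightarrow>\<^sub>M borel_of_topology cont_path_topology"
proof (rule measurable_cont_paths)
  fix \<omega> assume w: "\<omega> \<in> space M"
  have "continuous_on UNIV (\<lambda>t. buffer_level c (\<lambda>t. X t \<omega>) (a * t) * inverse b)"
    by (intro continuous_intros continuous_on_compose2[OF continuous_buffer_level[OF cont[OF w]]]) auto
  then show "(\<lambda>t\<in>{0..}. buffer_content X c (a * t) \<omega> / b) \<in> cont_paths"
    unfolding buffer_content_eq_level divide_inverse by (rule restrict_in_cont_paths)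
next
  fix t :: real assume "0 \<le> t"
  then show "(\<lambda>\<omega>. (\<lambda>t\<in>{0..}. buffer_content X c (a * t) \<omega> / b) t) \<in> borel_measurable M"
    unfolding buffer_content_eq_level
    by (simp add: borel_measurable_divide measurable_buffer_level[OF meas cont])
qed

section \<open>Regular variation and the scaling function\<close>

context
  fixes \<sigma> :: "real \<Rightarrow> real" and lam :: real
  assumes nn: "\<And>x. 0 \<le> \<sigma> x"
    and rv: "\<And>t. 0 < t \<Longrightarrow> ((\<lambda>x. \<sigma> (t * x) / \<sigma> x) \<longlongrightarrow> t powr lam) (at_right 0)"
begin

lemma doubling_near_zero:
  assumes "\<gamma> < lam" "lam < \<kappa>"
  obtains x1 where "0 < x1"
    "\<And>x. 0 < x \<Longrightarrow> x \<le> x1 \<Longrightarrow> 0 < \<sigma> x"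
    "\<And>x. 0 < x \<Longrightarrow> x \<le> x1 \<Longrightarrow> 2 powr \<gamma> * \<sigma> x \<le> \<sigma> (2 * x)"
    "\<And>x. 0 < x \<Longrightarrow> x \<le> x1 \<Longrightarrow> \<sigma> (2 * x) \<le> 2 powr \<kappa> * \<sigma> x"
proof -
  have lim: "((\<lambda>x. \<sigma> (2 * x) / \<sigma> x) \<longlongrightarrow> 2 powr lam) (at_right 0)" by (rule rv) simp
  have "\<forall>\<^sub>F x in at_right 0. 2 powr \<gamma> < \<sigma> (2 * x) / \<sigma> x"
    by (rule order_tendstoD(1)[OF lim]) (use assms in simp)
  moreover have "\<forall>\<^sub>F x in at_right 0. \<sigma> (2 * x) / \<sigma> x < 2 powr \<kappa>"
    by (rule order_tendstoD(2)[OF lim]) (use assms in simp)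
  ultimately have "\<forall>\<^sub>F x in at_right 0. 2 powr \<gamma> < \<sigma> (2 * x) / \<sigma> x \<and> \<sigma> (2 * x) / \<sigma> x < 2 powr \<kappa>"
    by (rule eventually_conj)
  then obtain b where b: "0 < b" "\<And>x. 0 < x \<Longrightarrow> x < b \<Longrightarrow> 2 powr \<gamma> < \<sigma> (2 * x) / \<sigma> x \<and> \<sigma> (2 * x) / \<sigma> x < 2 powr \<kappa>"
    unfolding eventually_at_right_field by blast
  have pos: "0 < \<sigma> x" if "0 < x" "x < b" for x
  proof -
    have "2 powr \<gamma> < \<sigma> (2 * x) / \<sigma> x" using b(2)[OF that] ..
    then have "\<sigma> x \<noteq> 0" by (intro notI) simp
    then show ?thesis using nn[of x] by simp
  qed
  show thesis
  proof (rule that[of "b / 2"])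
    show "0 < b / 2" using b(1) by simp
    fix x assume x: "0 < x" "x \<le> b / 2"
    then have xb: "x < b" using b(1) by simp
    show p: "0 < \<sigma> x" by (rule pos[OF x(1) xb])
    show "2 powr \<gamma> * \<sigma> x \<le> \<sigma> (2 * x)" "\<sigma> (2 * x) \<le> 2 powr \<kappa> * \<sigma> x"
      using b(2)[OF x(1) xb] p by (simp_all add: field_simps)
  qed
qed

text \<open>
  Doubling \<open>x\<close> does not decrease \<open>x\<^sup>\<kappa> / \<sigma> x\<close>, so on
  \<open>(0, x1]\<close> this quotient is bounded by its supremum over the compact interval
  \<open>[x1/2, x1]\<close>, where it is continuous.  Only the ratio \<open>\<sigma> (2 x) / \<sigma> x\<close> enters, so no uniform convergence
  theorem for regularly varying functions is involved.
\<close>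
lemma power_lower_bound:
  assumes cont: "continuous_on {0<..} \<sigma>" and x1: "0 < x1"
    and pos: "\<And>x. 0 < x \<Longrightarrow> x \<le> x1 \<Longrightarrow> 0 < \<sigma> x"
    and dbl: "\<And>x. 0 < x \<Longrightarrow> x \<le> x1 \<Longrightarrow> \<sigma> (2 * x) \<le> 2 powr \<kappa> * \<sigma> x"
  shows "\<exists>G. \<forall>x. 0 < x \<longrightarrow> x \<le> x1 \<longrightarrow> x powr \<kappa> / \<sigma> x \<le> G"
proof -
  let ?g = "\<lambda>x. x powr \<kappa> / \<sigma> x"
  have "continuous_on {x1 / 2..x1} ?g"
    using x1 pos by (intro continuous_intros continuous_on_subset[OF cont]) (force simp: less_imp_neq[THEN not_sym])+
  then have "bdd_above (?g ` {x1 / 2..x1})"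
    by (intro bounded_imp_bdd_above compact_imp_bounded compact_continuous_image) auto
  then obtain G where G: "\<And>x. x \<in> {x1 / 2..x1} \<Longrightarrow> ?g x \<le> G"
    unfolding bdd_above_def by blast
  have step: "?g x \<le> ?g (2 * x)" if x: "0 < x" "2 * x \<le> x1" for x
  proof -
    have "0 < \<sigma> x" "0 < \<sigma> (2 * x)" using x pos by auto
    moreover have "x powr \<kappa> * \<sigma> (2 * x) \<le> x powr \<kappa> * (2 powr \<kappa> * \<sigma> x)"
      using x by (intro mult_left_mono dbl) auto
    ultimately show ?thesis using x(1) by (simp add: frac_le_eq divide_simps powr_mult mult_ac)
  qed
  have main: "?g x \<le> G" if "0 < x" "x \<le> x1" "x1 / 2 ^ (n + 1) \<le> x" for n x
    using that
  proof (induction n arbitrary: x)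
    case 0
    then show ?case by (intro G) simp
  next
    case (Suc n)
    show ?case
    proof (cases "x1 / 2 \<le> x")
      case True
      then show ?thesis using Suc.prems by (intro G) simp
    next
      case False
      have "?g x \<le> ?g (2 * x)" using Suc.prems False by (intro step) auto
      also have "\<dots> \<le> G" using Suc.prems False by (intro Suc.IH) (auto simp: field_simps)
      finally show ?thesis .
    qed
  qed
  have "?g x \<le> G" if x: "0 < x" "x \<le> x1" for x
  proof -
    obtain n where "x1 / x < 2 ^ n" using real_arch_pow[of 2 "x1 / x"] by auto
    then have "x1 / 2 ^ (n + 1) \<le> x" using x x1 by (simp add: field_simps) 
    then show ?thesis using main x by blast
  qed
  then show ?thesis by blast
qed

text \<open>
  As \<open>x / \<sigma> x\<close> tends to zero at the origin, the solutions of
  \<open>x / \<sigma> x = 1/c\<close> stay away from zero, and the infimum defining the scaling is a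
  minimum; for large \<open>c\<close> the intermediate value theorem finds a solution below any
  prescribed \<open>x0\<close>.
\<close>
lemma scaling_eventually:
  assumes lam: "lam < 1" and cont: "continuous_on {0<..} \<sigma>" and x0: "0 < x0"
  shows "\<forall>\<^sub>F c in at_top. 0 < scaling \<sigma> c \<and> scaling \<sigma> c \<le> x0 \<and> c * scaling \<sigma> c = \<sigma> (scaling \<sigma> c) \<and> 0 < \<sigma> (scaling \<sigma> c)"
proof -
  obtain \<kappa> where \<kappa>: "lam < \<kappa>" "\<kappa> < 1" using dense[OF lam] by blast
  obtain x1 where x1: "0 < x1" and pos: "\<And>x. 0 < x \<Longrightarrow> x \<le> x1 \<Longrightarrow> 0 < \<sigma> x"
    and dbl: "\<And>x. 0 < x \<Longrightarrow> x \<le> x1 \<Longrightarrow> \<sigma> (2 * x) \<le> 2 powr \<kappa> * \<sigma> x"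
    by (rule doubling_near_zero[of "lam - 1" \<kappa>]) (use \<kappa> that in auto)
  obtain G where G: "\<And>x. 0 < x \<Longrightarrow> x \<le> x1 \<Longrightarrow> x powr \<kappa> / \<sigma> x \<le> G"
    using power_lower_bound[OF cont x1 pos dbl] by blast
  let ?f = "\<lambda>x. x / \<sigma> x"
  define y where "y = min x0 x1"
  have y: "0 < y" "y \<le> x0" "y \<le> x1" using x0 x1 by (auto simp: y_def)
  have f_le: "?f x \<le> G * x powr (1 - \<kappa>)" if x: "0 < x" "x \<le> x1" for x
  proof -
    have "?f x = (x powr \<kappa> / \<sigma> x) * x powr (1 - \<kappa>)"
      using x(1) by (simp add: powr_add[symmetric])
    also have "\<dots> \<le> G * x powr (1 - \<kappa>)" by (intro mult_right_mono G x) simp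
    finally show ?thesis .
  qed
  have "((\<lambda>x. G * x powr (1 - \<kappa>)) \<longlongrightarrow> G * 0) (at_right 0)"
  proof (intro tendsto_mult tendsto_const)
    have "((\<lambda>x. x powr (1 - \<kappa>)) \<longlongrightarrow> 0 powr (1 - \<kappa>)) (at_right 0)"
      by (rule tendsto_powr') (use \<kappa> in \<open>auto simp: eventually_at_right_less intro!: tendsto_intros eventually_mono[OF eventually_at_right_less]\<close>)
    then show "((\<lambda>x. x powr (1 - \<kappa>)) \<longlongrightarrow> 0) (at_right 0)" by simp
  qed
  then have Glim: "((\<lambda>x. G * x powr (1 - \<kappa>)) \<longlongrightarrow> 0) (at_right 0)" by simp
  have fy: "0 < ?f y" using y pos by simp
  have f_cont: "continuous_on {a..y} ?f" if "0 < a" for a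
    using that y pos by (intro continuous_intros continuous_on_subset[OF cont]) (force simp: less_imp_neq[THEN not_sym])+
  show ?thesis
    using eventually_gt_at_top[of "1 / ?f y"] eventually_gt_at_top[of 0]
  proof eventually_elim
    case (elim c)
    have "1 < c * ?f y" using elim(1) by (simp only: pos_divide_less_eq[OF fy])
    then have c: "0 < c" "1 / c < ?f y"
      using elim(2) by (simp_all only: pos_divide_less_eq[OF elim(2)] mult.commute)
    have "\<forall>\<^sub>F x in at_right 0. G * x powr (1 - \<kappa>) < 1 / c"
      by (rule order_tendstoD(2)[OF Glim]) (use c in simp)
    then obtain b where b: "0 < b" "\<And>x. 0 < x \<Longrightarrow> x < b \<Longrightarrow> G * x powr (1 - \<kappa>) < 1 / c"
      unfolding eventually_at_right_field by blast
    define a where "a = min b y / 2"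
    have a: "0 < a" "a < b" "a < y" using b(1) y(1) by (auto simp: a_def min_def)
    have small: "?f x < 1 / c" if "0 < x" "x \<le> a" for x
      using f_le[of x] b(2)[of x] that a y by simp
    let ?S = "{x. 0 < x \<and> x / \<sigma> x = 1 / c}"
    let ?S' = "{x \<in> {a..y}. ?f x = 1 / c}"
    have ne: "?S' \<noteq> {}"
    proof -
      have "\<exists>x\<ge>a. x \<le> y \<and> ?f x = 1 / c"
        by (rule IVT') (use small[of a] a c f_cont[OF a(1)] in auto)
      then show ?thesis by auto
    qed
    have cl: "closed ?S'"
      by (rule continuous_closed_preimage_constant[OF f_cont[OF a(1)]]) simp
    have bdd: "bdd_below ?S'" by (rule bdd_belowI[of _ a]) simp
    define d where "d = Inf ?S'"
    have d: "d \<in> ?S'" unfolding d_def by (rule closed_contains_Inf[OF ne bdd cl])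
    have least: "d \<le> x" if "x \<in> ?S" for x
    proof (cases "x \<le> y")
      case True
      then have "a \<le> x" using that small[of x] by force
      then have "x \<in> ?S'" using that True by simp
      then show ?thesis unfolding d_def by (rule cInf_lower[OF _ bdd])
    next
      case False
      then show ?thesis using d by simp
    qed
    have "scaling \<sigma> c = d"
      unfolding scaling_def by (rule cInf_eq_minimum) (use d a least in auto)
    moreover have dp: "0 < d" "d \<le> y" using d a by auto
    moreover have "0 < \<sigma> d" using dp y by (intro pos) auto
    moreover have "c * d = \<sigma> d"
    proof -
      have "d / \<sigma> d = 1 / c" using d by simp
      then show ?thesis using c(1) \<open>0 < \<sigma> d\<close> by (simp add: field_simps)
    qed
    ultimately show ?case using y by simp
  qed
qed

end

lemma geometric_bound_dyadic:
  fixes \<sigma> :: "real \<Rightarrow> real"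
  assumes dbl: "\<And>x. 0 < x \<Longrightarrow> x \<le> x1 \<Longrightarrow> 2 powr \<gamma> * \<sigma> x \<le> \<sigma> (2 * x)" and x: "0 < x" "x \<le> x1"
  shows "\<sigma> (x * (1 / 2 ^ m)) \<le> (2 powr (- \<gamma>)) ^ m * \<sigma> x"
proof (induction m)
  case (Suc m)
  let ?y = "x * (1 / 2 ^ Suc m)"
  have y: "0 < ?y" using x by simp
  have "x * (1 / 2 ^ Suc m) \<le> x * 1"
    using x one_le_power[of "2::real" "Suc m"] by (intro mult_left_mono) (simp_all del: power_Suc)
  then have "?y \<le> x" by simp
  then have "2 powr \<gamma> * \<sigma> ?y \<le> \<sigma> (2 * ?y)" using dbl[OF y] x by simp
  then have "2 powr (- \<gamma>) * (2 powr \<gamma> * \<sigma> ?y) \<le> 2 powr (- \<gamma>) * \<sigma> (2 * ?y)" by (intro mult_left_mono) auto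
  moreover have "2 powr (- \<gamma>) * (2 powr \<gamma> * \<sigma> ?y) = \<sigma> ?y"
    by (simp add: powr_minus)
  moreover have "2 * ?y = x * (1 / 2 ^ m)" by simp
  ultimately have "\<sigma> ?y \<le> 2 powr (- \<gamma>) * \<sigma> (x * (1 / 2 ^ m))" by (simp only:)
  also have "\<dots> \<le> 2 powr (- \<gamma>) * ((2 powr (- \<gamma>)) ^ m * \<sigma> x)"
    by (intro mult_left_mono Suc.IH) simp
  finally show ?case by simp
qed simp

text \<open>
  Doubling multiplies \<open>\<sigma>\<close> by at most \<open>2\<^sup>\<beta>\<close> below \<open>x1\<close> and above
  \<open>y1\<close>.  In between, subadditivity gives the factor \<open>2\<close>, and the sequence
  \<open>2\<^sup>i x\<close> visits the interval \<open>(x1, y1)\<close> at most \<open>J\<close> times, whatever the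
  starting point, so the loss is the constant \<open>w\<^sup>J\<close>.
\<close>
lemma geometric_growth_doubling:
  fixes \<sigma> :: "real \<Rightarrow> real"
  assumes x1: "0 < x1" and \<beta>: "\<beta> \<le> 1"
    and nn: "\<And>x. 0 \<le> \<sigma> x"
    and sub: "\<And>x y. 0 \<le> x \<Longrightarrow> 0 \<le> y \<Longrightarrow> \<sigma> (x + y) \<le> \<sigma> x + \<sigma> y"
    and dbl0: "\<And>x. 0 < x \<Longrightarrow> x \<le> x1 \<Longrightarrow> \<sigma> (2 * x) \<le> 2 powr \<beta> * \<sigma> x"
    and dbl1: "\<And>x. y1 \<le> x \<Longrightarrow> \<sigma> (2 * x) \<le> 2 powr \<beta> * \<sigma> x"
  shows "\<exists>C\<ge>1. \<forall>x. 0 < x \<longrightarrow> x \<le> x1 \<longrightarrow> (\<forall>j. \<sigma> (2 ^ j * x) \<le> C * (2 powr \<beta>) ^ j * \<sigma> x)"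
proof -
  define w where "w = 2 / 2 powr \<beta>"
  have "2 powr \<beta> \<le> 2 powr 1" using \<beta> by (intro powr_mono) auto
  then have w: "1 \<le> w" by (simp add: w_def)
  obtain J where J: "y1 / x1 < 2 ^ J" using real_arch_pow[of 2 "y1 / x1"] by auto
  have "\<sigma> (2 ^ j * x) \<le> w ^ J * (2 powr \<beta>) ^ j * \<sigma> x" if x: "0 < x" "x \<le> x1" for x j
  proof -
    \<comment> \<open>The doubling steps that only subadditivity controls.\<close>
    define mid where "mid j = {i. i < j \<and> x1 < 2 ^ i * x \<and> 2 ^ i * x < y1}" for j
    have fin: "finite (mid j)" for j unfolding mid_def by simp
    have bound: "\<sigma> (2 ^ j * x) \<le> w ^ card (mid j) * (2 powr \<beta>) ^ j * \<sigma> x" for j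
    proof (induction j)
      case 0
      then show ?case by (simp add: mid_def)
    next
      case (Suc j)
      let ?y = "2 ^ j * x"
      have y: "0 < ?y" using x by simp
      show ?case
      proof (cases "x1 < ?y \<and> ?y < y1")
        case True
        have "mid (Suc j) = insert j (mid j)" using True by (auto simp: mid_def less_Suc_eq)
        moreover have "j \<notin> mid j" by (simp add: mid_def)
        ultimately have card: "card (mid (Suc j)) = Suc (card (mid j))" using fin by simp
        have "\<sigma> (2 ^ Suc j * x) \<le> 2 * \<sigma> ?y" using sub[of ?y ?y] y by (simp add: mult_ac)
        also have "\<dots> = w * 2 powr \<beta> * \<sigma> ?y" by (simp add: w_def)
        also have "\<dots> \<le> w * 2 powr \<beta> * (w ^ card (mid j) * (2 powr \<beta>) ^ j * \<sigma> x)"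
          using w by (intro mult_left_mono Suc.IH) auto
        finally show ?thesis by (simp add: card mult_ac)
      next
        case False
        then have "mid (Suc j) = mid j" by (auto simp: mid_def less_Suc_eq)
        have "\<sigma> (2 * ?y) \<le> 2 powr \<beta> * \<sigma> ?y" using False y dbl0[of ?y] dbl1[of ?y] by linarith
        also have "\<dots> \<le> 2 powr \<beta> * (w ^ card (mid j) * (2 powr \<beta>) ^ j * \<sigma> x)"
          by (intro mult_left_mono Suc.IH) auto
        finally show ?thesis using \<open>mid (Suc j) = mid j\<close> by (simp add: mult_ac)
      qed
    qed
    have "card (mid j) \<le> J"
    proof (cases "mid j = {}")
      case False
      define i0 where "i0 = Min (mid j)"
      have i0: "i0 \<in> mid j" "\<And>i. i \<in> mid j \<Longrightarrow> i0 \<le> i"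
        unfolding i0_def using fin False by auto
      have "i < i0 + J" if i: "i \<in> mid j" for i
      proof (rule ccontr)
        assume "\<not> i < i0 + J"
        then obtain k where k: "i = i0 + J + k" using le_Suc_ex[of "i0 + J" i] by auto
        have "y1 \<le> 2 ^ J * x1" using J x1 by (simp add: field_simps)
        also have "\<dots> \<le> 2 ^ J * (2 ^ i0 * x)" using i0(1) by (simp add: mid_def)
        also have "\<dots> \<le> 2 ^ k * (2 ^ J * (2 ^ i0 * x))"
        proof -
          have "0 \<le> 2 ^ J * (2 ^ i0 * x)" using x by simp
          then show ?thesis using mult_right_mono[of 1 "2 ^ k" "2 ^ J * (2 ^ i0 * x)"] by simp
        qed
        also have "\<dots> = 2 ^ i * x" by (simp add: k power_add mult_ac)
        finally show False using i by (simp add: mid_def)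
      qed
      then have "mid j \<subseteq> {i0..<i0 + J}" using i0(2) by auto
      from card_mono[OF _ this] show ?thesis by simp
    qed simp
    then have "w ^ card (mid j) \<le> w ^ J" using w by (rule power_increasing)
    then have "w ^ card (mid j) * (2 powr \<beta>) ^ j * \<sigma> x \<le> w ^ J * (2 powr \<beta>) ^ j * \<sigma> x"
      using nn by (intro mult_right_mono) auto
    with bound[of j] show ?thesis by (rule order_trans)
  qed
  then show ?thesis using w by (intro exI[of _ "w ^ J"]) (auto simp: one_le_power)
qed

text \<open>
  Binary expansion of \<open>n\<close>, subadditivity, and a geometric sum.
\<close>
lemma growth_along_multiples:
  fixes \<sigma> :: "real \<Rightarrow> real"
  assumes x: "0 \<le> x" and \<beta>: "0 < \<beta>" and C: "0 \<le> C" and zero: "\<sigma> 0 = 0" and nn: "0 \<le> \<sigma> x"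
    and sub: "\<And>x y. 0 \<le> x \<Longrightarrow> 0 \<le> y \<Longrightarrow> \<sigma> (x + y) \<le> \<sigma> x + \<sigma> y"
    and dbl: "\<And>j. \<sigma> (2 ^ j * x) \<le> C * (2 powr \<beta>) ^ j * \<sigma> x"
  shows "\<sigma> (x * real n) \<le> C * (2 powr \<beta> / (2 powr \<beta> - 1)) * (1 + real n) powr \<beta> * \<sigma> x"
proof -
  let ?q = "2 powr \<beta>"
  have q: "1 < ?q" using \<beta> powr_less_mono[of 0 \<beta> 2] by simp
  have dyadic: "\<sigma> (real n * x) \<le> C * \<sigma> x * (\<Sum>j<k. ?q ^ j)" if "n < 2 ^ k" for k n
    using that
  proof (induction k arbitrary: n)
    case 0
    then show ?case by (simp add: zero)
  next
    case (Suc k)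
    have S: "0 \<le> C * \<sigma> x * ?q ^ k" using C nn by simp
    show ?case
    proof (cases "n < 2 ^ k")
      case True
      then show ?thesis using Suc.IH[OF True] S by (simp add: distrib_left)
    next
      case False
      define n' where "n' = n - 2 ^ k"
      have n': "n = 2 ^ k + n'" "n' < 2 ^ k" using False Suc.prems by (auto simp: n'_def)
      have "\<sigma> (real n * x) \<le> \<sigma> (2 ^ k * x) + \<sigma> (real n' * x)"
        using sub[of "2 ^ k * x" "real n' * x"] x by (simp add: n'(1) distrib_right)
      also have "\<dots> \<le> C * ?q ^ k * \<sigma> x + C * \<sigma> x * (\<Sum>j<k. ?q ^ j)"
        by (intro add_mono dbl Suc.IH n'(2))
      finally show ?thesis by (simp add: algebra_simps)
    qed
  qed
  obtain k where k: "2 ^ k \<le> n + 1" "n + 1 < 2 ^ (k + 1)"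
    using ex_power_ivl1[of 2 "n + 1"] by auto
  have "(\<Sum>j<k + 1. ?q ^ j) = (?q ^ (k + 1) - 1) / (?q - 1)" by (rule geometric_sum[OF less_imp_neq[OF q, symmetric]])
  also have "\<dots> \<le> ?q ^ (k + 1) / (?q - 1)" using q by (intro divide_right_mono) auto
  also have "?q ^ (k + 1) = ?q * ((2 ^ k) powr \<beta>)"
    by (simp add: powr_realpow[symmetric] powr_powr mult.commute)
  also have "?q * ((2 ^ k) powr \<beta>) / (?q - 1) \<le> ?q * ((1 + real n) powr \<beta>) / (?q - 1)"
  proof (intro divide_right_mono mult_left_mono powr_mono2)
    have "real (2 ^ k) \<le> real (n + 1)" using k(1) by (simp only: of_nat_le_iff)
    then show "2 ^ k \<le> 1 + real n" by simp
    show "0 \<le> ?q - 1" using q by linarith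
  qed (use \<beta> in auto)
  finally have sum: "(\<Sum>j<k + 1. ?q ^ j) \<le> ?q * ((1 + real n) powr \<beta>) / (?q - 1)" .
  have "\<sigma> (real n * x) \<le> C * \<sigma> x * (\<Sum>j<k + 1. ?q ^ j)" using k(2) by (intro dyadic) simp
  also have "\<dots> \<le> C * \<sigma> x * (?q * ((1 + real n) powr \<beta>) / (?q - 1))"
    using C nn by (intro mult_left_mono sum) auto
  finally show ?thesis by (simp add: mult_ac)
qed

section \<open>Convergence of the rescaled buffer content\<close>

lemma measurable_continuous_functional:
  assumes \<phi>: "continuous_map T euclideanreal \<phi>"
  shows "\<phi> \<in> borel_measurable (borel_of_topology T)"
proof (rule borel_measurableI)
  have sub: "{U. openin T U} \<subseteq> Pow (topspace T)" using openin_subset by blast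
  have space: "space (borel_of_topology T) = topspace T"
    unfolding borel_of_topology_def by (rule space_measure_of[OF sub])
  fix S :: "real set" assume "open S"
  then have "openin T {x \<in> topspace T. \<phi> x \<in> S}"
    using openin_continuous_map_preimage[OF \<phi>, of S] by simp
  moreover have "\<phi> -` S \<inter> space (borel_of_topology T) = {x \<in> topspace T. \<phi> x \<in> S}"
    unfolding space by auto
  ultimately show "\<phi> -` S \<inter> space (borel_of_topology T) \<in> sets (borel_of_topology T)"
    unfolding borel_of_topology_def sets_measure_of[OF sub] by (simp add: sigma_sets.Basic)
qed

text \<open>
  Substituting \<open>s = d u\<close> in the supremum.  Boundedness matters: an unspecified value of
  the supremum would not scale.
\<close>
lemma buffer_level_scaling:
  assumes d: "0 < d" and b: "0 < b" and cd: "c * d = b"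
    and bdd: "buffer_bounded 1 (\<lambda>u. x (d * u) / b) t"
  shows "buffer_level c x (d * t) / b = buffer_level 1 (\<lambda>u. x (d * u) / b) t"
proof -
  let ?y = "\<lambda>u. x (d * u) / b"
  have eq: "x (d * t) - x (d * u) - c * (d * t - d * u) = b * (?y t - ?y u - 1 * (t - u))" for u
  proof -
    have "c * (d * t - d * u) = (c * d) * (t - u)" by (simp add: algebra_simps)
    moreover have "b * (?y t - ?y u - 1 * (t - u)) = x (d * t) - x (d * u) - b * (t - u)"
      using b by (simp add: right_diff_distrib)
    ultimately show ?thesis by (simp only: cd)
  qed
  have "buffer_level c x (d * t) = b * buffer_level 1 ?y t"
    unfolding buffer_level_def[of c]
  proof (rule cSup_eq_non_empty)
    show "(\<lambda>s. x (d * t) - x s - c * (d * t - s)) ` {..d * t} \<noteq> {}" by simp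
    fix z assume "z \<in> (\<lambda>s. x (d * t) - x s - c * (d * t - s)) ` {..d * t}"
    then obtain s where s: "s \<le> d * t" "z = x (d * t) - x s - c * (d * t - s)" by auto
    have "s / d \<le> t" using s(1) d by (simp add: field_simps)
    from buffer_level_upper[OF bdd this]
    have "b * (?y t - ?y (s / d) - 1 * (t - s / d)) \<le> b * buffer_level 1 ?y t"
      using b by (intro mult_left_mono) auto
    then show "z \<le> b * buffer_level 1 ?y t" using eq[of "s / d"] d s(2) by simp
  next
    fix z assume z: "\<And>v. v \<in> (\<lambda>s. x (d * t) - x s - c * (d * t - s)) ` {..d * t} \<Longrightarrow> v \<le> z"
    have "?y t - ?y u - 1 * (t - u) \<le> z / b" if "u \<le> t" for u
    proof -
      have "d * u \<in> {..d * t}" using that d by simp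
      then have "x (d * t) - x (d * u) - c * (d * t - d * u) \<le> z" by (intro z imageI)
      then have "b * (?y t - ?y u - 1 * (t - u)) \<le> z" unfolding eq .
      then show ?thesis using b by (simp only: pos_le_divide_eq mult.commute)
    qed
    then have "buffer_level 1 ?y t \<le> z / b" by (simp only: buffer_level_le_iff[OF bdd]) blast
    then show "b * buffer_level 1 ?y t \<le> z" using b by (simp only: pos_le_divide_eq mult.commute)
  qed
  then show ?thesis using b by simp
qed

context gaussian_increments
begin

lemma std_0: "s 0 = 0"
  using increment[of 0 0] by simp

lemma std_continuous: "continuous_on {0<..} s"
proof -
  have "isCont s t" if t: "0 < t" for t
  proof (rule continuous_at_eps_delta[THEN iffD2], intro allI impI)
    fix e :: real assume e: "0 < e"
    have "\<forall>\<^sub>F h in at_right 0. s h < e"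
      by (rule order_tendstoD(2)[OF std_tendsto_0 e])
    then obtain b where b: "0 < b" "\<And>h. 0 < h \<Longrightarrow> h < b \<Longrightarrow> s h < e"
      unfolding eventually_at_right_field by blast
    have "\<bar>s u - s t\<bar> < e" if u: "\<bar>u - t\<bar> < min b t" for u
    proof (cases "u = t")
      case False
      have "0 \<le> u" using u t by linarith
      then have "\<bar>s u - s t\<bar> \<le> s \<bar>u - t\<bar>" using t by (intro std_diff_le) auto
      also have "\<dots> < e" using False u by (intro b(2)) auto
      finally show ?thesis .
    qed (use e in simp)
    then show "\<exists>d>0. \<forall>u. dist u t < d \<longrightarrow> dist (s u) (s t) < e"
      using b(1) t by (intro exI[of _ "min b t"]) (simp add: dist_real_def)
  qed
  then show ?thesis by (intro continuous_at_imp_continuous_on ballI) simp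
qed

text \<open>
  The covariance of a Gaussian process with stationary increments is a polynomial in finitely
  many values of \<open>s\<close>, so pointwise convergence of the standard deviations is enough for
  the characteristic functions.
\<close>
lemma characteristic_tendsto:
  assumes N: "gaussian_increments N B s'" and J: "finite J"
    and d: "\<forall>\<^sub>F c in F. 0 < d c" "\<forall>\<^sub>F c in F. 0 < b c"
    and lim: "\<And>t. 0 \<le> t \<Longrightarrow> ((\<lambda>c. s (d c * t) / b c) \<longlongrightarrow> s' t) F"
  shows "((\<lambda>c. expectation (\<lambda>\<omega>. cos ((\<Sum>t\<in>J. a t * (Y (d c * t) \<omega> / b c)) + \<theta>))) \<longlongrightarrow>
      (\<integral>\<omega>. cos ((\<Sum>t\<in>J. a t * B t \<omega>) + \<theta>) \<partial>N)) F"
proof -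
  interpret N: gaussian_increments N B s' by (rule N)
  let ?R = "\<lambda>S t u. a t * a u * (((S \<bar>t\<bar>)\<^sup>2 + (S \<bar>u\<bar>)\<^sup>2 - (S \<bar>t - u\<bar>)\<^sup>2) / 2)"
  let ?e = "\<lambda>S. exp (- (\<Sum>t\<in>J. \<Sum>u\<in>J. ?R S t u) / 2) * cos \<theta>"
  have "((\<lambda>c. ?e (\<lambda>t. s (d c * t) / b c)) \<longlongrightarrow> ?e s') F"
    by (intro tendsto_intros lim) auto
  moreover have "\<forall>\<^sub>F c in F. ?e (\<lambda>t. s (d c * t) / b c) =
      expectation (\<lambda>\<omega>. cos ((\<Sum>t\<in>J. a t * (Y (d c * t) \<omega> / b c)) + \<theta>))"
    using d
  proof eventually_elim
    case (elim c)
    interpret C: gaussian_increments M "\<lambda>t \<omega>. Y (d c * t) \<omega> / b c" "\<lambda>h. s (\<bar>d c\<bar> * h) / b c"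
      using elim by (intro time_change) auto
    show ?case
      using C.characteristic_combination[OF J, of a \<theta>] elim(1) by simp
  qed
  ultimately show ?thesis
    unfolding N.characteristic_combination[OF J] by (rule Lim_transform_eventually)
qed

end

lemma tightness_constant:
  fixes C K e :: real
  assumes C: "0 \<le> C" and K: "0 \<le> K" and e: "0 < e" and n: "1 \<le> n"
  shows "\<exists>A>0. K * (C / A) ^ n \<le> e"
proof -
  define A where "A = max 1 (max C (K * C / e))"
  have A: "0 < A" "C \<le> A" "K * C / e \<le> A" by (auto simp: A_def)
  have q: "0 \<le> C / A" "C / A \<le> 1" using A C by auto
  have "(C / A) ^ n \<le> (C / A) ^ 1" by (rule power_decreasing[OF n q])
  then have "K * (C / A) ^ n \<le> K * (C / A)" using K by (intro mult_left_mono) auto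
  also have "\<dots> \<le> e"
  proof -
    have "K * C \<le> A * e" using A(3) e by (simp only: pos_divide_le_eq)
    then show ?thesis using A(1) by (simp add: pos_divide_le_eq mult.commute)
  qed
  finally show ?thesis using A(1) by blast
qed

text \<open>
  The two estimates that tightness needs, uniform over all small \<open>x\<close>.  The second one
  ranges over all \<open>n\<close> and therefore follows \<open>\<sigma>\<close> from the origin out to
  infinity, which is where both kinds of regular variation enter.
\<close>
lemma std_bounds_near_zero:
  fixes \<sigma> :: "real \<Rightarrow> real"
  assumes nn: "\<And>x. 0 \<le> \<sigma> x" and zero: "\<sigma> 0 = 0"
    and sub: "\<And>x y. 0 \<le> x \<Longrightarrow> 0 \<le> y \<Longrightarrow> \<sigma> (x + y) \<le> \<sigma> x + \<sigma> y"
    and lam: "0 < lam" "lam < \<beta>" and rv0: "regularly_varying_at_zero \<sigma> lam"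
    and \<alpha>: "\<alpha> < \<beta>" "\<beta> \<le> 1" and rv1: "regularly_varying_at_infinity \<sigma> \<alpha>"
    and \<gamma>: "\<gamma> < lam"
  obtains x1 C where "0 < x1" "1 \<le> C"
    "\<And>x m. 0 < x \<Longrightarrow> x \<le> x1 \<Longrightarrow> \<sigma> (x * (1 / 2 ^ m)) \<le> C * (2 powr (- \<gamma>)) ^ m * \<sigma> x"
    "\<And>x n. 0 < x \<Longrightarrow> x \<le> x1 \<Longrightarrow> \<sigma> (x * real n) \<le> C * (1 + real n) powr \<beta> * \<sigma> x"
proof -
  have rv: "((\<lambda>x. \<sigma> (t * x) / \<sigma> x) \<longlongrightarrow> t powr lam) (at_right 0)" if "0 < t" for t
    using rv0 that by (simp add: regularly_varying_at_zero_def)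
  obtain x1 where x1: "0 < x1"
    and lower: "\<And>x. 0 < x \<Longrightarrow> x \<le> x1 \<Longrightarrow> 2 powr \<gamma> * \<sigma> x \<le> \<sigma> (2 * x)"
    and upper: "\<And>x. 0 < x \<Longrightarrow> x \<le> x1 \<Longrightarrow> \<sigma> (2 * x) \<le> 2 powr \<beta> * \<sigma> x"
    by (rule doubling_near_zero[OF nn rv \<gamma> lam(2)]) blast+
  have "((\<lambda>x. \<sigma> (2 * x) / \<sigma> x) \<longlongrightarrow> 2 powr \<alpha>) at_top"
    using rv1 by (simp add: regularly_varying_at_infinity_def)
  then have "\<forall>\<^sub>F x in at_top. 0 < \<sigma> (2 * x) / \<sigma> x \<and> \<sigma> (2 * x) / \<sigma> x < 2 powr \<beta>"
    by (intro eventually_conj order_tendstoD) (use \<alpha> in auto)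
  then obtain y1 where y1: "\<And>x. y1 \<le> x \<Longrightarrow> 0 < \<sigma> (2 * x) / \<sigma> x \<and> \<sigma> (2 * x) / \<sigma> x < 2 powr \<beta>"
    unfolding eventually_at_top_linorder by blast
  have upper': "\<sigma> (2 * x) \<le> 2 powr \<beta> * \<sigma> x" if "y1 \<le> x" for x
  proof -
    have "\<sigma> x \<noteq> 0" using y1[OF that] by (intro notI) simp
    then have "0 < \<sigma> x" using nn[of x] by simp
    moreover have "\<sigma> (2 * x) / \<sigma> x \<le> 2 powr \<beta>" using y1[OF that] by simp
    ultimately show ?thesis by (simp only: pos_divide_le_eq)
  qed
  have "\<exists>C\<ge>1. \<forall>x. 0 < x \<longrightarrow> x \<le> x1 \<longrightarrow> (\<forall>j. \<sigma> (2 ^ j * x) \<le> C * (2 powr \<beta>) ^ j * \<sigma> x)"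
    by (rule geometric_growth_doubling[OF x1 \<alpha>(2) nn sub upper upper'])
  then obtain C where C: "1 \<le> C"
    and dbl: "\<And>x j. 0 < x \<Longrightarrow> x \<le> x1 \<Longrightarrow> \<sigma> (2 ^ j * x) \<le> C * (2 powr \<beta>) ^ j * \<sigma> x"
    by blast
  have \<beta>: "0 < \<beta>" using lam by simp
  define C' where "C' = C * (2 powr \<beta> / (2 powr \<beta> - 1))"
  have q: "1 < 2 powr \<beta>" using powr_less_mono[OF \<beta>, of 2] by simp
  have "1 \<le> 2 powr \<beta> / (2 powr \<beta> - 1)" using q by (simp add: pos_le_divide_eq)
  then have C': "1 \<le> C'" using C mult_mono[of 1 C 1 "2 powr \<beta> / (2 powr \<beta> - 1)"] by (simp add: C'_def)
  show thesis
  proof (rule that[OF x1 C'])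
    fix x :: real assume x: "0 < x" "x \<le> x1"
    show "\<sigma> (x * real n) \<le> C' * (1 + real n) powr \<beta> * \<sigma> x" for n
      unfolding C'_def
      by (rule growth_along_multiples) (use x \<beta> C zero nn sub dbl in auto)
    show "\<sigma> (x * (1 / 2 ^ m)) \<le> C' * (2 powr (- \<gamma>)) ^ m * \<sigma> x" for m
    proof -
      have "\<sigma> (x * (1 / 2 ^ m)) \<le> (2 powr (- \<gamma>)) ^ m * \<sigma> x"
        by (rule geometric_bound_dyadic[OF _ x]) (rule lower)
      also have "\<dots> \<le> C' * ((2 powr (- \<gamma>)) ^ m * \<sigma> x)"
        using mult_right_mono[OF C', of "(2 powr (- \<gamma>)) ^ m * \<sigma> x"] nn by simp
      finally show ?thesis by (simp only: mult.assoc)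
    qed
  qed
qed

theorem theorem2:
  fixes M :: "'a measure" and N :: "'b measure"
    and X :: "real \<Rightarrow> 'a \<Rightarrow> real" and B :: "real \<Rightarrow> 'b \<Rightarrow> real"
    and \<sigma> \<delta> :: "real \<Rightarrow> real" and lam \<alpha> :: real
  assumes "prob_space M"
    and "gaussian_stationary_increments M X"
    and "\<sigma> = std_function M X"
    and "0 < lam" "lam < 1" "regularly_varying_at_zero \<sigma> lam"
    and "0 < \<alpha>" "\<alpha> < 1" "regularly_varying_at_infinity \<sigma> \<alpha>"
    and "\<delta> = scaling \<sigma>"
    and "prob_space N"
    and "fractional_brownian_motion N lam B"
  shows "converges_in_distribution cont_path_topology
           M (\<lambda>c \<omega>. \<lambda>t\<in>{0..}. buffer_content X c (\<delta> c * t) \<omega> / \<sigma> (\<delta> c)) at_top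
           N (\<lambda>\<omega>. \<lambda>t\<in>{0..}. buffer_content B 1 t \<omega>)"
proof -
  interpret X: gaussian_increments M X \<sigma>
    unfolding assms(3) by (rule gaussian_increments_of_stationary[OF assms(1,2)])
  interpret B: gaussian_increments N B "\<lambda>h. \<bar>h\<bar> powr lam"
    by (rule gaussian_increments_fractional_brownian_motion[OF assms(11,12)])
  note lam = assms(4,5) and \<alpha> = assms(7,8)
  have rv: "((\<lambda>x. \<sigma> (t * x) / \<sigma> x) \<longlongrightarrow> t powr lam) (at_right 0)" if "0 < t" for t
    using assms(6) that by (simp add: regularly_varying_at_zero_def)
  have \<delta>_eventually: "\<forall>\<^sub>F c in at_top. 0 < \<delta> c \<and> \<delta> c \<le> x0 \<and> c * \<delta> c = \<sigma> (\<delta> c) \<and> 0 < \<sigma> (\<delta> c)"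
    if "0 < x0" for x0
    unfolding assms(10) by (rule scaling_eventually[OF X.s_nonneg rv lam(2) X.std_continuous that])
  have \<delta>_lim: "filterlim \<delta> (at_right 0) at_top"
    unfolding filterlim_at
  proof
    have "\<forall>\<^sub>F c in at_top. dist (\<delta> c) 0 < e" if "0 < e" for e
      using \<delta>_eventually[of "e / 2"] that by (auto elim!: eventually_mono)
    then show "(\<delta> \<longlongrightarrow> 0) at_top" by (rule tendstoI)
    show "\<forall>\<^sub>F c in at_top. \<delta> c \<in> {0<..} \<and> \<delta> c \<noteq> 0"
      using \<delta>_eventually[of 1] by (auto elim!: eventually_mono)
  qed
  have std_lim: "((\<lambda>c. \<sigma> (\<delta> c * t) / \<sigma> (\<delta> c)) \<longlongrightarrow> \<bar>t\<bar> powr lam) at_top" if t: "0 \<le> t" for t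
  proof (cases "t = 0")
    case True
    then show ?thesis by (simp add: X.std_0)
  next
    case False
    then have "0 < t" using t by simp
    from filterlim_compose[OF rv[OF this] \<delta>_lim] show ?thesis using t by (simp add: mult.commute)
  qed
  \<comment> \<open>\<open>\<beta>\<close> is the growth exponent of the standard deviation, \<open>\<beta>'\<close> that of the paths.\<close>
  define \<beta> where "\<beta> = (1 + max lam \<alpha>) / 2"
  define \<beta>' where "\<beta>' = (1 + \<beta>) / 2"
  have \<beta>: "lam < \<beta>" "\<alpha> < \<beta>" "0 < \<beta>" "\<beta> < 1" "\<beta> < \<beta>'" "0 \<le> \<beta>'" "\<beta>' < 1"
    using lam \<alpha> by (auto simp: \<beta>_def \<beta>'_def max_def)
  \<comment> \<open>\<open>r\<^sup>2 = 2\<^sup>-\<^sup>\<gamma>\<close> for the exponent \<open>\<gamma> = lam / 2\<close> of the standard deviation; the paths are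
    controlled with half of it.\<close>
  define r where "r = 2 powr (- lam / 4)"
  have r: "0 < r" "r < 1" using powr_less_mono[of "- lam / 4" 0 2] lam by (simp_all add: r_def)
  have r2: "r ^ 2 = 2 powr (- (lam / 2))"
    by (simp add: r_def power2_eq_square powr_add[symmetric])
  obtain p :: nat where p: "r ^ (2 * p) \<le> 1 / 4" "2 \<le> 2 * real p * (\<beta>' - \<beta>)" "1 \<le> 2 * p"
  proof -
    obtain p :: nat where p0: "max (4 / lam) (1 / (\<beta>' - \<beta>)) < real p" using reals_Archimedean2 by blast
    then have p1: "4 / lam < real p" and p2: "1 / (\<beta>' - \<beta>) < real p" by simp_all
    have "r ^ (2 * p) = 2 powr (- (lam / 2) * real p)"
      by (simp add: power_mult r2 powr_realpow[symmetric] powr_powr)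
    also have "\<dots> \<le> 2 powr (- 2)"
      using p1 lam by (intro powr_mono) (auto simp: field_simps)
    also have "\<dots> = 1 / 4" by (simp add: powr_minus_divide)
    finally have "r ^ (2 * p) \<le> 1 / 4" .
    moreover have "1 < real p * (\<beta>' - \<beta>)" using p2 \<beta>(5) by (simp add: pos_divide_less_eq)
    moreover have "0 < real p" using p1 lam by (meson divide_pos_pos less_trans zero_less_numeral)
    ultimately show thesis by (intro that[of p]) auto
  qed
  obtain x1 C where x1: "0 < x1" and C: "1 \<le> C"
    and dyadic: "\<And>x m. 0 < x \<Longrightarrow> x \<le> x1 \<Longrightarrow> \<sigma> (x * (1 / 2 ^ m)) \<le> C * (2 powr (- (lam / 2))) ^ m * \<sigma> x"
    and multiples: "\<And>x n. 0 < x \<Longrightarrow> x \<le> x1 \<Longrightarrow> \<sigma> (x * real n) \<le> C * (1 + real n) powr \<beta> * \<sigma> x"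
    using std_bounds_near_zero[OF X.s_nonneg X.std_0 X.std_subadditive lam(1) \<beta>(1) assms(6) \<beta>(2) less_imp_le[OF \<beta>(4)] assms(9), of "lam / 2"]
      lam(1) by auto
  define D where "D = 6 * (fact (2 * p) / (2 ^ p * fact p)) * (\<Sum>n. 1 / (1 + real n)\<^sup>2)"
  have D: "0 \<le> D"
    unfolding D_def using inverse_squares_sums
    by (intro mult_nonneg_nonneg suminf_nonneg) (auto simp: sums_iff add.commute)
  have C0: "0 \<le> C" using C by simp
  have tight_B: "\<exists>E\<in>B.events. 1 - D * (C / A) ^ (2 * p) \<le> B.prob E \<and>
      (\<forall>\<omega>\<in>E. (\<lambda>t. B t \<omega>) \<in> controlled_paths A \<beta>' r)" if A: "0 < A" for A
    unfolding D_def
  proof (rule B.prob_controlled_paths[OF A C0 r p(1,2) less_imp_le[OF \<beta>(3)] \<beta>(6)])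
    fix n :: nat
    have "\<bar>real n\<bar> powr lam \<le> (1 + real n) powr lam" using lam by (intro powr_mono2) auto
    also have "\<dots> \<le> (1 + real n) powr \<beta>" using \<beta> by (intro powr_mono) auto
    also have "\<dots> \<le> C * (1 + real n) powr \<beta>" using mult_right_mono[OF C, of "(1 + real n) powr \<beta>"] by simp
    finally show "\<bar>real n\<bar> powr lam \<le> C * (1 + real n) powr \<beta>" .
  next
    fix m :: nat
    have "\<bar>1 / 2 ^ m\<bar> powr lam = 2 powr (- lam * real m)"
      by (simp add: powr_divide powr_realpow[symmetric] powr_powr powr_minus_divide mult.commute)
    also have "\<dots> \<le> 2 powr (- (lam / 2) * real m)" using lam by (intro powr_mono) (auto simp: mult_right_mono)
    also have "\<dots> = (r ^ 2) ^ m" by (simp add: r2 powr_realpow[symmetric] powr_powr)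
    also have "\<dots> \<le> C * (r ^ 2) ^ m" using mult_right_mono[OF C, of "(r ^ 2) ^ m"] by simp
    finally show "\<bar>1 / 2 ^ m\<bar> powr lam \<le> C * (r ^ 2) ^ m" .
  qed
  have tight_X: "\<forall>\<^sub>F c in at_top. \<exists>E\<in>X.events. 1 - D * (C / A) ^ (2 * p) \<le> X.prob E \<and>
      (\<forall>\<omega>\<in>E. (\<lambda>t. X (\<delta> c * t) \<omega> / \<sigma> (\<delta> c)) \<in> controlled_paths A \<beta>' r)" if A: "0 < A" for A
    using \<delta>_eventually[OF x1]
  proof eventually_elim
    case (elim c)
    then have d: "0 < \<delta> c" "\<delta> c \<le> x1" "0 < \<sigma> (\<delta> c)" by auto
    interpret C: gaussian_increments M "\<lambda>t \<omega>. X (\<delta> c * t) \<omega> / \<sigma> (\<delta> c)" "\<lambda>h. \<sigma> (\<bar>\<delta> c\<bar> * h) / \<sigma> (\<delta> c)"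
      using d by (intro X.time_change) auto
    show ?case
      unfolding D_def
    proof (rule C.prob_controlled_paths[OF A C0 r p(1,2) less_imp_le[OF \<beta>(3)] \<beta>(6)])
      show "\<sigma> (\<bar>\<delta> c\<bar> * real n) / \<sigma> (\<delta> c) \<le> C * (1 + real n) powr \<beta>" for n
        using multiples[OF d(1,2), of n] d by (simp add: pos_divide_le_eq)
      show "\<sigma> (\<bar>\<delta> c\<bar> * (1 / 2 ^ m)) / \<sigma> (\<delta> c) \<le> C * (r ^ 2) ^ m" for m
        using dyadic[OF d(1,2), of m] d unfolding r2 by (simp add: pos_divide_le_eq)
    qed
  qed
  let ?QX = "\<lambda>c \<omega>. \<lambda>t\<in>{0..}. buffer_content X c (\<delta> c * t) \<omega> / \<sigma> (\<delta> c)"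
  let ?QB = "\<lambda>\<omega>. \<lambda>t\<in>{0..}. buffer_content B 1 t \<omega>"
  have QX_meas: "?QX c \<in> M \<rightarrow>\<^sub>M borel_of_topology cont_path_topology" for c
    by (rule measurable_buffer_content[OF X.measurable_coordinate X.cont])
  have QB_meas: "?QB \<in> N \<rightarrow>\<^sub>M borel_of_topology cont_path_topology"
    using measurable_buffer_content[OF B.measurable_coordinate B.cont, where a = 1 and b = 1 and c = 1] by simp
  have space_paths: "space (borel_of_topology cont_path_topology) = cont_paths"
    unfolding borel_of_topology_def
    by (subst space_measure_of) (use openin_subset in \<open>auto simp: topspace_cont_path_topology[symmetric] simp del: topspace_cont_path_topology\<close>)
  have limit: "((\<lambda>c. \<integral>\<omega>. \<phi> (?QX c \<omega>) \<partial>M) \<longlongrightarrow> (\<integral>\<omega>. \<phi> (?QB \<omega>) \<partial>N)) at_top"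
    if \<phi>: "continuous_map cont_path_topology euclideanreal \<phi>" and bdd: "bounded (\<phi> ` topspace cont_path_topology)" for \<phi>
  proof -
    obtain b where b: "\<And>f. f \<in> cont_paths \<Longrightarrow> \<bar>\<phi> f\<bar> \<le> b"
      using bdd unfolding bounded_iff by auto
    have \<phi>_meas: "\<phi> \<in> borel_measurable (borel_of_topology cont_path_topology)"
      by (rule measurable_continuous_functional[OF \<phi>])
    show ?thesis
    proof (rule expectation_tendsto_of_characteristic_functions[OF assms(1,11), where
          Y = "\<lambda>c \<omega> t. X (\<delta> c * t) \<omega> / \<sigma> (\<delta> c)" and Z = "\<lambda>\<omega> t. B t \<omega>" and b = b])
      show "(\<lambda>\<omega>. X (\<delta> c * t) \<omega> / \<sigma> (\<delta> c)) \<in> borel_measurable M" for c t by measurable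
      show "(\<lambda>\<omega>. B t \<omega>) \<in> borel_measurable N" for t by measurable
      show "((\<lambda>c. \<integral>\<omega>. cos ((\<Sum>t\<in>J. a t * (X (\<delta> c * t) \<omega> / \<sigma> (\<delta> c))) + \<theta>) \<partial>M) \<longlongrightarrow>
          (\<integral>\<omega>. cos ((\<Sum>t\<in>J. a t * B t \<omega>) + \<theta>) \<partial>N)) at_top" if "finite J" for J a \<theta>
        by (rule X.characteristic_tendsto[OF B.gaussian_increments_axioms that _ _ std_lim])
           (use \<delta>_eventually[of 1] in \<open>auto elim!: eventually_mono\<close>)
      show "(\<lambda>\<omega>. \<phi> (?QX c \<omega>)) \<in> borel_measurable M" for c
        by (rule measurable_compose[OF QX_meas \<phi>_meas])
      show "(\<lambda>\<omega>. \<phi> (?QB \<omega>)) \<in> borel_measurable N"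
        by (rule measurable_compose[OF QB_meas \<phi>_meas])
      show "\<bar>\<phi> (?QX c \<omega>)\<bar> \<le> b" if "\<omega> \<in> space M" for c \<omega>
        using measurable_space[OF QX_meas that] unfolding space_paths by (rule b)
      show "\<bar>\<phi> (?QB \<omega>)\<bar> \<le> b" if "\<omega> \<in> space N" for \<omega>
        using measurable_space[OF QB_meas that] unfolding space_paths by (rule b)
      fix e :: real assume "0 < e"
      then obtain A where A: "0 < A" "D * (C / A) ^ (2 * p) \<le> e"
        using tightness_constant[OF C0 D _ p(3)] by blast
      let ?K = "controlled_paths A \<beta>' r" and ?g = "\<lambda>x. \<phi> (buffer_path x)"
      have A0: "0 \<le> A" using A(1) by simp
      note K = A0 r \<beta>(6,7)
      have K_paths: "buffer_path x \<in> cont_paths" if "x \<in> ?K" for x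
        unfolding buffer_path_def
        by (intro restrict_in_cont_paths continuous_buffer_level controlled_paths_continuous[OF K that])
      have QX_eq: "\<forall>\<^sub>F c in at_top. \<exists>E\<in>X.events. 1 - e \<le> X.prob E \<and>
          (\<forall>\<omega>\<in>E. (\<lambda>t. X (\<delta> c * t) \<omega> / \<sigma> (\<delta> c)) \<in> ?K \<and>
             \<phi> (?QX c \<omega>) = ?g (\<lambda>t. X (\<delta> c * t) \<omega> / \<sigma> (\<delta> c)))"
        using tight_X[OF A(1)] \<delta>_eventually[of 1, OF zero_less_one]
      proof eventually_elim
        case (elim c)
        then obtain E where E: "E \<in> X.events" "1 - D * (C / A) ^ (2 * p) \<le> X.prob E"
          and EK: "\<And>\<omega>. \<omega> \<in> E \<Longrightarrow> (\<lambda>t. X (\<delta> c * t) \<omega> / \<sigma> (\<delta> c)) \<in> ?K" by blast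
        have d: "0 < \<delta> c" "0 < \<sigma> (\<delta> c)" "c * \<delta> c = \<sigma> (\<delta> c)" using elim(2) by auto
        have "?QX c \<omega> = buffer_path (\<lambda>t. X (\<delta> c * t) \<omega> / \<sigma> (\<delta> c))" if "\<omega> \<in> E" for \<omega>
          unfolding buffer_path_def buffer_content_eq_level
          by (intro restrict_ext buffer_level_scaling d controlled_paths_buffer_bounded[OF K EK[OF that]])
        then show ?case using E EK A(2) by (intro bexI[of _ E] conjI ballI) auto
      qed
      have "\<exists>E\<in>B.events. 1 - e \<le> B.prob E \<and>
          (\<forall>\<omega>\<in>E. (\<lambda>t. B t \<omega>) \<in> ?K \<and> \<phi> (?QB \<omega>) = ?g (\<lambda>t. B t \<omega>))"
      proof -
        obtain E where "E \<in> B.events" "1 - D * (C / A) ^ (2 * p) \<le> B.prob E"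
          "\<forall>\<omega>\<in>E. (\<lambda>t. B t \<omega>) \<in> ?K"
          using tight_B[OF A(1)] by blast
        then show ?thesis
          using A(2) by (intro bexI[of _ E]) (auto simp: buffer_path_def buffer_content_eq_level)
      qed
      then show "\<exists>K g. compact K \<and> continuous_on K g \<and> (\<forall>x\<in>K. \<bar>g x\<bar> \<le> b) \<and>
         (\<forall>\<^sub>F c in at_top. \<exists>E\<in>sets M. 1 - e \<le> measure M E \<and>
            (\<forall>\<omega>\<in>E. (\<lambda>t. X (\<delta> c * t) \<omega> / \<sigma> (\<delta> c)) \<in> K \<and> \<phi> (?QX c \<omega>) = g (\<lambda>t. X (\<delta> c * t) \<omega> / \<sigma> (\<delta> c)))) \<and>
         (\<exists>E\<in>sets N. 1 - e \<le> measure N E \<and> (\<forall>\<omega>\<in>E. (\<lambda>t. B t \<omega>) \<in> K \<and> \<phi> (?QB \<omega>) = g (\<lambda>t. B t \<omega>)))"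
        using compact_controlled_paths[OF A0 r \<beta>(6)] continuous_on_buffer_functional[OF K \<phi>] QX_eq b K_paths
        by (intro exI[of _ ?K] exI[of _ ?g] conjI ballI) auto
    qed
  qed
  show ?thesis
    unfolding converges_in_distribution_def using QX_meas QB_meas limit by auto
qed

end
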